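(* The theory $T$ of (non-degenerate) open projective planes is complete.
   Context: Structures are in a two-sorted language $L$ with sorts $S_1$ (points), $S_2$ (lines) and a binary point–line incidence relation $I$. A partial plane is a system of points and lines such that any two distinct points are incident with at most one common line, and any two distinct lines are incident with at most one common point. A projective plane is a partial plane in which any two distinct points lie on exactly one common line and any two distinct lines meet in exactly one common point; it is non-degenerate if it contains a quadrangle, i.e. four points no three of which are collinear. A subconfiguration of a partial plane $P$ is a subset $P'$ of $P$ with the induced points, lines and incidence. A partial plane $P$ is open if there is no finite subconfiguration $A$ of $P$ such that every element of $A$ is incident with at least three elements of $A$. $T$ denotes the $L$-theory of non-degenerate open projective planes (openness is first-order, being expressed by forbidding finite configurations). *)

theory Defs
  imports Main
begin

section \<open>Incidence structures\<close>

record ('p, 'l) incidence_structure =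
  points :: "'p set"
  lines :: "'l set"
  incid :: "('p \<times> 'l) set"

definition incidence_system :: "('p, 'l) incidence_structure \<Rightarrow> bool" where
  "incidence_system M \<longleftrightarrow> incid M \<subseteq> points M \<times> lines M"

definition partial_plane :: "('p, 'l) incidence_structure \<Rightarrow> bool" where
  "partial_plane M \<longleftrightarrow> incidence_system M \<and>
     (\<forall>p\<in>points M. \<forall>q\<in>points M. p \<noteq> q \<longrightarrow>
        (\<forall>l\<in>lines M. \<forall>k\<in>lines M.
           (p, l) \<in> incid M \<and> (q, l) \<in> incid M \<and> (p, k) \<in> incid M \<and> (q, k) \<in> incid M \<longrightarrow> l = k)) \<and>
     (\<forall>l\<in>lines M. \<forall>k\<in>lines M. l \<noteq> k \<longrightarrow>
        (\<forall>p\<in>points M. \<forall>q\<in>points M.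
           (p, l) \<in> incid M \<and> (p, k) \<in> incid M \<and> (q, l) \<in> incid M \<and> (q, k) \<in> incid M \<longrightarrow> p = q))"

definition projective_plane :: "('p, 'l) incidence_structure \<Rightarrow> bool" where
  "projective_plane M \<longleftrightarrow> partial_plane M \<and>
     (\<forall>p\<in>points M. \<forall>q\<in>points M. p \<noteq> q \<longrightarrow>
        (\<exists>!l. l \<in> lines M \<and> (p, l) \<in> incid M \<and> (q, l) \<in> incid M)) \<and>
     (\<forall>l\<in>lines M. \<forall>k\<in>lines M. l \<noteq> k \<longrightarrow>
        (\<exists>!p. p \<in> points M \<and> (p, l) \<in> incid M \<and> (p, k) \<in> incid M))"

definition collinear3 :: "('p, 'l) incidence_structure \<Rightarrow> 'p \<Rightarrow> 'p \<Rightarrow> 'p \<Rightarrow> bool" where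
  "collinear3 M p q r \<longleftrightarrow>
     (\<exists>l\<in>lines M. (p, l) \<in> incid M \<and> (q, l) \<in> incid M \<and> (r, l) \<in> incid M)"

definition nondegenerate :: "('p, 'l) incidence_structure \<Rightarrow> bool" where
  "nondegenerate M \<longleftrightarrow>
     (\<exists>p\<in>points M. \<exists>q\<in>points M. \<exists>r\<in>points M. \<exists>s\<in>points M. distinct [p, q, r, s] \<and>
        \<not> collinear3 M p q r \<and> \<not> collinear3 M p q s \<and>
        \<not> collinear3 M p r s \<and> \<not> collinear3 M q r s)"

definition subconfiguration ::
  "('p, 'l) incidence_structure \<Rightarrow> ('p, 'l) incidence_structure \<Rightarrow> bool" where
  "subconfiguration A M \<longleftrightarrow> points A \<subseteq> points M \<and> lines A \<subseteq> lines M \<and>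
     incid A = incid M \<inter> (points A \<times> lines A)"

text \<open>
  Finite configurations all of whose elements are incident with at least three of its
  elements. Nonemptiness is explicit: the empty configuration vacuously satisfies
  the incidence condition and would otherwise rule out every partial plane.
\<close>

definition confined :: "('p, 'l) incidence_structure \<Rightarrow> bool" where
  "confined A \<longleftrightarrow>
     finite (points A) \<and> finite (lines A) \<and> (points A \<noteq> {} \<or> lines A \<noteq> {}) \<and>
     (\<forall>p\<in>points A. 3 \<le> card {l \<in> lines A. (p, l) \<in> incid A}) \<and>
     (\<forall>l\<in>lines A. 3 \<le> card {p \<in> points A. (p, l) \<in> incid A})"

definition open_plane :: "('p, 'l) incidence_structure \<Rightarrow> bool" where
  "open_plane M \<longleftrightarrow> partial_plane M \<and> \<not> (\<exists>A. subconfiguration A M \<and> confined A)"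


section \<open>The two-sorted language\<close>

text \<open>
  Point variables and line variables form two disjoint families, each indexed by the
  natural numbers; \<open>ExP i\<close> binds the \<open>i\<close>-th point variable and \<open>ExL i\<close> the \<open>i\<close>-th
  line variable.
\<close>

datatype fm =
    EqP nat nat
  | EqL nat nat
  | Inc nat nat
  | Neg fm
  | Con fm fm
  | ExP nat fm
  | ExL nat fm

abbreviation Imp :: "fm \<Rightarrow> fm \<Rightarrow> fm" where
  "Imp \<phi> \<psi> \<equiv> Neg (Con \<phi> (Neg \<psi>))"

abbreviation AllP :: "nat \<Rightarrow> fm \<Rightarrow> fm" where
  "AllP i \<phi> \<equiv> Neg (ExP i (Neg \<phi>))"

abbreviation AllL :: "nat \<Rightarrow> fm \<Rightarrow> fm" where
  "AllL i \<phi> \<equiv> Neg (ExL i (Neg \<phi>))"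

abbreviation Verum :: fm where
  "Verum \<equiv> AllP 0 (EqP 0 0)"

definition Conj :: "fm list \<Rightarrow> fm" where
  "Conj \<phi>s = foldr Con \<phi>s Verum"

fun free_pvars :: "fm \<Rightarrow> nat set" where
  "free_pvars (EqP i j) = {i, j}"
| "free_pvars (EqL i j) = {}"
| "free_pvars (Inc i j) = {i}"
| "free_pvars (Neg \<phi>) = free_pvars \<phi>"
| "free_pvars (Con \<phi> \<psi>) = free_pvars \<phi> \<union> free_pvars \<psi>"
| "free_pvars (ExP i \<phi>) = free_pvars \<phi> - {i}"
| "free_pvars (ExL i \<phi>) = free_pvars \<phi>"

fun free_lvars :: "fm \<Rightarrow> nat set" where
  "free_lvars (EqP i j) = {}"
| "free_lvars (EqL i j) = {i, j}"
| "free_lvars (Inc i j) = {j}"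
| "free_lvars (Neg \<phi>) = free_lvars \<phi>"
| "free_lvars (Con \<phi> \<psi>) = free_lvars \<phi> \<union> free_lvars \<psi>"
| "free_lvars (ExP i \<phi>) = free_lvars \<phi>"
| "free_lvars (ExL i \<phi>) = free_lvars \<phi> - {i}"

definition sentence :: "fm \<Rightarrow> bool" where
  "sentence \<phi> \<longleftrightarrow> free_pvars \<phi> = {} \<and> free_lvars \<phi> = {}"

definition L_structure :: "('p, 'l) incidence_structure \<Rightarrow> bool" where
  "L_structure M \<longleftrightarrow> incidence_system M \<and> points M \<noteq> {} \<and> lines M \<noteq> {}"

fun sat :: "('p, 'l) incidence_structure \<Rightarrow> (nat \<Rightarrow> 'p) \<Rightarrow> (nat \<Rightarrow> 'l) \<Rightarrow> fm \<Rightarrow> bool" where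
  "sat M e h (EqP i j) \<longleftrightarrow> e i = e j"
| "sat M e h (EqL i j) \<longleftrightarrow> h i = h j"
| "sat M e h (Inc i j) \<longleftrightarrow> (e i, h j) \<in> incid M"
| "sat M e h (Neg \<phi>) \<longleftrightarrow> \<not> sat M e h \<phi>"
| "sat M e h (Con \<phi> \<psi>) \<longleftrightarrow> sat M e h \<phi> \<and> sat M e h \<psi>"
| "sat M e h (ExP i \<phi>) \<longleftrightarrow> (\<exists>p\<in>points M. sat M (e(i := p)) h \<phi>)"
| "sat M e h (ExL i \<phi>) \<longleftrightarrow> (\<exists>l\<in>lines M. sat M e (h(i := l)) \<phi>)"

definition holds :: "('p, 'l) incidence_structure \<Rightarrow> fm \<Rightarrow> bool" where
  "holds M \<phi> \<longleftrightarrow> (\<forall>e h. range e \<subseteq> points M \<and> range h \<subseteq> lines M \<longrightarrow> sat M e h \<phi>)"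

definition model_of :: "('p, 'l) incidence_structure \<Rightarrow> fm set \<Rightarrow> bool" where
  "model_of M T \<longleftrightarrow> L_structure M \<and> (\<forall>\<phi>\<in>T. holds M \<phi>)"


section \<open>Complete theories\<close>

text \<open>
  Models are taken with carriers in a pair of types \<open>'p\<close>, \<open>'l\<close>, passed as a type argument,
  since HOL cannot quantify over types inside a formula. Carriers are arbitrary subsets of
  these types, so a statement that is polymorphic in \<open>'p\<close> and \<open>'l\<close> covers all structures;
  models living in different types are compared by embedding both into the sum types, see
  \<open>complete_elementarily_equivalent\<close> below. For infinite \<open>'p\<close> and \<open>'l\<close> having a model in
  these types is plain satisfiability, by the Loewenheim-Skolem theorem (the language is
  countable); in finite types a theory with only infinite models would count as inconsistent.
\<close>

definition consistent :: "('p \<times> 'l) itself \<Rightarrow> fm set \<Rightarrow> bool" where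
  "consistent _ T \<longleftrightarrow> (\<exists>M :: ('p, 'l) incidence_structure. model_of M T)"

definition entails :: "('p \<times> 'l) itself \<Rightarrow> fm set \<Rightarrow> fm \<Rightarrow> bool" where
  "entails _ T \<phi> \<longleftrightarrow> (\<forall>M :: ('p, 'l) incidence_structure. model_of M T \<longrightarrow> holds M \<phi>)"

definition complete_theory :: "('p \<times> 'l) itself \<Rightarrow> fm set \<Rightarrow> bool" where
  "complete_theory U T \<longleftrightarrow>
     consistent U T \<and> (\<forall>\<phi>. sentence \<phi> \<longrightarrow> entails U T \<phi> \<or> entails U T (Neg \<phi>))"


section \<open>The theory of non-degenerate open projective planes\<close>

definition join_axiom :: fm where
  "join_axiom =
     AllP 0 (AllP 1 (Imp (Neg (EqP 0 1))
       (ExL 0 (Con (Con (Inc 0 0) (Inc 1 0))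
         (AllL 1 (Imp (Con (Inc 0 1) (Inc 1 1)) (EqL 1 0)))))))"

definition meet_axiom :: fm where
  "meet_axiom =
     AllL 0 (AllL 1 (Imp (Neg (EqL 0 1))
       (ExP 0 (Con (Con (Inc 0 0) (Inc 0 1))
         (AllP 1 (Imp (Con (Inc 1 0) (Inc 1 1)) (EqP 1 0)))))))"

definition noncollinear_fm :: "nat \<Rightarrow> nat \<Rightarrow> nat \<Rightarrow> fm" where
  "noncollinear_fm i j k = Neg (ExL 0 (Con (Inc i 0) (Con (Inc j 0) (Inc k 0))))"

definition quadrangle_axiom :: fm where
  "quadrangle_axiom =
     ExP 0 (ExP 1 (ExP 2 (ExP 3 (Conj (
       [Neg (EqP 0 1), Neg (EqP 0 2), Neg (EqP 0 3),
        Neg (EqP 1 2), Neg (EqP 1 3), Neg (EqP 2 3),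
        noncollinear_fm 0 1 2, noncollinear_fm 0 1 3,
        noncollinear_fm 0 2 3, noncollinear_fm 1 2 3])))))"

definition diagram :: "nat \<Rightarrow> nat \<Rightarrow> (nat \<times> nat) set \<Rightarrow> fm" where
  "diagram m n E = Conj (
     [Neg (EqP i j). i \<leftarrow> [0..<m], j \<leftarrow> [0..<i]] @
     [Neg (EqL i j). i \<leftarrow> [0..<n], j \<leftarrow> [0..<i]] @
     [if (i, j) \<in> E then Inc i j else Neg (Inc i j). i \<leftarrow> [0..<m], j \<leftarrow> [0..<n]])"

text \<open>No subconfiguration is isomorphic to the one with points \<open>{..<m}\<close>, lines \<open>{..<n}\<close>
  and incidence \<open>E\<close>.\<close>

definition forbid_axiom :: "nat \<Rightarrow> nat \<Rightarrow> (nat \<times> nat) set \<Rightarrow> fm" where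
  "forbid_axiom m n E = Neg (foldr ExP [0..<m] (foldr ExL [0..<n] (diagram m n E)))"

definition open_projective_planes_theory :: "fm set" where
  "open_projective_planes_theory =
     {join_axiom, meet_axiom, quadrangle_axiom} \<union>
     {forbid_axiom m n E | m n E. E \<subseteq> {..<m} \<times> {..<n} \<and>
        confined \<lparr>points = {..<m}, lines = {..<n}, incid = E\<rparr>}"


section \<open>Adequacy of the axiomatization\<close>

lemma free_vars_Conj:
  "free_pvars (Conj \<phi>s) = (\<Union>\<phi>\<in>set \<phi>s. free_pvars \<phi>)"
  "free_lvars (Conj \<phi>s) = (\<Union>\<phi>\<in>set \<phi>s. free_lvars \<phi>)"
  unfolding Conj_def by (induction \<phi>s) auto

lemma free_vars_foldr_ExP:
  "free_pvars (foldr ExP is \<phi>) = free_pvars \<phi> - set is"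
  "free_lvars (foldr ExP is \<phi>) = free_lvars \<phi>"
  by (induction "is") auto

lemma free_vars_foldr_ExL:
  "free_pvars (foldr ExL is \<phi>) = free_pvars \<phi>"
  "free_lvars (foldr ExL is \<phi>) = free_lvars \<phi> - set is"
  by (induction "is") auto

lemma sentence_open_projective_planes_theory:
  "\<phi> \<in> open_projective_planes_theory \<Longrightarrow> sentence \<phi>"
  unfolding open_projective_planes_theory_def sentence_def
  by (auto simp: join_axiom_def meet_axiom_def quadrangle_axiom_def noncollinear_fm_def
      forbid_axiom_def diagram_def free_vars_Conj free_vars_foldr_ExP free_vars_foldr_ExL
      split: if_splits)

lemma sat_Conj: "sat M e h (Conj \<phi>s) \<longleftrightarrow> (\<forall>\<phi>\<in>set \<phi>s. sat M e h \<phi>)"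
  unfolding Conj_def by (induction \<phi>s) auto

lemma sat_cong:
  "(\<And>i. i \<in> free_pvars \<phi> \<Longrightarrow> e i = e' i) \<Longrightarrow> (\<And>i. i \<in> free_lvars \<phi> \<Longrightarrow> h i = h' i) \<Longrightarrow>
   sat M e h \<phi> \<longleftrightarrow> sat M e' h' \<phi>"
proof (induction \<phi> arbitrary: e e' h h')
  case (ExP i \<phi>)
  have "sat M (e(i := p)) h \<phi> \<longleftrightarrow> sat M (e'(i := p)) h' \<phi>" for p
    by (rule ExP.IH) (use ExP.prems in auto)
  then show ?case by simp
next
  case (ExL i \<phi>)
  have "sat M e (h(i := l)) \<phi> \<longleftrightarrow> sat M e' (h'(i := l)) \<phi>" for l
    by (rule ExL.IH) (use ExL.prems in auto)
  then show ?case by simp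
next
  case (Neg \<phi>)
  have "sat M e h \<phi> \<longleftrightarrow> sat M e' h' \<phi>" by (rule Neg.IH) (use Neg.prems in auto)
  then show ?case by simp
next
  case (Con \<phi> \<psi>)
  have "sat M e h \<phi> \<longleftrightarrow> sat M e' h' \<phi>" "sat M e h \<psi> \<longleftrightarrow> sat M e' h' \<psi>"
    by (rule Con.IH; use Con.prems in auto)+
  then show ?case by simp
qed auto

lemma holds_sentence:
  assumes "L_structure M" "sentence \<phi>" "range e \<subseteq> points M" "range h \<subseteq> lines M"
  shows "holds M \<phi> \<longleftrightarrow> sat M e h \<phi>"
  using assms sat_cong[of \<phi>] unfolding holds_def sentence_def by (metis empty_iff)

lemma L_structure_assignment:
  fixes M :: "('p, 'l) incidence_structure"
  assumes "L_structure M"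
  obtains e :: "nat \<Rightarrow> 'p" and h :: "nat \<Rightarrow> 'l" where "range e \<subseteq> points M" "range h \<subseteq> lines M"
proof -
  from assms obtain p l where "p \<in> points M" "l \<in> lines M" unfolding L_structure_def by blast
  then show thesis by (intro that[of "\<lambda>_. p" "\<lambda>_. l"]) auto
qed

lemma holds_Neg:
  assumes "L_structure M" "sentence \<phi>"
  shows "holds M (Neg \<phi>) \<longleftrightarrow> \<not> holds M \<phi>"
proof -
  obtain e :: "nat \<Rightarrow> _" and h :: "nat \<Rightarrow> _"
      where eh: "range e \<subseteq> points M" "range h \<subseteq> lines M"
    using L_structure_assignment[OF assms(1)] by blast
  have "sentence (Neg \<phi>)" using assms(2) by (simp add: sentence_def)
  then show ?thesis
    using assms holds_sentence[of M _ e h] eh by simp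
qed

lemma sat_foldr_ExP:
  "sat M e h (foldr ExP [0..<m] \<phi>) \<longleftrightarrow>
   (\<exists>e'. (\<forall>i<m. e' i \<in> points M) \<and> sat M (\<lambda>i. if i < m then e' i else e i) h \<phi>)"
proof (induction m arbitrary: \<phi>)
  case (Suc m)
  have "sat M e h (foldr ExP [0..<Suc m] \<phi>) \<longleftrightarrow>
    (\<exists>e'. (\<forall>i<m. e' i \<in> points M) \<and>
       (\<exists>p\<in>points M. sat M ((\<lambda>i. if i < m then e' i else e i)(m := p)) h \<phi>))"
    by (simp add: Suc.IH)
  also have "\<dots> \<longleftrightarrow> (\<exists>e'. (\<forall>i<Suc m. e' i \<in> points M) \<and>
       sat M (\<lambda>i. if i < Suc m then e' i else e i) h \<phi>)" (is "?A \<longleftrightarrow> ?B")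
  proof
    assume ?A
    then obtain e' p where "\<forall>i<m. e' i \<in> points M" "p \<in> points M"
      "sat M ((\<lambda>i. if i < m then e' i else e i)(m := p)) h \<phi>" by blast
    moreover have "(\<lambda>i. if i < m then e' i else e i)(m := p) =
      (\<lambda>i. if i < Suc m then (e'(m := p)) i else e i)" by auto
    ultimately show ?B by (intro exI[of _ "e'(m := p)"]) (auto simp: less_Suc_eq)
  next
    assume ?B
    then obtain e' where "\<forall>i<Suc m. e' i \<in> points M"
      "sat M (\<lambda>i. if i < Suc m then e' i else e i) h \<phi>" by blast
    moreover have "(\<lambda>i. if i < Suc m then e' i else e i) =
      (\<lambda>i. if i < m then e' i else e i)(m := e' m)" by auto
    ultimately show ?A by (intro exI[of _ e']) auto
  qed
  finally show ?case .
qed simp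

lemma sat_foldr_ExL:
  "sat M e h (foldr ExL [0..<n] \<phi>) \<longleftrightarrow>
   (\<exists>h'. (\<forall>i<n. h' i \<in> lines M) \<and> sat M e (\<lambda>i. if i < n then h' i else h i) \<phi>)"
proof (induction n arbitrary: \<phi>)
  case (Suc n)
  have "sat M e h (foldr ExL [0..<Suc n] \<phi>) \<longleftrightarrow>
    (\<exists>h'. (\<forall>i<n. h' i \<in> lines M) \<and>
       (\<exists>l\<in>lines M. sat M e ((\<lambda>i. if i < n then h' i else h i)(n := l)) \<phi>))"
    by (simp add: Suc.IH)
  also have "\<dots> \<longleftrightarrow> (\<exists>h'. (\<forall>i<Suc n. h' i \<in> lines M) \<and>
       sat M e (\<lambda>i. if i < Suc n then h' i else h i) \<phi>)" (is "?A \<longleftrightarrow> ?B")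
  proof
    assume ?A
    then obtain h' l where "\<forall>i<n. h' i \<in> lines M" "l \<in> lines M"
      "sat M e ((\<lambda>i. if i < n then h' i else h i)(n := l)) \<phi>" by blast
    moreover have "(\<lambda>i. if i < n then h' i else h i)(n := l) =
      (\<lambda>i. if i < Suc n then (h'(n := l)) i else h i)" by auto
    ultimately show ?B by (intro exI[of _ "h'(n := l)"]) (auto simp: less_Suc_eq)
  next
    assume ?B
    then obtain h' where "\<forall>i<Suc n. h' i \<in> lines M"
      "sat M e (\<lambda>i. if i < Suc n then h' i else h i) \<phi>" by blast
    moreover have "(\<lambda>i. if i < Suc n then h' i else h i) =
      (\<lambda>i. if i < n then h' i else h i)(n := h' n)" by auto
    ultimately show ?A by (intro exI[of _ h']) auto
  qed
  finally show ?case .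
qed simp

lemma inj_on_lessThan_iff:
  fixes e :: "nat \<Rightarrow> 'a"
  shows "inj_on e {..<m} \<longleftrightarrow> (\<forall>i<m. \<forall>j<i. e i \<noteq> e j)"
proof
  assume "inj_on e {..<m}"
  then show "\<forall>i<m. \<forall>j<i. e i \<noteq> e j" by (auto dest: inj_onD)
next
  assume "\<forall>i<m. \<forall>j<i. e i \<noteq> e j"
  then show "inj_on e {..<m}" by (intro linorder_inj_onI) force+
qed

lemma sat_diagram:
  "sat M e h (diagram m n E) \<longleftrightarrow>
   inj_on e {..<m} \<and> inj_on h {..<n} \<and>
   (\<forall>i<m. \<forall>j<n. (e i, h j) \<in> incid M \<longleftrightarrow> (i, j) \<in> E)"
proof -
  have ball: "(\<forall>\<psi>\<in>set [f i j. i \<leftarrow> is, j \<leftarrow> js i]. P \<psi>) \<longleftrightarrow> (\<forall>i\<in>set is. \<forall>j\<in>set (js i). P (f i j))"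
    for f :: "nat \<Rightarrow> nat \<Rightarrow> fm" and "is" js P
    by auto
  have lit: "sat M e h (if c then \<phi> else Neg \<phi>) \<longleftrightarrow> (sat M e h \<phi> \<longleftrightarrow> c)" for c \<phi>
    by simp
  show ?thesis
    unfolding diagram_def sat_Conj inj_on_lessThan_iff set_append ball_Un ball lit
    by (simp add: Ball_def)
qed

lemma sat_forbid_axiom:
  "sat M e h (forbid_axiom m n E) \<longleftrightarrow>
   \<not> (\<exists>e h. e ` {..<m} \<subseteq> points M \<and> h ` {..<n} \<subseteq> lines M \<and> inj_on e {..<m} \<and> inj_on h {..<n} \<and>
        (\<forall>i<m. \<forall>j<n. (e i, h j) \<in> incid M \<longleftrightarrow> (i, j) \<in> E))"
proof -
  have inj: "inj_on (\<lambda>i. if i < k then f i else g i) {..<k} \<longleftrightarrow> inj_on f {..<k}"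
    for f g :: "nat \<Rightarrow> 'x" and k
    by (rule inj_on_cong) simp
  show ?thesis
    unfolding forbid_axiom_def sat.simps sat_foldr_ExP sat_foldr_ExL sat_diagram inj
      image_subset_iff
    by (simp add: Ball_def cong: conj_cong)
qed

text \<open>Invariance of \<open>confined\<close> under isomorphism.\<close>

lemma confined_iso:
  assumes e: "bij_betw e (points A) (points B)" and h: "bij_betw h (lines A) (lines B)"
    and I: "\<And>p l. p \<in> points A \<Longrightarrow> l \<in> lines A \<Longrightarrow> (e p, h l) \<in> incid B \<longleftrightarrow> (p, l) \<in> incid A"
  shows "confined A \<longleftrightarrow> confined B"
proof -
  have P: "points B = e ` points A" and L: "lines B = h ` lines A"
    and ie: "inj_on e (points A)" and ih: "inj_on h (lines A)"
    using e h by (auto simp: bij_betw_def)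
  have "{l \<in> lines B. (e p, l) \<in> incid B} = h ` {l \<in> lines A. (p, l) \<in> incid A}"
    if "p \<in> points A" for p
    using that I L by auto
  then have 1: "card {l \<in> lines B. (e p, l) \<in> incid B} = card {l \<in> lines A. (p, l) \<in> incid A}"
    if "p \<in> points A" for p
    using that ih by (metis (no_types, lifting) card_image inj_on_subset mem_Collect_eq subsetI)
  have "{p \<in> points B. (p, h l) \<in> incid B} = e ` {p \<in> points A. (p, l) \<in> incid A}"
    if "l \<in> lines A" for l
    using that I P by auto
  then have 2: "card {p \<in> points B. (p, h l) \<in> incid B} = card {p \<in> points A. (p, l) \<in> incid A}"
    if "l \<in> lines A" for l
    using that ie by (metis (no_types, lifting) card_image inj_on_subset mem_Collect_eq subsetI)
  have 3: "finite (points B) = finite (points A)" "finite (lines B) = finite (lines A)"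
    using e h bij_betw_finite by blast+
  have 4: "(\<forall>p\<in>points B. 3 \<le> card {l \<in> lines B. (p, l) \<in> incid B}) \<longleftrightarrow>
    (\<forall>p\<in>points A. 3 \<le> card {l \<in> lines A. (p, l) \<in> incid A})"
    using 1 unfolding P by simp
  have 5: "(\<forall>l\<in>lines B. 3 \<le> card {p \<in> points B. (p, l) \<in> incid B}) \<longleftrightarrow>
    (\<forall>l\<in>lines A. 3 \<le> card {p \<in> points A. (p, l) \<in> incid A})"
    using 2 unfolding L by simp
  have 6: "points B = {} \<longleftrightarrow> points A = {}" "lines B = {} \<longleftrightarrow> lines A = {}"
    by (simp_all add: P L)
  show ?thesis
    unfolding confined_def 3 4 5 6 ..
qed

lemma forbid_axioms_iff:
  "(\<forall>m n E. E \<subseteq> {..<m} \<times> {..<n} \<and>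
        confined \<lparr>points = {..<m}, lines = {..<n}, incid = E\<rparr> \<longrightarrow>
        sat M e0 h0 (forbid_axiom m n E)) \<longleftrightarrow>
   \<not> (\<exists>A. subconfiguration A M \<and> confined A)" (is "?L \<longleftrightarrow> ?R")
proof
  assume L: ?L
  show ?R
  proof
    assume "\<exists>A. subconfiguration A M \<and> confined A"
    then obtain A where A: "subconfiguration A M" "confined A" by blast
    then have "finite (points A)" "finite (lines A)" by (auto simp: confined_def)
    then obtain e :: "nat \<Rightarrow> _" and h :: "nat \<Rightarrow> _" and m n
      where e: "bij_betw e {..<m} (points A)" and h: "bij_betw h {..<n} (lines A)"
      using ex_bij_betw_nat_finite[of "points A"] ex_bij_betw_nat_finite[of "lines A"]
      unfolding atLeast0LessThan by blast
    define E where "E = {(i, j). i < m \<and> j < n \<and> (e i, h j) \<in> incid A}"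
    let ?B = "\<lparr>points = {..<m}, lines = {..<n}, incid = E\<rparr>"
    have "confined ?B \<longleftrightarrow> confined A"
      by (rule confined_iso[of e _ _ h]) (use e h in \<open>auto simp: E_def\<close>)
    moreover have "E \<subseteq> {..<m} \<times> {..<n}" by (auto simp: E_def)
    ultimately have "sat M e0 h0 (forbid_axiom m n E)" using L A by blast
    moreover have "e ` {..<m} = points A" "h ` {..<n} = lines A"
      "inj_on e {..<m}" "inj_on h {..<n}"
      using e h by (auto simp: bij_betw_def)
    moreover have "(e i, h j) \<in> incid M \<longleftrightarrow> (i, j) \<in> E" if "i < m" "j < n" for i j
      using that A \<open>e ` {..<m} = points A\<close> \<open>h ` {..<n} = lines A\<close>
      by (auto simp: E_def subconfiguration_def)
    moreover have "points A \<subseteq> points M" "lines A \<subseteq> lines M"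
      using A by (auto simp: subconfiguration_def)
    ultimately show False unfolding sat_forbid_axiom by blast
  qed
next
  assume R: ?R
  show ?L
  proof (intro allI impI, elim conjE)
    fix m n :: nat and E
    assume E: "E \<subseteq> {..<m} \<times> {..<n}"
      and c: "confined \<lparr>points = {..<m}, lines = {..<n}, incid = E\<rparr>"
    show "sat M e0 h0 (forbid_axiom m n E)"
      unfolding sat_forbid_axiom
    proof
      assume "\<exists>e h. e ` {..<m} \<subseteq> points M \<and> h ` {..<n} \<subseteq> lines M \<and>
        inj_on e {..<m} \<and> inj_on h {..<n} \<and>
        (\<forall>i<m. \<forall>j<n. (e i, h j) \<in> incid M \<longleftrightarrow> (i, j) \<in> E)"
      then obtain e h where eh: "e ` {..<m} \<subseteq> points M" "h ` {..<n} \<subseteq> lines M"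
        "inj_on e {..<m}" "inj_on h {..<n}"
        "\<forall>i<m. \<forall>j<n. (e i, h j) \<in> incid M \<longleftrightarrow> (i, j) \<in> E" by blast
      let ?A = "\<lparr>points = e ` {..<m}, lines = h ` {..<n},
        incid = incid M \<inter> (e ` {..<m} \<times> h ` {..<n})\<rparr>"
      have "subconfiguration ?A M" using eh by (simp add: subconfiguration_def)
      moreover have "confined \<lparr>points = {..<m}, lines = {..<n}, incid = E\<rparr> \<longleftrightarrow>
        confined ?A"
        by (rule confined_iso[of e _ _ h]) (use eh in \<open>auto simp: bij_betw_def\<close>)
      ultimately show False using R c by blast
    qed
  qed
qed

lemma model_of_open_projective_planes_theory:
  "model_of M open_projective_planes_theory \<longleftrightarrow>
   projective_plane M \<and> nondegenerate M \<and> open_plane M"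
proof -
  have struct: "L_structure M" if "projective_plane M" "nondegenerate M"
  proof -
    from that(2) obtain p q where "p \<in> points M" "q \<in> points M" "p \<noteq> q"
      unfolding nondegenerate_def by auto
    moreover from this that(1) have "lines M \<noteq> {}" unfolding projective_plane_def by blast
    ultimately show ?thesis
      using that(1) unfolding L_structure_def projective_plane_def partial_plane_def by blast
  qed
  have main: "(\<forall>\<phi>\<in>open_projective_planes_theory. holds M \<phi>) \<longleftrightarrow>
    projective_plane M \<and> nondegenerate M \<and> open_plane M" if M: "L_structure M"
  proof -
    obtain e :: "nat \<Rightarrow> _" and h :: "nat \<Rightarrow> _"
      where eh: "range e \<subseteq> points M" "range h \<subseteq> lines M"
      using L_structure_assignment[OF M] by blast
    have ex1: "(\<exists>!x. x \<in> X \<and> P x \<and> Q x) \<longleftrightarrow>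
      (\<exists>x\<in>X. (P x \<and> Q x) \<and> (\<forall>y\<in>X. P y \<and> Q y \<longrightarrow> y = x))" for X :: "'x set" and P Q
      by blast
    have sys: "incidence_system M" using M by (simp add: L_structure_def)
    have "(\<forall>\<phi>\<in>open_projective_planes_theory. holds M \<phi>) \<longleftrightarrow>
      (\<forall>\<phi>\<in>open_projective_planes_theory. sat M e h \<phi>)"
      using M eh holds_sentence sentence_open_projective_planes_theory by blast
    also have "\<dots> \<longleftrightarrow> sat M e h join_axiom \<and> sat M e h meet_axiom \<and> sat M e h quadrangle_axiom \<and>
      \<not> (\<exists>A. subconfiguration A M \<and> confined A)"
      unfolding forbid_axioms_iff[of M e h, symmetric] open_projective_planes_theory_def by blast
    also have "sat M e h quadrangle_axiom \<longleftrightarrow> nondegenerate M"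
      unfolding quadrangle_axiom_def nondegenerate_def noncollinear_fm_def collinear3_def
      by (simp add: sat_Conj)
    also have "sat M e h join_axiom \<longleftrightarrow> (\<forall>p\<in>points M. \<forall>q\<in>points M. p \<noteq> q \<longrightarrow>
        (\<exists>!l. l \<in> lines M \<and> (p, l) \<in> incid M \<and> (q, l) \<in> incid M))"
      unfolding join_axiom_def ex1 by simp blast
    also have "sat M e h meet_axiom \<longleftrightarrow> (\<forall>l\<in>lines M. \<forall>k\<in>lines M. l \<noteq> k \<longrightarrow>
        (\<exists>!p. p \<in> points M \<and> (p, l) \<in> incid M \<and> (p, k) \<in> incid M))"
      unfolding meet_axiom_def ex1 by simp blast
    finally have *: "(\<forall>\<phi>\<in>open_projective_planes_theory. holds M \<phi>) \<longleftrightarrow>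
      (\<forall>p\<in>points M. \<forall>q\<in>points M. p \<noteq> q \<longrightarrow>
        (\<exists>!l. l \<in> lines M \<and> (p, l) \<in> incid M \<and> (q, l) \<in> incid M)) \<and>
      (\<forall>l\<in>lines M. \<forall>k\<in>lines M. l \<noteq> k \<longrightarrow>
        (\<exists>!p. p \<in> points M \<and> (p, l) \<in> incid M \<and> (p, k) \<in> incid M)) \<and>
      nondegenerate M \<and> \<not> (\<exists>A. subconfiguration A M \<and> confined A)"
      (is "_ \<longleftrightarrow> ?J \<and> ?K \<and> _") .
    have "partial_plane M" if ?J ?K
      unfolding partial_plane_def using that sys by blast
    then show ?thesis unfolding * projective_plane_def open_plane_def by blast
  qed
  show ?thesis using struct main unfolding model_of_def by blast
qed


section \<open>Independence of the carrier types\<close>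

definition map_structure ::
  "('p \<Rightarrow> 'q) \<Rightarrow> ('l \<Rightarrow> 'k) \<Rightarrow> ('p, 'l) incidence_structure \<Rightarrow> ('q, 'k) incidence_structure" where
  "map_structure f g M =
     \<lparr>points = f ` points M, lines = g ` lines M, incid = map_prod f g ` incid M\<rparr>"

lemma sat_map_structure:
  assumes "inj f" "inj g"
  shows "sat (map_structure f g M) (f \<circ> e) (g \<circ> h) \<phi> \<longleftrightarrow> sat M e h \<phi>"
proof (induction \<phi> arbitrary: e h)
  case (Inc i j)
  then show ?case using assms by (auto simp: map_structure_def inj_eq)
next
  case (ExP i \<phi>)
  have "(\<lambda>a. f (e a))(i := f p) = (\<lambda>a. f ((e(i := p)) a))" for p by auto
  moreover have "points (map_structure f g M) = f ` points M" by (simp add: map_structure_def)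
  ultimately show ?case using ExP.IH by (simp add: comp_def del: fun_upd_apply)
next
  case (ExL i \<phi>)
  have "(\<lambda>a. g (h a))(i := g l) = (\<lambda>a. g ((h(i := l)) a))" for l by auto
  moreover have "lines (map_structure f g M) = g ` lines M" by (simp add: map_structure_def)
  ultimately show ?case using ExL.IH by (simp add: comp_def del: fun_upd_apply)
qed (use assms in \<open>auto simp: inj_eq\<close>)

lemma L_structure_map_structure:
  "L_structure M \<Longrightarrow> L_structure (map_structure f g M)"
  by (auto simp: L_structure_def incidence_system_def map_structure_def)

lemma holds_map_structure:
  assumes "inj f" "inj g" "L_structure M" "sentence \<phi>"
  shows "holds (map_structure f g M) \<phi> \<longleftrightarrow> holds M \<phi>"
proof -
  obtain e :: "nat \<Rightarrow> _" and h :: "nat \<Rightarrow> _"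
      where eh: "range e \<subseteq> points M" "range h \<subseteq> lines M"
    using L_structure_assignment[OF assms(3)] by blast
  have "range (f \<circ> e) \<subseteq> points (map_structure f g M)"
    "range (g \<circ> h) \<subseteq> lines (map_structure f g M)"
    using eh by (auto simp: map_structure_def)
  then have "holds (map_structure f g M) \<phi> \<longleftrightarrow> sat (map_structure f g M) (f \<circ> e) (g \<circ> h) \<phi>"
    using assms by (intro holds_sentence L_structure_map_structure)
  also have "\<dots> \<longleftrightarrow> sat M e h \<phi>" by (rule sat_map_structure[OF assms(1,2)])
  also have "\<dots> \<longleftrightarrow> holds M \<phi>" using holds_sentence[OF assms(3,4) eh] by simp
  finally show ?thesis .
qed

lemma complete_elementarily_equivalent:
  fixes M :: "('p1, 'l1) incidence_structure" and N :: "('p2, 'l2) incidence_structure"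
  assumes "complete_theory TYPE(('p1 + 'p2) \<times> ('l1 + 'l2)) T"
    and T: "\<And>\<psi>. \<psi> \<in> T \<Longrightarrow> sentence \<psi>"
    and M: "model_of M T" and N: "model_of N T" and \<phi>: "sentence \<phi>"
  shows "holds M \<phi> \<longleftrightarrow> holds N \<phi>"
proof -
  let ?M = "map_structure Inl Inl M :: ('p1 + 'p2, 'l1 + 'l2) incidence_structure"
  let ?N = "map_structure Inr Inr N :: ('p1 + 'p2, 'l1 + 'l2) incidence_structure"
  have LM: "L_structure M" and LN: "L_structure N" using M N by (auto simp: model_of_def)
  have hM: "holds ?M \<psi> \<longleftrightarrow> holds M \<psi>" and hN: "holds ?N \<psi> \<longleftrightarrow> holds N \<psi>" if "sentence \<psi>" for \<psi>
    using that LM LN by (auto simp: holds_map_structure)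
  have mods: "model_of ?M T" "model_of ?N T"
    using M N T hM hN by (auto simp: model_of_def L_structure_map_structure)
  have LMN: "L_structure ?M" "L_structure ?N" using mods by (auto simp: model_of_def)
  have "(holds ?M \<phi> \<and> holds ?N \<phi>) \<or> (holds ?M (Neg \<phi>) \<and> holds ?N (Neg \<phi>))"
    using assms(1) \<phi> mods unfolding complete_theory_def entails_def by blast
  then show ?thesis
    using holds_Neg[OF LMN(1) \<phi>] holds_Neg[OF LMN(2) \<phi>] hM[OF \<phi>] hN[OF \<phi>] by blast
qed

end

theory Submission
  imports Defs "HOL-Library.Nat_Bijection"
begin

text \<open>
  Points and lines are the vertices of the incidence graph. Call a finite set \<open>C\<close> tight over a
  disjoint set \<open>A\<close> if each element of \<open>C\<close> has at least three neighbours in \<open>A \<union> C\<close>. Openness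
  forces a disjoint family of nonempty tight sets over \<open>A\<close> to have at most \<open>2 |A|\<close> members, so
  the hull, the union of \<open>A\<close> and the sets of size at most \<open>n\<close> that are tight over \<open>A\<close>, is finite,
  with a size bounded in terms of \<open>|A|\<close> and \<open>n\<close> only; and hulls of hulls are contained in
  larger hulls.

  In the Ehrenfeucht-Fraisse game between two planes, Duplicator maintains an isomorphism of
  hulls of the sets of chosen vertices, with parameters that are large compared to the number of
  rounds left. After a move \<open>a\<close>, the hull \<open>B\<close> of \<open>A \<union> {a}\<close> is bounded in size, so it misses
  one of the differences between successive hulls of \<open>A\<close>. Over the lower one of these hulls, \<open>B\<close>
  arises by successively adding vertices with at most two earlier neighbours. This construction is
  copied in the other plane. A vertex with two earlier neighbours is their join or meet; the
  others are chosen generically, so that they lie in no small tight configuration.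
\<close>

section \<open>Tight sets and hulls in an open plane\<close>

text \<open>Closing a finite set under joins and meets usually gives an infinite subplane, so
  Duplicator cannot keep a finite isomorphism of subplanes. Hulls replace subplanes because three is
  the threshold of freedom: two earlier neighbours prescribe a join, which exists in every plane,
  and fewer leave a choice, whereas a third neighbour is a coincidence that another plane need not
  repeat. Hulls collect all small coincidences over the chosen vertices. The danger in copying is
  that a forced join coincides with an old vertex or acquires an extra neighbour. Either event
  produces a small tight set, which genericity of the earlier choices pushes back into a hull where
  everything is already matched. Working with one symmetric graph makes each statement about points
  serve its dual about lines. Completeness includes consistency, hence the separate construction of
  a free plane.\<close>

locale plane_graph =
  fixes V :: "'v set" and adj :: "'v \<Rightarrow> 'v \<Rightarrow> bool" and side :: "'v \<Rightarrow> bool"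
  assumes adj_sym: "adj x y \<Longrightarrow> adj y x"
    and adj_V: "adj x y \<Longrightarrow> x \<in> V"
    and adj_side: "adj x y \<Longrightarrow> side x \<noteq> side y"
    and join_unique: "x \<noteq> y \<Longrightarrow> adj x z \<Longrightarrow> adj y z \<Longrightarrow> adj x w \<Longrightarrow> adj y w \<Longrightarrow> z = w"
    and join_ex: "x \<in> V \<Longrightarrow> y \<in> V \<Longrightarrow> x \<noteq> y \<Longrightarrow> side x = side y \<Longrightarrow> \<exists>z. adj x z \<and> adj y z"
begin

section \<open>Quadrangles and vertices that avoid two given ones\<close>

definition quad :: "'v \<Rightarrow> 'v \<Rightarrow> 'v \<Rightarrow> 'v \<Rightarrow> bool" where
  "quad a b c d \<longleftrightarrow> {a, b, c, d} \<subseteq> V \<and> distinct [a, b, c, d] \<and>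
     side b = side a \<and> side c = side a \<and> side d = side a \<and>
     (\<forall>m. \<not> (adj a m \<and> adj b m \<and> adj c m) \<and> \<not> (adj a m \<and> adj b m \<and> adj d m) \<and>
          \<not> (adj a m \<and> adj c m \<and> adj d m) \<and> \<not> (adj b m \<and> adj c m \<and> adj d m))"

lemma adj_V2: "adj x y \<Longrightarrow> y \<in> V"
  using adj_V adj_sym by blast

lemma join_obtain:
  assumes "x \<in> V" "y \<in> V" "x \<noteq> y" "side x = side y"
  obtains z where "adj x z" "adj y z"
  using join_ex[OF assms] by blast

lemma quadD:
  assumes "quad a b c d"
  shows "a \<in> V" "b \<in> V" "c \<in> V" "d \<in> V" "a \<noteq> b" "a \<noteq> c" "a \<noteq> d" "b \<noteq> c" "b \<noteq> d" "c \<noteq> d"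
    "side b = side a" "side c = side a" "side d = side a"
    "\<not> (adj a m \<and> adj b m \<and> adj c m)" "\<not> (adj a m \<and> adj b m \<and> adj d m)"
    "\<not> (adj a m \<and> adj c m \<and> adj d m)" "\<not> (adj b m \<and> adj c m \<and> adj d m)"
  using assms by (auto simp: quad_def)

lemma quad_swap:
  assumes "quad a b c d"
  shows "quad b a c d" "quad a c b d" "quad a b d c"
  using assms unfolding quad_def by auto

text \<open>The witness is the diagonal point where the join of \<open>a\<close>, \<open>c\<close>
  meets the join of \<open>b\<close>, \<open>d\<close>. On \<open>l\<close> or \<open>k\<close> it
  would give three vertices of the quadrangle a common neighbour.\<close>

lemma quad_diagonal_point:
  assumes q: "quad a b c d" and l: "adj a l" "adj b l" and k: "adj c k" "adj d k"
  shows "\<exists>x\<in>V. side x = side a \<and> \<not> adj x l \<and> \<not> adj x k"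
proof -
  note q' = quadD[OF q]
  obtain m1 where m1: "adj a m1" "adj c m1" using join_obtain[of a c] q' by metis
  obtain m2 where m2: "adj b m2" "adj d m2" using join_obtain[of b d] q' by metis
  have "m1 \<noteq> m2" using m1 m2 q'(14) by blast
  moreover have "side m1 = side m2" using adj_side[OF m1(1)] adj_side[OF m2(1)] q'(11) by auto
  moreover have "m1 \<in> V" "m2 \<in> V" using m1 m2 adj_V2 by blast+
  ultimately obtain x where x: "adj m1 x" "adj m2 x" using join_obtain by metis
  have x': "adj x m1" "adj x m2" using x adj_sym by blast+
  have "\<not> adj x l"
  proof
    assume "adj x l"
    have "x \<noteq> a" using x'(2) m2 q'(15) by blast
    then have "l = m1" using join_unique[of x a l m1] \<open>adj x l\<close> l x'(1) m1 by blast
    then show False using q'(14) l m1 by blast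
  qed
  moreover have "\<not> adj x k"
  proof
    assume "adj x k"
    have "x \<noteq> c" using x'(2) m2 q'(17) by blast
    then have "k = m1" using join_unique[of x c k m1] \<open>adj x k\<close> k x'(1) m1 by blast
    then show False using q'(16) k m1 by blast
  qed
  moreover have "side x = side a" using adj_side[OF x(1)] adj_side[OF m1(1)] by auto
  ultimately show ?thesis using adj_V2[OF x(1)] by blast
qed

text \<open>Neither \<open>l\<close> nor \<open>k\<close> is adjacent to three of the four vertices,
  so if together they reach all four, they split them two and two, and a diagonal point escapes
  both. The six cases are the ordered splits.\<close>

lemma quad_avoids:
  assumes q: "quad a b c d"
  shows "\<exists>x\<in>V. side x = side a \<and> \<not> adj x l \<and> \<not> adj x k"
proof (rule ccontr)
  assume no: "\<not> ?thesis"
  note q' = quadD[OF q]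
  have "adj a l \<or> adj a k" "adj b l \<or> adj b k" "adj c l \<or> adj c k" "adj d l \<or> adj d k"
    using no q' by blast+
  then consider "adj a l" "adj b l" "adj c k" "adj d k" | "adj a k" "adj b k" "adj c l" "adj d l"
    | "adj a l" "adj c l" "adj b k" "adj d k" | "adj a k" "adj c k" "adj b l" "adj d l"
    | "adj a l" "adj d l" "adj b k" "adj c k" | "adj a k" "adj d k" "adj b l" "adj c l"
    using q'(14-17) by metis
  then show False
  proof cases
    case 1
    then show ?thesis using quad_diagonal_point[OF q 1] no by blast
  next
    case 2
    then show ?thesis using quad_diagonal_point[OF q 2] no by blast
  next
    case 3
    then show ?thesis using quad_diagonal_point[OF quad_swap(2)[OF q] 3] no by blast
  next
    case 4
    then show ?thesis using quad_diagonal_point[OF quad_swap(2)[OF q] 4] no by blast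
  next
    case 5
    then show ?thesis
      using quad_diagonal_point[OF quad_swap(2)[OF quad_swap(3)[OF q]] 5] no by blast
  next
    case 6
    then show ?thesis
      using quad_diagonal_point[OF quad_swap(2)[OF quad_swap(3)[OF q]] 6] no by blast
  qed
qed

text \<open>The four consecutive sides of the quadrangle work: two that share a corner meet only
  there, and no other side passes through it.\<close>

lemma quad_dual:
  assumes q: "quad a b c d"
  shows "\<exists>e f g h. quad e f g h \<and> side e \<noteq> side a"
proof -
  note q' = quadD[OF q]
  obtain e where e: "adj a e" "adj b e" using join_obtain[of a b] q' by metis
  obtain f where f: "adj b f" "adj c f" using join_obtain[of b c] q' by metis
  obtain g where g: "adj c g" "adj d g" using join_obtain[of c d] q' by metis
  obtain h where h: "adj d h" "adj a h" using join_obtain[of d a] q' by metis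
  have s: "side e \<noteq> side a" "side f \<noteq> side a" "side g \<noteq> side a" "side h \<noteq> side a"
    using adj_side[OF e(1)] adj_side[OF f(1)] adj_side[OF g(1)] adj_side[OF h(2)] q' by auto
  have V: "e \<in> V" "f \<in> V" "g \<in> V" "h \<in> V" using e f g h adj_V2 by blast+
  have neq: "e \<noteq> f" "e \<noteq> g" "e \<noteq> h" "f \<noteq> g" "f \<noteq> h" "g \<noteq> h"
    using q'(14-17) e f g h by blast+
  have b: "m = b" if "adj e m" "adj f m" for m
    using join_unique[OF neq(1) that adj_sym[OF e(2)] adj_sym[OF f(1)]] .
  have d: "m = d" if "adj g m" "adj h m" for m
    using join_unique[OF neq(6) that adj_sym[OF g(2)] adj_sym[OF h(1)]] .
  have nb: "\<not> adj g b" "\<not> adj h b" "\<not> adj e d" "\<not> adj f d"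
    using q'(14-17) e f g h adj_sym by blast+
  have "quad e f g h"
    unfolding quad_def using V neq s b d nb by auto
  then show ?thesis using s by blast
qed

end

text \<open>The incidence graph of a non-degenerate open projective plane; \<open>side\<close> tells points from lines.\<close>

locale open_plane_graph = plane_graph V adj side for V :: "'v set" and adj side +
  assumes no_confined: "finite C \<Longrightarrow> C \<subseteq> V \<Longrightarrow> (\<And>c. c \<in> C \<Longrightarrow> 3 \<le> card {y \<in> C. adj c y}) \<Longrightarrow> C = {}"
    and ex_quad: "\<exists>a b c d. quad a b c d"
begin

lemma missing:
  assumes "x \<in> V" "y \<in> V" "side x = side y"
  shows "\<exists>z\<in>V. side z \<noteq> side x \<and> \<not> adj x z \<and> \<not> adj y z"
proof -
  obtain a b c d where q: "quad a b c d" using ex_quad by blast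
  have "\<exists>a b c d. quad a b c d \<and> side a \<noteq> side x"
  proof (cases "side a = side x")
    case True
    then show ?thesis using quad_dual[OF q] by auto
  next
    case False
    then show ?thesis using q by blast
  qed
  then obtain a b c d where "quad a b c d" "side a \<noteq> side x" by blast
  then show ?thesis using quad_avoids[of a b c d x y] adj_sym by metis
qed

lemma adj_ex: "\<exists>x y. adj x y"
proof -
  obtain a b c d where "quad a b c d" using ex_quad by blast
  note q = quadD[OF this]
  show ?thesis using join_ex[OF q(1,2,5)] q(11) by auto
qed

section \<open>Neighbour counts and tight sets\<close>

definition nbrs :: "'v \<Rightarrow> 'v set \<Rightarrow> 'v set" where
  "nbrs x S = {y \<in> S. adj x y}"

definition tight :: "'v set \<Rightarrow> 'v set \<Rightarrow> bool" where
  "tight A C \<longleftrightarrow> finite C \<and> C \<subseteq> V \<and> C \<inter> A = {} \<and> (\<forall>c\<in>C. 3 \<le> card (nbrs c (A \<union> C)))"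

definition hull :: "nat \<Rightarrow> 'v set \<Rightarrow> 'v set" where
  "hull n A = A \<union> \<Union>{C. tight A C \<and> card C \<le> n}"

lemma finite_nbrs [simp]: "finite S \<Longrightarrow> finite (nbrs x S)"
  by (simp add: nbrs_def)

lemma card_nbrs_mono:
  assumes "k \<le> card (nbrs x S)" "finite T" "\<And>y. y \<in> S \<Longrightarrow> adj x y \<Longrightarrow> y \<in> T"
  shows "k \<le> card (nbrs x T)"
proof -
  have "nbrs x S \<subseteq> nbrs x T" using assms(3) by (auto simp: nbrs_def)
  then show ?thesis using assms card_mono[of "nbrs x T" "nbrs x S"] by simp
qed

lemma tight_nbrs:
  assumes "tight A C" "c \<in> C" "finite T" "\<And>y. y \<in> A \<union> C \<Longrightarrow> adj c y \<Longrightarrow> y \<in> T"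
  shows "3 \<le> card (nbrs c T)"
  using assms by (auto simp: tight_def intro: card_nbrs_mono)

lemma card_nbrs_insert:
  assumes "k \<le> card (nbrs x S)" "finite T" "\<And>y. y \<in> S \<Longrightarrow> adj x y \<Longrightarrow> y \<in> T"
    "w \<in> T" "w \<notin> S" "adj x w" "finite S"
  shows "Suc k \<le> card (nbrs x T)"
proof -
  have "insert w (nbrs x S) \<subseteq> nbrs x T" using assms by (auto simp: nbrs_def)
  moreover have "w \<notin> nbrs x S" using assms by (simp add: nbrs_def)
  ultimately show ?thesis
    using assms card_mono[of "nbrs x T" "insert w (nbrs x S)"] by simp
qed

lemma card_nbrs_remove:
  assumes "Suc k \<le> card (nbrs x S)" "finite S" "finite T"
    "\<And>y. y \<in> S \<Longrightarrow> adj x y \<Longrightarrow> y \<noteq> w \<Longrightarrow> y \<in> T"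
  shows "k \<le> card (nbrs x T)"
proof -
  have "nbrs x S - {w} \<subseteq> nbrs x T" using assms by (auto simp: nbrs_def)
  then have "card (nbrs x S - {w}) \<le> card (nbrs x T)" using assms by (simp add: card_mono)
  moreover have "card (nbrs x S) - 1 \<le> card (nbrs x S - {w})"
    using assms by (metis card_Diff_singleton_if diff_le_self le_refl)
  ultimately show ?thesis using assms(1) by linarith
qed

text \<open>Over the empty set, tight means confined. Both the base case of the family bound and the
  empty starting position of the game rest on this.\<close>

lemma tight_empty_iff: "tight {} C \<longleftrightarrow> C = {}"
  using no_confined[of C] by (auto simp: tight_def nbrs_def)

lemma tight_extend:
  assumes "tight A C" "finite A'" "A \<subseteq> A'"
  shows "tight A' (C - A')"
  unfolding tight_def
proof (intro conjI ballI)
  show "3 \<le> card (nbrs c (A' \<union> (C - A')))" if "c \<in> C - A'" for c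
    using that assms by (intro tight_nbrs[of "A" "C" c]) (auto simp: tight_def)
qed (use assms in \<open>auto simp: tight_def\<close>)

lemma tight_shrink:
  assumes "tight A C" "finite A" "\<And>c a. c \<in> C \<Longrightarrow> a \<in> A \<Longrightarrow> adj c a \<Longrightarrow> a \<in> A'" "A' \<subseteq> A"
  shows "tight A' C"
  unfolding tight_def
proof (intro conjI ballI)
  show "3 \<le> card (nbrs c (A' \<union> C))" if "c \<in> C" for c
    using that assms finite_subset[of A' A]
    by (intro tight_nbrs[of "A" "C" c]) (auto simp: tight_def)
qed (use assms in \<open>auto simp: tight_def\<close>)

text \<open>If every \<open>a\<close> in \<open>A\<close> had neighbours in three members of
  \<open>F\<close>, these would be distinct by disjointness, and \<open>A\<close> together with all
  members would be confined. So some \<open>a\<close> touches at most two members. Discarding them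
  costs two per element of \<open>A\<close>, and the rest of the family is tight over
  \<open>A - {a}\<close>.\<close>

lemma tight_family_bound:
  assumes "finite A" "A \<subseteq> V" "finite F" "pairwise disjnt F"
    "\<And>C. C \<in> F \<Longrightarrow> tight A C \<and> C \<noteq> {}"
  shows "card F \<le> 2 * card A"
  using assms
proof (induction "card A" arbitrary: A F)
  case 0
  then have "A = {}" by simp
  with 0 have "F = {}" using tight_empty_iff by blast
  then show ?case by simp
next
  case (Suc k)
  define touch where "touch a = {C \<in> F. \<exists>c\<in>C. adj a c}" for a
  show ?case
  proof (cases "\<forall>a\<in>A. 3 \<le> card (touch a)")
    case True
    have "finite (\<Union>F)" using Suc.prems by (auto simp: tight_def)
    have "\<Union>F \<subseteq> V" using Suc.prems(5) unfolding tight_def by blast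
    have "A \<union> \<Union>F = {}"
    proof (rule no_confined)
      fix c assume c: "c \<in> A \<union> \<Union>F"
      show "3 \<le> card {y \<in> A \<union> \<Union>F. adj c y}"
      proof (cases "c \<in> A")
        case True
        define pick where "pick C = (SOME y. y \<in> C \<and> adj c y)" for C
        have pick: "pick C \<in> C \<and> adj c (pick C)" if "C \<in> touch c" for C
          unfolding pick_def by (rule someI_ex) (use that in \<open>auto simp: touch_def\<close>)
        have "inj_on pick (touch c)"
        proof (rule inj_onI)
          fix C C' assume "C \<in> touch c" "C' \<in> touch c" "pick C = pick C'"
          moreover from this have "C \<inter> C' \<noteq> {}" using pick by (metis disjoint_iff)
          ultimately show "C = C'"
            using Suc.prems(4) by (auto simp: touch_def pairwise_def disjnt_def)
        qed
        then have "card (touch c) = card (pick ` touch c)" by (simp add: card_image)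
        also have "\<dots> \<le> card {y \<in> A \<union> \<Union>F. adj c y}"
        proof (rule card_mono)
          show "finite {y \<in> A \<union> \<Union>F. adj c y}"
            using \<open>finite (\<Union>F)\<close> Suc.prems(1) finite_nbrs[of "A \<union> \<Union>F" c]
            unfolding nbrs_def by blast
          show "pick ` touch c \<subseteq> {y \<in> A \<union> \<Union>F. adj c y}"
            using pick by (auto simp: touch_def)
        qed
        finally show ?thesis using \<open>\<forall>a\<in>A. 3 \<le> card (touch a)\<close> True by force
      next
        case False
        then obtain C where C: "C \<in> F" "c \<in> C" using c by blast
        then have "3 \<le> card (nbrs c (A \<union> \<Union>F))"
          using Suc.prems(1) Suc.prems(5)[of C] \<open>finite (\<Union>F)\<close>
          by (intro tight_nbrs[of A C c]) auto
        then show ?thesis by (simp add: nbrs_def)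
      qed
    qed (use Suc.prems(1,2) \<open>finite (\<Union>F)\<close> \<open>\<Union>F \<subseteq> V\<close> in auto)
    then show ?thesis using Suc.prems(5) Suc.hyps(2) by simp
  next
    case False
    then obtain a where a: "a \<in> A" "card (touch a) \<le> 2" by force
    have "card (F - touch a) \<le> 2 * card (A - {a})"
    proof (rule Suc.hyps(1))
      show "k = card (A - {a})" using a Suc by simp
      show "pairwise disjnt (F - touch a)" using Suc.prems(4) by (rule pairwise_subset) auto
      show "tight (A - {a}) C \<and> C \<noteq> {}" if "C \<in> F - touch a" for C
      proof
        have C: "tight A C" "C \<noteq> {}" "\<And>c. c \<in> C \<Longrightarrow> \<not> adj c a"
          using that Suc.prems(5)[of C] adj_sym by (auto simp: touch_def)
        show "tight (A - {a}) C"
          using C(1) Suc.prems(1) by (rule tight_shrink) (use C(3) in auto)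
        show "C \<noteq> {}" by (rule C(2))
      qed
    qed (use Suc.prems in auto)
    moreover have "card F \<le> card (F - touch a) + card (touch a)"
    proof -
      have "F = (F - touch a) \<union> touch a" by (auto simp: touch_def)
      then show ?thesis using card_Un_le[of "F - touch a" "touch a"] by simp
    qed
    moreover have "card A = Suc (card (A - {a}))" using a Suc by simp
    ultimately show ?thesis using a(2) by linarith
  qed
qed

end

section \<open>Size of hulls\<close>

fun hull_bound :: "nat \<Rightarrow> nat \<Rightarrow> nat" where
  "hull_bound a 0 = a"
| "hull_bound a (Suc n) = hull_bound (a + 2 * a * Suc n) n"

lemma hull_bound_mono: "a \<le> b \<Longrightarrow> hull_bound a n \<le> hull_bound b n"
proof (induction n arbitrary: a b)
  case (Suc n)
  have "a + 2 * a * Suc n \<le> b + 2 * b * Suc n"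
    using Suc.prems by (intro add_mono mult_mono) auto
  then show ?case using Suc.IH by simp
qed simp

context open_plane_graph
begin

lemma hull_subset: "A \<subseteq> hull n A"
  by (auto simp: hull_def)

lemma hull_V: "A \<subseteq> V \<Longrightarrow> hull n A \<subseteq> V"
  by (auto simp: hull_def tight_def)

lemma hull_mono: "n \<le> m \<Longrightarrow> hull n A \<subseteq> hull m A"
  by (auto simp: hull_def)

lemma tight_subset_hull: "tight A C \<Longrightarrow> card C \<le> n \<Longrightarrow> C \<subseteq> hull n A"
  by (auto simp: hull_def)

text \<open>Let \<open>U\<close> be the union of a largest disjoint family of nonempty tight sets of
  size at most \<open>Suc n\<close>. It has at most \<open>2 * card A * Suc n\<close> elements, the
  term in the recursion of \<open>hull_bound\<close>. Any other such set not inside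
  \<open>A \<union> U\<close> meets \<open>U\<close>, so its part outside
  \<open>A \<union> U\<close> has at most \<open>n\<close> elements and is tight over
  \<open>A \<union> U\<close>.\<close>

lemma hull_finite_card:
  assumes "finite A" "A \<subseteq> V"
  shows "finite (hull n A) \<and> card (hull n A) \<le> hull_bound (card A) n"
  using assms
proof (induction n arbitrary: A)
  case 0
  have "hull 0 A = A" by (auto simp: hull_def tight_def)
  then show ?case using 0 by simp
next
  case (Suc n)
  define P where "P F \<longleftrightarrow> finite F \<and> pairwise disjnt F \<and>
    (\<forall>C\<in>F. tight A C \<and> C \<noteq> {} \<and> card C \<le> Suc n)" for F
  have "P {}" by (simp add: P_def)
  have bound: "\<forall>F. P F \<longrightarrow> card F \<le> 2 * card A"
    using tight_family_bound[OF Suc.prems] unfolding P_def by meson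
  then have "\<forall>F. P F \<longrightarrow> card F < Suc (2 * card A)" by (simp add: less_Suc_eq_le)
  \<comment> \<open>Although \<open>V\<close> may be infinite, the family bound guarantees that a
    family of greatest size exists.\<close>
  from ex_has_greatest_nat[OF \<open>P {}\<close> this]
  obtain F where F: "P F" and max: "\<And>F'. P F' \<Longrightarrow> card F' \<le> card F"
    by (elim exE conjE) blast
  define U where "U = \<Union>F"
  have "\<forall>C\<in>F. finite C \<and> C \<subseteq> V" "finite F" using F by (auto simp: P_def tight_def)
  then have "finite U" "U \<subseteq> V" by (auto simp: U_def)
  have "card U \<le> (\<Sum>C\<in>F. card C)" unfolding U_def by (rule card_Union_le_sum_card)
  also have "\<dots> \<le> (\<Sum>C\<in>F. Suc n)" using F by (intro sum_mono) (auto simp: P_def)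
  also have "\<dots> \<le> 2 * card A * Suc n" using F bound by (simp add: mult_le_mono1 del: mult_Suc_right)
  finally have cU: "card U \<le> 2 * card A * Suc n" .
  have "hull (Suc n) A \<subseteq> hull n (A \<union> U)"
  proof
    fix x assume "x \<in> hull (Suc n) A"
    then consider "x \<in> A \<union> U" | C where "tight A C" "card C \<le> Suc n" "x \<in> C" "x \<notin> A \<union> U"
      by (auto simp: hull_def)
    then show "x \<in> hull n (A \<union> U)"
    proof cases
      case 1
      then show ?thesis using hull_subset by blast
    next
      case (2 C)
      have "finite C" using 2 by (simp add: tight_def)
      have "C \<inter> U \<noteq> {}"
      proof
        assume *: "C \<inter> U = {}"
        then have "C \<notin> F" using 2 by (auto simp: U_def)
        have "P (insert C F)"
          using F 2 * by (auto simp: P_def U_def pairwise_insert disjnt_def)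
        then show False using max[of "insert C F"] F \<open>C \<notin> F\<close> by (simp add: P_def)
      qed
      then obtain u where u: "u \<in> C" "u \<in> U" by blast
      then have "C - (A \<union> U) \<subseteq> C - {u}" by blast
      then have "card (C - (A \<union> U)) \<le> card (C - {u})" using \<open>finite C\<close> by (intro card_mono) auto
      also have "\<dots> \<le> n" using 2 u \<open>finite C\<close> by simp
      finally have "C - (A \<union> U) \<subseteq> hull n (A \<union> U)"
        using 2 Suc.prems \<open>finite U\<close> tight_extend[of A C "A \<union> U"] by (intro tight_subset_hull) auto
      then show ?thesis using 2 by blast
    qed
  qed
  note sub = this
  have IH: "finite (hull n (A \<union> U)) \<and> card (hull n (A \<union> U)) \<le> hull_bound (card (A \<union> U)) n"
    using Suc \<open>finite U\<close> \<open>U \<subseteq> V\<close> by simp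
  have "card (A \<union> U) \<le> card A + 2 * card A * Suc n"
    using cU card_Un_le[of A U] by linarith
  then have "hull_bound (card (A \<union> U)) n \<le> hull_bound (card A) (Suc n)"
    by (simp add: hull_bound_mono)
  then have "card (hull (Suc n) A) \<le> hull_bound (card A) (Suc n)"
    using card_mono[OF conjunct1[OF IH] sub] IH by linarith
  then show ?case using finite_subset[OF sub] IH by blast
qed

lemmas finite_hull = hull_finite_card[THEN conjunct1]
  and card_hull = hull_finite_card[THEN conjunct2]

lemma tight_hull_Diff:
  assumes "finite A" "A \<subseteq> V"
  shows "tight A (hull n A - A)"
  unfolding tight_def
proof (intro conjI ballI)
  fix c assume "c \<in> hull n A - A"
  then obtain C where C: "tight A C" "card C \<le> n" "c \<in> C" by (auto simp: hull_def)
  then have "C \<subseteq> hull n A" by (simp add: tight_subset_hull)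
  then show "3 \<le> card (nbrs c (A \<union> (hull n A - A)))"
    using C assms finite_hull[OF assms]
    by (intro tight_nbrs[of "A" "C" c]) (auto simp: tight_def)
qed (use assms finite_hull[OF assms] hull_V[OF assms(2), of n] in auto)

text \<open>Adding all of \<open>hull m A - A\<close> to a set that is tight over
  \<open>hull m A\<close> makes it tight over \<open>A\<close>, and its size grows by at most
  \<open>hull_bound k m\<close>.\<close>

lemma hull_hull:
  assumes "finite A" "A \<subseteq> V" "card A \<le> k"
  shows "hull n (hull m A) \<subseteq> hull (n + hull_bound k m) A"
proof -
  note fin = finite_hull[OF assms(1,2)]
  have card: "card (hull m A - A) \<le> hull_bound k m"
    using card_hull[OF assms(1,2)] hull_bound_mono[OF assms(3)] fin
    by (meson Diff_subset card_mono le_trans)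
  have main: "C \<union> (hull m A - A) \<subseteq> hull (n + hull_bound k m) A"
    if C: "tight (hull m A) C" "card C \<le> n" for C
  proof (rule tight_subset_hull)
    show "tight A (C \<union> (hull m A - A))"
      unfolding tight_def
    proof (intro conjI ballI)
      fix c assume "c \<in> C \<union> (hull m A - A)"
      then show "3 \<le> card (nbrs c (A \<union> (C \<union> (hull m A - A))))"
      proof
        assume "c \<in> C"
        then show ?thesis using C fin assms
          by (intro tight_nbrs[of "hull m A" "C" c]) (auto simp: tight_def)
      next
        assume "c \<in> hull m A - A"
        then show ?thesis using C fin assms tight_hull_Diff[OF assms(1,2), of m]
          by (intro tight_nbrs[of "A" "hull m A - A" c]) (auto simp: tight_def)
      qed
    qed (use C fin assms hull_V[of A m] hull_subset[of A m] in \<open>auto simp: tight_def\<close>)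
    show "card (C \<union> (hull m A - A)) \<le> n + hull_bound k m"
      using C(2) card card_Un_le[of C "hull m A - A"] by linarith
  qed
  \<comment> \<open>The empty \<open>C\<close> accounts for the inner hull itself.\<close>
  have "tight (hull m A) {}" by (simp add: tight_def)
  then have "hull m A - A \<subseteq> hull (n + hull_bound k m) A" using main[of "{}"] by simp
  then have "hull m A \<subseteq> hull (n + hull_bound k m) A" using hull_subset by blast
  then show ?thesis using main unfolding hull_def[of n "hull m A"] by blast
qed


section \<open>Generic vertices\<close>

lemma finite_common_nbrs:
  assumes "x \<noteq> y"
  shows "finite {z. adj x z \<and> adj y z}" "card {z. adj x z \<and> adj y z} \<le> 1"
proof -
  have sub: "\<exists>w. {z. adj x z \<and> adj y z} \<subseteq> {w}" using join_unique[OF assms] by blast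
  then show "finite {z. adj x z \<and> adj y z}" using finite_subset by blast
  from sub obtain w where "{z. adj x z \<and> adj y z} \<subseteq> {w}" by blast
  from card_mono[OF _ this] show "card {z. adj x z \<and> adj y z} \<le> 1" by simp
qed

lemma side_witness: "\<exists>x y. adj x y \<and> side x = c"
proof -
  obtain x y where "adj x y" using adj_ex by blast
  then show ?thesis using adj_sym[of x y] adj_side[of x y] by (cases "side x = c") metis+
qed

lemma another_on_side:
  assumes "c \<in> V"
  shows "\<exists>y\<in>V. y \<noteq> c \<and> side y = side c"
proof -
  obtain x y where xy: "adj x y" "side x = side c" using side_witness by blast
  show ?thesis
  proof (cases "x = c")
    case True
    obtain z where z: "z \<in> V" "side z \<noteq> side c" "\<not> adj c z" using missing[of c c] assms by blast
    have "y \<noteq> z" "side y = side z" "y \<in> V" using xy z True adj_side[of x y] adj_V2 by auto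
    then obtain w where "adj y w" "adj z w" using z join_obtain by blast
    then have "w \<noteq> c" "side w = side c" "w \<in> V"
      using z adj_sym adj_side[of z w] adj_V2 by auto
    then show ?thesis by blast
  qed (use xy adj_V in blast)
qed

text \<open>Given two neighbours of \<open>c\<close>, some \<open>z\<close> on the side of
  \<open>c\<close> is adjacent to neither, and the join of \<open>c\<close> and \<open>z\<close> is
  a further neighbour.\<close>

lemma three_nbrs:
  assumes "c \<in> V"
  shows "\<exists>l1 l2 l3. adj c l1 \<and> adj c l2 \<and> adj c l3 \<and> l1 \<noteq> l2 \<and> l1 \<noteq> l3 \<and> l2 \<noteq> l3"
proof -
  obtain y where "y \<in> V" "y \<noteq> c" "side y = side c" using another_on_side[OF assms] by blast
  then obtain l1 where l1: "adj c l1" using join_obtain[of c y] assms by metis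
  have new: "\<exists>m. adj c m \<and> m \<noteq> l \<and> m \<noteq> k" if "adj c l" "adj c k" for l k
  proof -
    have "side l = side k" "l \<in> V" "k \<in> V" using that adj_side adj_V2 by blast+
    then obtain z where z: "z \<in> V" "side z \<noteq> side l" "\<not> adj l z" "\<not> adj k z"
      using missing by blast
    have "z \<noteq> c" "side z = side c" using that z adj_sym adj_side[of c l] by auto
    then obtain m where "adj c m" "adj z m" using join_obtain[of c z] assms z by metis
    then show ?thesis using z adj_sym by blast
  qed
  obtain l2 where l2: "adj c l2" "l2 \<noteq> l1" using new[OF l1 l1] by blast
  obtain l3 where "adj c l3" "l3 \<noteq> l1" "l3 \<noteq> l2" using new[OF l1 l2(1)] by blast
  then show ?thesis using l1 l2 by metis
qed

lemma infinite_V: "infinite V"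
proof
  assume fin: "finite V"
  have "V = {}"
  proof (rule no_confined[OF fin subset_refl])
    fix c assume "c \<in> V"
    then obtain l1 l2 l3 where l: "adj c l1" "adj c l2" "adj c l3" "l1 \<noteq> l2" "l1 \<noteq> l3" "l2 \<noteq> l3"
      using three_nbrs by blast
    then have "{l1, l2, l3} \<subseteq> {y \<in> V. adj c y}" using adj_V2 by auto
    then have "card {l1, l2, l3} \<le> card {y \<in> V. adj c y}" using fin by (intro card_mono) auto
    then show "3 \<le> card {y \<in> V. adj c y}" using l by simp
  qed
  then show False using adj_ex adj_V by blast
qed

text \<open>If one side were finite, so would be the other, since each of its vertices is a common
  neighbour of two vertices of the first.\<close>

lemma infinite_side: "infinite {x \<in> V. side x = c}"
proof
  assume fin: "finite {x \<in> V. side x = c}" (is "finite ?S")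
  have "{x \<in> V. side x \<noteq> c} \<subseteq> (\<Union>u\<in>?S. \<Union>v\<in>?S - {u}. {z. adj u z \<and> adj v z})"
  proof
    fix x assume x: "x \<in> {x \<in> V. side x \<noteq> c}"
    then obtain u v where uv: "adj x u" "adj x v" "u \<noteq> v" using three_nbrs by blast
    then have "u \<in> ?S" "v \<in> ?S" using x adj_side adj_V2 by fastforce+
    then show "x \<in> (\<Union>u\<in>?S. \<Union>v\<in>?S - {u}. {z. adj u z \<and> adj v z})"
      using uv adj_sym by blast
  qed
  moreover have "finite (\<Union>u\<in>?S. \<Union>v\<in>?S - {u}. {z. adj u z \<and> adj v z})"
  proof (intro finite_UN_I fin)
    show "finite (?S - {u})" for u using fin by simp
    show "finite {z. adj u z \<and> adj v z}" if "v \<in> ?S - {u}" for u v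
      using that by (intro finite_common_nbrs) auto
  qed
  ultimately have "finite {x \<in> V. side x \<noteq> c}" by (rule finite_subset)
  with fin have "finite (?S \<union> {x \<in> V. side x \<noteq> c})" by (rule finite_UnI)
  moreover have "?S \<union> {x \<in> V. side x \<noteq> c} = V" by auto
  ultimately show False using infinite_V by metis
qed

text \<open>A perspectivity: a neighbour \<open>z\<close> of \<open>y\<close> goes to its join with
  \<open>m\<close>. As \<open>m\<close> is not adjacent to \<open>y\<close>, no value
  \<open>w\<close> equals \<open>y\<close>, so each value is taken at most once.\<close>

lemma infinite_nbrs_transfer:
  assumes "y \<in> V" "m \<in> V" "side y \<noteq> side m" "\<not> adj y m" "infinite {z. adj y z}"
  shows "infinite {z. adj m z}"
proof
  assume fin: "finite {z. adj m z}"
  have "{z. adj y z} \<subseteq> (\<Union>w\<in>{z. adj m z}. {z. adj y z \<and> adj w z})"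
  proof
    fix z assume "z \<in> {z. adj y z}"
    then have z: "adj y z" by simp
    have "z \<in> V" "side z = side m" "z \<noteq> m" using z assms adj_V2 adj_side[of y z] by auto
    then obtain w where "adj z w" "adj m w" using assms(2) join_obtain by blast
    then show "z \<in> (\<Union>w\<in>{z. adj m z}. {z. adj y z \<and> adj w z})" using z adj_sym by blast
  qed
  moreover have "finite (\<Union>w\<in>{z. adj m z}. {z. adj y z \<and> adj w z})"
  proof (intro finite_UN_I fin)
    fix w assume "w \<in> {z. adj m z}"
    then have "y \<noteq> w" using assms(4) adj_sym by blast
    then show "finite {z. adj y z \<and> adj w z}" by (rule finite_common_nbrs)
  qed
  ultimately show False using assms(5) finite_subset by blast
qed

text \<open>If \<open>x\<close> had finitely many neighbours, one of them, \<open>l\<close>, would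
  have infinitely many, because the neighbours of neighbours of \<open>x\<close> exhaust its
  infinite side. Three perspectivities carry this from \<open>l\<close> through \<open>y\<close> and
  \<open>m\<close> back to \<open>x\<close>; the nonadjacencies they require dictate the choice of
  \<open>y\<close> and \<open>m\<close>.\<close>

lemma infinite_nbrs:
  assumes "x \<in> V"
  shows "infinite {z. adj x z}"
proof
  assume fin: "finite {z. adj x z}"
  have "{y \<in> V. side y = side x} \<subseteq> insert x (\<Union>l\<in>{z. adj x z}. {z. adj l z})"
  proof
    fix y assume y: "y \<in> {y \<in> V. side y = side x}"
    show "y \<in> insert x (\<Union>l\<in>{z. adj x z}. {z. adj l z})"
    proof (cases "y = x")
      case False
      then obtain l where "adj x l" "adj y l" using join_obtain[of x y] y assms by auto
      then show ?thesis using adj_sym by blast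
    qed simp
  qed
  then have "infinite (insert x (\<Union>l\<in>{z. adj x z}. {z. adj l z}))"
    using infinite_side finite_subset by blast
  then obtain l where l: "adj x l" "infinite {z. adj l z}" using fin by auto
  have "l \<in> V" using l adj_V2 by blast
  then obtain y where y: "y \<in> V" "side y \<noteq> side l" "\<not> adj l y" using missing[of l l] by blast
  have "infinite {z. adj y z}"
    using infinite_nbrs_transfer[of l y] \<open>l \<in> V\<close> y l by auto
  moreover have "side y = side x" using y adj_side[OF l(1)] by auto
  then obtain m where m: "m \<in> V" "side m \<noteq> side x" "\<not> adj x m" "\<not> adj y m"
    using missing[of x y] assms y by auto
  ultimately have "infinite {z. adj m z}"
    using infinite_nbrs_transfer[of y m] y m \<open>side y = side x\<close> by auto
  then show False using infinite_nbrs_transfer[of m x] m assms fin adj_sym by blast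
qed

text \<open>Fix \<open>l\<close> outside \<open>A\<close> on the opposite side: each element of
  \<open>A\<close> spoils at most one of its infinitely many neighbours by adjacency.\<close>

lemma ex_nonadjacent:
  assumes "finite A"
  shows "\<exists>x\<in>V. side x = c \<and> x \<notin> A \<and> (\<forall>a\<in>A. \<not> adj a x)"
proof -
  have "\<exists>l. l \<in> {x \<in> V. side x = (\<not> c)} - A"
    using infinite_side assms finite_subset by (metis Diff_infinite_finite ex_in_conv infinite_imp_nonempty)
  then obtain l where l: "l \<in> V" "side l \<noteq> c" "l \<notin> A" by auto
  define Bad where "Bad = A \<union> (\<Union>a\<in>A. {z. adj a z \<and> adj l z})"
  have "finite Bad"
    unfolding Bad_def using assms l by (intro finite_UnI finite_UN_I finite_common_nbrs) auto
  then have "infinite ({z. adj l z} - Bad)" using infinite_nbrs[OF l(1)] Diff_infinite_finite by blast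
  then obtain z where "z \<in> {z. adj l z} - Bad" using infinite_imp_nonempty by blast
  then have z: "adj l z" "z \<notin> Bad" by auto
  have "z \<in> V" "side z = c" using z l adj_V2 adj_side[of l z] by auto
  then show ?thesis using z by (auto simp: Bad_def)
qed

section \<open>Pinned vertices\<close>

text \<open>
  A vertex pinned by a small set is the opposite of a generic one: adding one more edge at \<open>x\<close>
  makes the set tight.
\<close>

definition pins :: "'v set \<Rightarrow> 'v set \<Rightarrow> 'v \<Rightarrow> bool" where
  "pins A C x \<longleftrightarrow> finite C \<and> C \<subseteq> V \<and> C \<inter> A = {} \<and> x \<in> C \<and>
     2 \<le> card (nbrs x (A \<union> C)) \<and> (\<forall>c\<in>C - {x}. 3 \<le> card (nbrs c (A \<union> C)))"

definition pinned :: "nat \<Rightarrow> 'v set \<Rightarrow> 'v \<Rightarrow> bool" where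
  "pinned n A x \<longleftrightarrow> (\<exists>C. pins A C x \<and> card C \<le> n)"

lemma pins_nbrs2:
  assumes "pins A C x" "finite T" "\<And>y. y \<in> A \<union> C \<Longrightarrow> adj x y \<Longrightarrow> y \<in> T"
  shows "2 \<le> card (nbrs x T)"
  using assms by (auto simp: pins_def intro: card_nbrs_mono)

lemma pins_nbrs3:
  assumes "pins A C x" "c \<in> C" "c \<noteq> x" "finite T" "\<And>y. y \<in> A \<union> C \<Longrightarrow> adj c y \<Longrightarrow> y \<in> T"
  shows "3 \<le> card (nbrs c T)"
proof -
  have "3 \<le> card (nbrs c (A \<union> C))" using assms by (auto simp: pins_def)
  then show ?thesis using assms(4,5) by (rule card_nbrs_mono)
qed

lemma pins_nbrs_insert:
  assumes "pins A C x" "finite A" "finite T" "\<And>y. y \<in> A \<union> C \<Longrightarrow> adj x y \<Longrightarrow> y \<in> T"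
    "w \<in> T" "w \<notin> A \<union> C" "adj x w"
  shows "3 \<le> card (nbrs x T)"
proof -
  have "2 \<le> card (nbrs x (A \<union> C))" "finite (A \<union> C)" using assms by (auto simp: pins_def)
  then have "Suc 2 \<le> card (nbrs x T)"
    using assms(3-7) by (intro card_nbrs_insert[of 2 x "A \<union> C" T w])
  then show ?thesis by simp
qed

lemma tight_imp_pins:
  assumes "tight A C" "x \<in> C"
  shows "pins A C x"
proof -
  have "2 \<le> card (nbrs x (A \<union> C))" using assms by (auto simp: tight_def)
  then show ?thesis using assms by (simp add: pins_def tight_def)
qed

lemma pinned_mono:
  assumes "pinned n A x" "n \<le> m" "A \<subseteq> A'" "finite A'" "x \<notin> A'"
  shows "pinned m A' x"
proof -
  obtain C where C: "pins A C x" "card C \<le> n" using assms(1) by (auto simp: pinned_def)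
  have fin: "finite C" "C \<subseteq> V" "x \<in> C" using C by (auto simp: pins_def)
  have fin': "finite (A' \<union> (C - A'))" using fin assms by simp
  have sub: "y \<in> A' \<union> (C - A')" if "y \<in> A \<union> C" for y using that assms by auto
  have "pins A' (C - A') x"
    unfolding pins_def
  proof (intro conjI ballI)
    show "2 \<le> card (nbrs x (A' \<union> (C - A')))" by (rule pins_nbrs2[OF C(1) fin' sub])
    show "3 \<le> card (nbrs c (A' \<union> (C - A')))" if "c \<in> C - A' - {x}" for c
      by (rule pins_nbrs3[OF C(1) _ _ fin' sub]) (use that in auto)
  qed (use fin assms in auto)
  moreover have "card (C - A') \<le> m" using card_mono[of C "C - A'"] fin C assms by auto
  ultimately show ?thesis by (auto simp: pinned_def)
qed

text \<open>If \<open>C\<close> is not tight already, \<open>y\<close> has exactly two neighbours in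
  \<open>A \<union> C\<close>, namely \<open>a\<close> and \<open>x\<close>. Deleting
  \<open>y\<close> then affects only \<open>x\<close>, which keeps at least two of its three or more
  neighbours.\<close>

lemma pins_remove:
  assumes C: "pins A C y" and "x \<in> C" "a \<in> A" "adj y a" "adj y x" "finite A"
  shows "tight A C \<or> pins A (C - {y}) x"
proof (cases "3 \<le> card (nbrs y (A \<union> C))")
  case True
  then have "tight A C" using C unfolding tight_def pins_def by blast
  then show ?thesis ..
next
  case False
  have fin: "finite C" "C \<subseteq> V" "C \<inter> A = {}" "y \<in> C" "finite (A \<union> C)"
    using C assms by (auto simp: pins_def)
  have "a \<noteq> x" "y \<noteq> x" using assms fin adj_side[of y x] by auto
  have "nbrs y (A \<union> C) = {a, x}"
  proof (rule sym, rule card_seteq)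
    show "{a, x} \<subseteq> nbrs y (A \<union> C)" using assms by (auto simp: nbrs_def)
    show "card (nbrs y (A \<union> C)) \<le> card {a, x}" using False \<open>a \<noteq> x\<close> by simp
  qed (use fin in simp)
  then have only: "c = x" if "c \<in> C" "adj c y" for c
    using that adj_sym fin assms(3) by (auto simp: nbrs_def)
  have "pins A (C - {y}) x"
    unfolding pins_def
  proof (intro conjI ballI)
    have "3 \<le> card (nbrs x (A \<union> C))" using C \<open>x \<in> C\<close> \<open>y \<noteq> x\<close> by (auto simp: pins_def)
    then have "Suc 2 \<le> card (nbrs x (A \<union> C))" by simp
    then show "2 \<le> card (nbrs x (A \<union> (C - {y})))"
      by (rule card_nbrs_remove[where w = y]) (use fin assms in auto)
    show "3 \<le> card (nbrs c (A \<union> (C - {y})))" if "c \<in> C - {y} - {x}" for c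
      by (rule pins_nbrs3[OF C]) (use that only fin assms in auto)
  qed (use fin assms \<open>y \<noteq> x\<close> in auto)
  then show ?thesis ..
qed

text \<open>The edge between \<open>x\<close> and \<open>y\<close> is counted in neither pinning, so
  it supplies the third neighbour that each of them may lack.\<close>

lemma tight_of_pins_edge:
  assumes "pins A C x" "pins A D y" "finite A" "adj x y" "y \<notin> C" "x \<notin> D"
  shows "tight A (C \<union> D)"
  unfolding tight_def
proof (intro conjI ballI)
  have fin: "finite C" "finite D" "C \<inter> A = {}" "D \<inter> A = {}" "x \<in> C" "y \<in> D"
    "finite (A \<union> (C \<union> D))"
    using assms by (auto simp: pins_def)
  fix c assume "c \<in> C \<union> D"
  then consider "c = x" | "c = y" | "c \<in> C" "c \<noteq> x" | "c \<in> D" "c \<noteq> y" by blast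
  then show "3 \<le> card (nbrs c (A \<union> (C \<union> D)))"
  proof cases
    case 1
    then show ?thesis
      using pins_nbrs_insert[OF assms(1,3) fin(7), of y] fin assms by blast
  next
    case 2
    then show ?thesis
      using pins_nbrs_insert[OF assms(2,3) fin(7), of x] fin assms adj_sym[of x y] by blast
  next
    case 3
    then show ?thesis using pins_nbrs3[OF assms(1) 3 fin(7)] by blast
  next
    case 4
    then show ?thesis using pins_nbrs3[OF assms(2) 4 fin(7)] by blast
  qed
qed (use assms in \<open>auto simp: pins_def\<close>)

text \<open>Once \<open>joins A\<close> is adjoined to \<open>A\<close>, every vertex outside has at
  most one neighbour in \<open>A\<close>. This is how new vertices are kept free of unwanted
  edges.\<close>

definition joins :: "'v set \<Rightarrow> 'v set" where
  "joins A = {z. \<exists>a\<in>A. \<exists>b\<in>A. a \<noteq> b \<and> adj a z \<and> adj b z}"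

lemma finite_joins:
  assumes "finite A"
  shows "finite (joins A)"
proof -
  have "joins A \<subseteq> (\<Union>a\<in>A. \<Union>b\<in>A - {a}. {z. adj a z \<and> adj b z})" by (auto simp: joins_def)
  moreover have "finite (\<Union>a\<in>A. \<Union>b\<in>A - {a}. {z. adj a z \<and> adj b z})"
    using assms by (intro finite_UN_I finite_common_nbrs) auto
  ultimately show ?thesis by (rule finite_subset)
qed

lemma joins_V: "joins A \<subseteq> V"
  using adj_V2 by (auto simp: joins_def)

lemma joinsI: "a \<in> A \<Longrightarrow> b \<in> A \<Longrightarrow> a \<noteq> b \<Longrightarrow> adj a z \<Longrightarrow> adj b z \<Longrightarrow> z \<in> joins A"
  by (auto simp: joins_def)

section \<open>Existence of unpinned and generic vertices\<close>

lemma ex_finite_on_side: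
  assumes "finite A"
  shows "\<exists>P. finite P \<and> card P = m \<and> P \<subseteq> V \<and> P \<inter> A = {} \<and> (\<forall>p\<in>P. side p = c)"
proof -
  have "infinite ({x \<in> V. side x = c} - A)"
    using infinite_side assms by (rule Diff_infinite_finite[rotated])
  from infinite_arbitrarily_large[OF this, of m]
  obtain P where "P \<subseteq> {x \<in> V. side x = c} - A" "finite P" "card P = m"
    by (elim exE conjE)
  then show ?thesis by (intro exI[of _ P]) auto
qed

text \<open>
  Induction on \<open>n\<close>: if \<open>x\<close> is not pinned by \<open>n\<close> vertices but is pinned by a set \<open>C\<close> of size
  \<open>n + 1\<close>, join \<open>x\<close> to a vertex of \<open>A\<close> by some \<open>y\<close> outside \<open>C\<close>. A set \<open>D\<close> of size \<open>n + 1\<close>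
  pinning \<open>y\<close> either contains \<open>x\<close>, and then \<open>D - {y}\<close> pins \<open>x\<close>, or \<open>C \<union> D\<close> is tight.
\<close>

lemma ex_unpinned:
  assumes "finite A" "A \<subseteq> V"
  shows "\<exists>x\<in>V. x \<notin> A \<and> (\<forall>a\<in>A. \<not> adj a x) \<and> \<not> pinned n A x"
  using assms
proof (induction n arbitrary: A)
  case 0
  have "\<not> pinned 0 A x" for x by (auto simp: pinned_def pins_def)
  then show ?case using ex_nonadjacent[OF 0(1)] by blast
next
  case (Suc n)
  \<comment> \<open>The size exceeds the number of bad choices for \<open>y\<close>: at most
    \<open>Suc n\<close> in \<open>C\<close>, and for each element of \<open>A\<close> at most one
    common neighbour with \<open>x\<close>. Both sides receive such a set because the side of
    \<open>x\<close> is not known in advance.\<close>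
  have "\<forall>c. \<exists>P. finite P \<and> card P = n + card A + 2 \<and> P \<subseteq> V \<and> P \<inter> A = {} \<and> (\<forall>p\<in>P. side p = c)"
    using ex_finite_on_side[OF Suc.prems(1)] by blast
  then obtain P where P: "\<And>c. finite (P c)" "\<And>c. card (P c) = n + card A + 2" "\<And>c. P c \<subseteq> V"
    "\<And>c. P c \<inter> A = {}" "\<And>c p. p \<in> P c \<Longrightarrow> side p = c"
    by metis
  define A1 where "A1 = A \<union> P True \<union> P False"
  define A2 where "A2 = A1 \<union> joins A1"
  \<comment> \<open>Here \<open>2 * n + 2\<close> bounds the union of two sets of size at most
    \<open>Suc n\<close>. Since \<open>x\<close> will avoid \<open>H\<close>, no tight set of that
    size over \<open>A2\<close> contains \<open>x\<close>.\<close>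
  define H where "H = hull (2 * n + 2) A2"
  have A1: "finite A1" "A1 \<subseteq> V" "A \<subseteq> A1" "\<And>c. P c \<subseteq> A1"
    using Suc.prems P unfolding A1_def by (auto, metis (full_types))
  have A2: "finite A2" "A2 \<subseteq> V" "A1 \<subseteq> A2" "joins A1 \<subseteq> A2" "A \<subseteq> A2"
    using A1 finite_joins joins_V by (auto simp: A2_def)
  have H: "finite H" "H \<subseteq> V" "A2 \<subseteq> H"
    unfolding H_def using finite_hull[OF A2(1,2)] hull_V[OF A2(2)] hull_subset by auto
  obtain x where x: "x \<in> V" "x \<notin> H" "\<And>a. a \<in> H \<Longrightarrow> \<not> adj a x" "\<not> pinned n H x"
    using Suc.IH[OF H(1,2)] by blast
  have xA2: "x \<notin> A2" "\<not> pinned n A2 x"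
    using x H pinned_mono[of n A2 x n H] by auto
  have xnon: "\<not> adj a x" "\<not> adj x a" if "a \<in> H" for a
    using x(3)[OF that] adj_sym by blast+
  show ?case
  proof (cases "pinned (Suc n) A2 x")
    case False
    then have "\<not> pinned (Suc n) A x"
      using pinned_mono[of "Suc n" A x "Suc n" A2] A2 xA2 by blast
    then show ?thesis using x A1 A2 H by blast
  next
    case True
    then obtain C where C: "pins A2 C x" "card C \<le> Suc n" by (auto simp: pinned_def)
    have "finite C" "x \<in> C" using C by (auto simp: pins_def)
    define j where "j a = (SOME y. adj a y \<and> adj x y)" for a
    let ?P = "P (side x)"
    have sub: "?P \<subseteq> H" using A1(4) A2 H by blast
    have j: "adj a (j a)" "adj x (j a)" if "a \<in> ?P" for a
    proof -
      have "\<exists>y. adj a y \<and> adj x y"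
        using that sub x P(3,5) by (intro join_ex) auto
      then show "adj a (j a)" "adj x (j a)" unfolding j_def by (metis (mono_tags, lifting) someI_ex)+
    qed
    \<comment> \<open>Two coinciding joins would lie in \<open>joins A1\<close>, hence in
      \<open>H\<close>, to which \<open>x\<close> has no edge.\<close>
    have inj: "inj_on j ?P"
    proof (rule inj_onI, rule ccontr)
      fix a b assume ab: "a \<in> ?P" "b \<in> ?P" "j a = j b" "a \<noteq> b"
      have "j a \<in> joins A1"
        using j(1)[OF ab(1)] j(1)[OF ab(2)] ab A1(4) by (intro joinsI[of a _ b]) auto
      then have "j a \<in> H" using A2 H by blast
      then show False using xnon(2) j(2)[OF ab(1)] by blast
    qed
    define Bad where "Bad = C \<union> (\<Union>a\<in>A. {z. adj a z \<and> adj x z})"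
    have xA: "x \<notin> A" using xA2 A1 A2 by blast
    have "card (\<Union>a\<in>A. {z. adj a z \<and> adj x z}) \<le> (\<Sum>a\<in>A. card {z. adj a z \<and> adj x z})"
      using Suc.prems(1) by (rule card_UN_le)
    also have "\<dots> \<le> (\<Sum>a\<in>A. 1)"
      by (intro sum_mono finite_common_nbrs(2)) (use xA in auto)
    finally have "card Bad < card ?P"
      using C(2) card_Un_le[of C "\<Union>a\<in>A. {z. adj a z \<and> adj x z}"] P(2) by (simp add: Bad_def)
    moreover have "card (j ` ?P) = card ?P" using inj by (rule card_image)
    moreover have "finite Bad"
      unfolding Bad_def using \<open>finite C\<close> Suc.prems(1) xA
      by (intro finite_UnI finite_UN_I finite_common_nbrs(1)) auto
    ultimately have "\<not> j ` ?P \<subseteq> Bad" using card_mono[of Bad "j ` ?P"] by linarith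
    then obtain a where a: "a \<in> ?P" "j a \<notin> Bad" by blast
    define y where "y = j a"
    have y: "adj a y" "adj x y" "y \<notin> C" "\<And>b. b \<in> A \<Longrightarrow> \<not> adj b y" "y \<in> V" "adj y a" "adj y x"
      using j[OF a(1)] a(2) adj_V2 adj_sym by (auto simp: y_def Bad_def)
    have yA2: "y \<notin> A2" using xnon(2)[of y] y H by blast
    have "a \<in> A2" using a A1(4) A2 by blast
    have "\<not> pinned (Suc n) A2 y"
    proof
      assume "pinned (Suc n) A2 y"
      then obtain D where D: "pins A2 D y" "card D \<le> Suc n" by (auto simp: pinned_def)
      have "finite D" "y \<in> D" using D by (auto simp: pins_def)
      show False
      proof (cases "x \<in> D")
        case True
        from pins_remove[OF D(1) this \<open>a \<in> A2\<close> y(6,7) A2(1)] show False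
        proof
          assume "tight A2 D"
          then have "D \<subseteq> H" unfolding H_def by (rule tight_subset_hull) (use D in simp)
          then show False using True x by blast
        next
          assume "pins A2 (D - {y}) x"
          moreover have "card (D - {y}) \<le> n" using D \<open>finite D\<close> \<open>y \<in> D\<close> by simp
          ultimately show False using xA2 by (auto simp: pinned_def)
        qed
      next
        case False
        have "tight A2 (C \<union> D)"
          by (rule tight_of_pins_edge[OF C(1) D(1) A2(1) y(2,3) False])
        then have "C \<union> D \<subseteq> H"
          unfolding H_def by (rule tight_subset_hull) (use C D card_Un_le[of C D] in simp)
        then show False using \<open>x \<in> C\<close> x by blast
      qed
    qed
    then have "\<not> pinned (Suc n) A y"
      using pinned_mono[of "Suc n" A y "Suc n" A2] A2 yA2 by blast
    then show ?thesis using y yA2 A1 A2 by blast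
  qed
qed

text \<open>Used contraposed: a sufficiently unpinned \<open>x\<close> has an unpinned join with one
  of two given vertices. In the main case both pinning sets together with \<open>x\<close> pin
  \<open>x\<close>: its two neighbours are \<open>y1\<close> and \<open>y2\<close>, and each of
  these gains \<open>x\<close> as its third.\<close>

lemma pinned_of_two_joins:
  assumes "finite A" "p1 \<in> A" "p2 \<in> A" "adj p1 y1" "adj p2 y2" "adj x y1" "adj x y2" "y1 \<noteq> y2"
    "x \<notin> A" "pinned n A y1" "pinned n A y2"
  shows "pinned (2 * n + 1) A x"
proof -
  have one: "pinned (2 * n + 1) A x" if "pins A C y" "card C \<le> n" "x \<in> C" "p \<in> A" "adj p y" "adj x y"
    for C y p
  proof -
    have "tight A C \<or> pins A (C - {y}) x"
      using that assms(1) adj_sym by (intro pins_remove[of A C y x p]) auto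
    then have "pins A C x \<or> pins A (C - {y}) x" using tight_imp_pins that by blast
    moreover have "card (C - {y}) \<le> card C" by (intro card_mono) (use that in \<open>auto simp: pins_def\<close>)
    ultimately show ?thesis using that unfolding pinned_def by (metis add_leD1 le_trans mult_2 trans_le_add1)
  qed
  obtain C1 where C1: "pins A C1 y1" "card C1 \<le> n" using assms by (auto simp: pinned_def)
  obtain C2 where C2: "pins A C2 y2" "card C2 \<le> n" using assms by (auto simp: pinned_def)
  show ?thesis
  proof (cases "x \<in> C1 \<or> x \<in> C2")
    case True
    then show ?thesis using one[OF C1 _ assms(2,4,6)] one[OF C2 _ assms(3,5,7)] by blast
  next
    case False
    have fin: "finite (A \<union> insert x (C1 \<union> C2))" "y1 \<in> C1" "y2 \<in> C2" "finite C1" "finite C2"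
      using C1 C2 assms by (auto simp: pins_def)
    have "pins A (insert x (C1 \<union> C2)) x"
      unfolding pins_def
    proof (intro conjI ballI)
      have "card {y1, y2} \<le> card (nbrs x (A \<union> insert x (C1 \<union> C2)))"
        using fin assms by (intro card_mono) (auto simp: nbrs_def)
      then show "2 \<le> card (nbrs x (A \<union> insert x (C1 \<union> C2)))" using assms(8) by simp
      fix c assume "c \<in> insert x (C1 \<union> C2) - {x}"
      then consider "c = y1" | "c = y2" | "c \<in> C1" "c \<noteq> y1" | "c \<in> C2" "c \<noteq> y2" by blast
      then show "3 \<le> card (nbrs c (A \<union> insert x (C1 \<union> C2)))"
      proof cases
        case 1
        then show ?thesis
          using pins_nbrs_insert[OF C1(1) assms(1) fin(1), of x] False assms adj_sym[of x y1] by blast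
      next
        case 2
        then show ?thesis
          using pins_nbrs_insert[OF C2(1) assms(1) fin(1), of x] False assms adj_sym[of x y2] by blast
      next
        case 3
        then show ?thesis using pins_nbrs3[OF C1(1) 3 fin(1)] by blast
      next
        case 4
        then show ?thesis using pins_nbrs3[OF C2(1) 4 fin(1)] by blast
      qed
    qed (use fin C1 C2 assms adj_V in \<open>auto simp: pins_def\<close>)
    moreover have "card (insert x (C1 \<union> C2)) \<le> 2 * n + 1"
      using C1(2) C2(2) card_Un_le[of C1 C2] card_insert_le_m1[of "2 * n + 1" "C1 \<union> C2" x] by simp
    ultimately show ?thesis by (auto simp: pinned_def)
  qed
qed

text \<open>In \<open>ex_unpinned\<close> the side is left to chance. If \<open>x\<close> falls on
  the wrong side, it is joined to two vertices \<open>p1\<close>, \<open>p2\<close> of that side,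
  and one of the two joins takes its place.\<close>

lemma ex_unpinned_side:
  assumes "finite A" "A \<subseteq> V"
  shows "\<exists>x\<in>V. side x = c \<and> x \<notin> A \<and> (\<forall>a\<in>A. \<not> adj a x) \<and> \<not> pinned n A x"
proof -
  obtain P where P: "finite P" "card P = 2" "P \<subseteq> V" "P \<inter> A = {}" "\<And>p. p \<in> P \<Longrightarrow> side p = (\<not> c)"
    using ex_finite_on_side[OF assms(1), of 2 "\<not> c"] by blast
  then obtain p1 p2 where p: "P = {p1, p2}" "p1 \<noteq> p2" by (auto simp: card_2_iff)
  define A1 where "A1 = A \<union> P"
  define A2 where "A2 = A1 \<union> joins A1"
  have A2: "finite A2" "A2 \<subseteq> V" "A \<subseteq> A2" "P \<subseteq> A2" "joins A1 \<subseteq> A2"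
    using assms P finite_joins joins_V by (auto simp: A2_def A1_def)
  obtain x where x: "x \<in> V" "x \<notin> A2" "\<And>a. a \<in> A2 \<Longrightarrow> \<not> adj a x" "\<not> pinned (2 * n + 1) A2 x"
    using ex_unpinned[OF A2(1,2)] by blast
  show ?thesis
  proof (cases "side x = c")
    case True
    have "\<not> pinned n A x" using pinned_mono[of n A x "2 * n + 1" A2] x A2 by auto
    then show ?thesis using x True A2 by blast
  next
    case False
    have good: "\<exists>y. adj q y \<and> adj x y \<and> y \<notin> A2 \<and> side y = c \<and> (\<forall>a\<in>A. \<not> adj a y)" if "q \<in> P" for q
    proof -
      have "q \<noteq> x" "side q = side x" "q \<in> V" using that x A2 P False by auto
      then obtain y where y: "adj q y" "adj x y" using x(1) join_obtain by blast
      have "y \<notin> A2" using x(3)[of y] y adj_sym by blast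
      moreover have "side y = c" using y False adj_side[of x y] by auto
      moreover have "\<not> adj a y" if "a \<in> A" for a
        
      proof
        assume "adj a y"
        moreover have "a \<noteq> q" "a \<in> A1" "q \<in> A1" using that \<open>q \<in> P\<close> P(4) by (auto simp: A1_def)
        ultimately have "y \<in> joins A1" using joinsI y by blast
        then show False using \<open>y \<notin> A2\<close> A2 by blast
      qed
      ultimately show ?thesis using y by blast
    qed
    obtain y1 where y1: "adj p1 y1" "adj x y1" "y1 \<notin> A2" "side y1 = c" "\<forall>a\<in>A. \<not> adj a y1"
      using good p by blast
    obtain y2 where y2: "adj p2 y2" "adj x y2" "y2 \<notin> A2" "side y2 = c" "\<forall>a\<in>A. \<not> adj a y2"
      using good p by blast
    have "y1 \<noteq> y2" using joinsI[of p1 A1 p2 y1] p y1 y2 A2 by (auto simp: A1_def)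
    have "\<not> (pinned n A2 y1 \<and> pinned n A2 y2)"
      using pinned_of_two_joins[OF A2(1) _ _ y1(1) y2(1) y1(2) y2(2) \<open>y1 \<noteq> y2\<close> x(2)] x(4) p A2 by blast
    then have "\<not> (pinned n A y1 \<and> pinned n A y2)"
      using pinned_mono[of n A _ n A2] A2 y1(3) y2(3) by blast
    then show ?thesis using y1 y2 A2 adj_V2 by blast
  qed
qed

text \<open>An unpinned \<open>x\<close> opposite to \<open>p\<close> meets \<open>l1\<close> and
  \<open>l2\<close> in two vertices, one of which, \<open>y\<close>, is unpinned; \<open>b\<close>
  is the join of \<open>p\<close> and \<open>y\<close>. A set pinning \<open>b\<close> would yield
  one pinning \<open>y\<close> that is larger by at most one element, hence the bound
  \<open>Suc n\<close> for \<open>y\<close>. Nonadjacency of \<open>p\<close> to \<open>l1\<close>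
  and \<open>l2\<close> makes \<open>b\<close> differ from both.\<close>

lemma ex_unpinned_at:
  assumes "finite A" "A \<subseteq> V" "p \<in> A"
  shows "\<exists>b\<in>V. b \<notin> A \<and> adj p b \<and> (\<forall>a\<in>A. adj a b \<longrightarrow> a = p) \<and> \<not> pinned n A b"
proof -
  have "p \<in> V" using assms by blast
  obtain l1 where l1: "l1 \<in> V" "side l1 \<noteq> side p" "\<not> adj p l1"
    using ex_nonadjacent[of "{p}" "\<not> side p"] by auto
  obtain l2 where l2: "l2 \<in> V" "side l2 \<noteq> side p" "\<not> adj p l2" "l2 \<noteq> l1"
    using ex_nonadjacent[of "{p, l1}" "\<not> side p"] by auto
  define A1 where "A1 = A \<union> {l1, l2}"
  define A2 where "A2 = A1 \<union> joins A1"
  \<comment> \<open>The second closure under joins keeps \<open>b\<close> out of \<open>A2\<close>: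
    otherwise \<open>y\<close>, a common neighbour of \<open>b\<close> and \<open>l\<close>, would
    lie in \<open>joins A2\<close>, but \<open>y\<close> is adjacent to \<open>x\<close> and so not
    in \<open>A3\<close>.\<close>
  define A3 where "A3 = A2 \<union> joins A2"
  have A1: "finite A1" "A1 \<subseteq> V" "A \<subseteq> A1" "l1 \<in> A1" "l2 \<in> A1" "p \<in> A1"
    using assms l1 l2 by (auto simp: A1_def)
  have A2: "finite A2" "A2 \<subseteq> V" "A1 \<subseteq> A2" "joins A1 \<subseteq> A2"
    using A1 finite_joins joins_V by (auto simp: A2_def)
  have A3: "finite A3" "A3 \<subseteq> V" "A2 \<subseteq> A3" "joins A2 \<subseteq> A3" "A1 \<subseteq> A3"
    using A2 finite_joins joins_V by (auto simp: A3_def)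
  obtain x where x: "x \<in> V" "side x = (\<not> side p)" "x \<notin> A3" "\<And>a. a \<in> A3 \<Longrightarrow> \<not> adj a x"
    "\<not> pinned (2 * Suc n + 1) A3 x"
    using ex_unpinned_side[OF A3(1,2)] by blast
  have xnon: "\<not> adj x a" if "a \<in> A3" for a using x(4)[OF that] adj_sym by blast
  have "l1 \<noteq> x" "l2 \<noteq> x" using x(3) A1 A2 A3 by auto
  then obtain y1 y2 where y12: "adj l1 y1" "adj x y1" "adj l2 y2" "adj x y2"
    using join_obtain[of l1 x] join_obtain[of l2 x] l1 l2 x(1,2) by metis
  have "y1 \<noteq> y2"
  proof
    assume "y1 = y2"
    then have "y1 \<in> joins A1" using joinsI[of l1 A1 l2 y1] A1 l2 y12 by auto
    then show False using xnon[of y1] y12 A2 A3 by blast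
  qed
  then have "\<not> (pinned (Suc n) A3 y1 \<and> pinned (Suc n) A3 y2)"
    using pinned_of_two_joins[of A3 l1 l2 y1 y2 x "Suc n"] A1 A2 A3 y12 x by blast
  then obtain l y where y: "l \<in> {l1, l2}" "adj l y" "adj x y" "\<not> pinned (Suc n) A3 y"
    using y12 by blast
  have yA3: "y \<notin> A3" using xnon y by blast
  have yA1: "\<not> pinned (Suc n) A1 y"
    using pinned_mono[of "Suc n" A1 y "Suc n" A3] y(4) yA3 A3 by blast
  have l: "l \<in> A1" "\<not> adj p l" using y l1 l2 A1 by auto
  have "y \<in> V" "y \<noteq> p" "side y = side p"
    using y yA3 A1 A2 A3 x(2) adj_V2 adj_side[of x y] by auto
  then obtain b where b: "adj p b" "adj y b" using join_obtain \<open>p \<in> V\<close> by metis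
  have "b \<noteq> l" using b l by blast
  have bA2: "b \<notin> A2"
  proof
    assume "b \<in> A2"
    then have "y \<in> joins A2"
      using joinsI[of l A2 b y] \<open>b \<noteq> l\<close> l A2 y b adj_sym by blast
    then show False using yA3 A3 by blast
  qed
  have only: "a = p" if "a \<in> A" "adj a b" for a
    using joinsI[of a A1 p b] that b A1 A2 bA2 by blast
  have "\<not> pinned n A1 b"
  proof
    assume "pinned n A1 b"
    then obtain C where C: "pins A1 C b" "card C \<le> n" by (auto simp: pinned_def)
    have fin: "finite C" "b \<in> C" "C \<inter> A1 = {}" "C \<subseteq> V" using C by (auto simp: pins_def)
    show False
    proof (cases "y \<in> C")
      case True
      have "tight A1 C \<or> pins A1 (C - {b}) y"
        by (rule pins_remove[OF C(1) True A1(6) _ _ A1(1)]) (use b adj_sym in auto)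
      then have "pins A1 C y \<or> pins A1 (C - {b}) y" using tight_imp_pins True by blast
      moreover have "card (C - {b}) \<le> card C" using fin by (intro card_mono) auto
      ultimately show False using yA1 C(2) unfolding pinned_def by (meson le_SucI le_trans)
    next
      case False
      have finT: "finite (A1 \<union> insert y C)" using fin A1 by simp
      have "pins A1 (insert y C) y"
        unfolding pins_def
      proof (intro conjI ballI)
        have "card {l, b} \<le> card (nbrs y (A1 \<union> insert y C))"
          using finT fin l b adj_sym[OF y(2)] by (intro card_mono) (auto simp: nbrs_def)
        then show "2 \<le> card (nbrs y (A1 \<union> insert y C))" using \<open>b \<noteq> l\<close> by simp
        fix c assume c: "c \<in> insert y C - {y}"
        show "3 \<le> card (nbrs c (A1 \<union> insert y C))"
        proof (cases "c = b")
          case True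
          have "y \<notin> A1" using yA3 A2 A3 by blast
          then show ?thesis
            using pins_nbrs_insert[OF C(1) A1(1) finT, of y] False b True adj_sym by blast
        next
          case False
          then show ?thesis using pins_nbrs3[OF C(1) _ False finT] c by blast
        qed
      qed (use fin A1 A2 A3 yA3 \<open>y \<in> V\<close> in auto)
      moreover have "card (insert y C) \<le> Suc n" using C(2) fin by (simp add: card_insert_if)
      ultimately show False using yA1 by (auto simp: pinned_def)
    qed
  qed
  then have "\<not> pinned n A b"
    using pinned_mono[of n A b n A1] A1 A2 bA2 by auto
  then show ?thesis using b bA2 only A1 A2 adj_V2 by blast
qed

text \<open>With a prescribed neighbour \<open>p\<close>, a neighbour \<open>d\<close> of
  \<open>b\<close> in a small tight \<open>C\<close> is the second one needed for
  \<open>insert b C\<close> to pin \<open>b\<close>. Without \<open>p\<close> the vertex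
  \<open>d\<close> alone is not enough. The witness \<open>z\<close> is therefore anchored outside
  \<open>A\<close>, as an unpinned neighbour of some \<open>l\<close> which is itself an unpinned
  neighbour of a chosen \<open>p\<close>.\<close>

lemma ex_generic:
  assumes "finite A" "A \<subseteq> V" "P \<subseteq> A" "card P \<le> 1" "\<And>p. p \<in> P \<Longrightarrow> side p \<noteq> c"
  shows "\<exists>b\<in>V. side b = c \<and> b \<notin> A \<and> (\<forall>a\<in>A. adj a b \<longleftrightarrow> a \<in> P) \<and>
    (\<forall>C. tight (insert b A) C \<longrightarrow> card C \<le> n \<longrightarrow> (\<forall>d\<in>C. \<not> adj b d))"
proof (cases "P = {}")
  case False
  moreover have "finite P" using assms finite_subset by blast
  ultimately have "card P = 1" using assms(4) by (simp add: card_gt_0_iff order_antisym Suc_leI)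
  then obtain p where P: "P = {p}" using card_1_singletonE by blast
  have p: "p \<in> A" "side p \<noteq> c" using P assms by auto
  obtain b where b: "b \<in> V" "b \<notin> A" "adj p b" "\<And>a. a \<in> A \<Longrightarrow> adj a b \<Longrightarrow> a = p" "\<not> pinned (Suc n) A b"
    using ex_unpinned_at[OF assms(1,2) p(1)] by blast
  have "\<not> adj b d" if C: "tight (insert b A) C" "card C \<le> n" and "d \<in> C" for C d
  proof
    assume "adj b d"
    have fin: "finite C" "C \<subseteq> V" "C \<inter> A = {}" "b \<notin> C" using C by (auto simp: tight_def)
    have finT: "finite (A \<union> insert b C)" using fin assms by simp
    have "pins A (insert b C) b"
      unfolding pins_def
    proof (intro conjI ballI)
      have "card {p, d} \<le> card (nbrs b (A \<union> insert b C))"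
        using finT \<open>adj b d\<close> \<open>d \<in> C\<close> p adj_sym[OF b(3)] by (intro card_mono) (auto simp: nbrs_def)
      moreover have "p \<noteq> d" using p fin \<open>d \<in> C\<close> by blast
      ultimately show "2 \<le> card (nbrs b (A \<union> insert b C))" by simp
      show "3 \<le> card (nbrs c (A \<union> insert b C))" if "c \<in> insert b C - {b}" for c
        by (rule tight_nbrs[OF C(1) _ finT]) (use that in auto)
    qed (use fin b in auto)
    moreover have "card (insert b C) \<le> Suc n" using C fin by simp
    ultimately show False using b(5) by (auto simp: pinned_def)
  qed
  moreover have "side b = c" using adj_side[OF b(3)] p(2) by auto
  moreover have "\<forall>a\<in>A. adj a b \<longleftrightarrow> a \<in> P" using b(3,4) P by blast
  ultimately show ?thesis using b(1,2) by blast
next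
  case True
  obtain p where p: "p \<in> V" "side p = c" using infinite_side[of c] infinite_imp_nonempty by blast
  define A' where "A' = insert p A"
  have A': "finite A'" "A' \<subseteq> V" "p \<in> A'" "A \<subseteq> A'" using assms p by (auto simp: A'_def)
  obtain l where l: "l \<in> V" "l \<notin> A'" "adj p l" "\<And>a. a \<in> A' \<Longrightarrow> adj a l \<Longrightarrow> a = p" "\<not> pinned (Suc n) A' l"
    using ex_unpinned_at[OF A'(1-3)] by blast
  define B where "B = insert l A'"
  have B: "finite B" "B \<subseteq> V" "l \<in> B" using A' l by (auto simp: B_def)
  obtain z where z: "z \<in> V" "z \<notin> B" "adj l z" "\<And>a. a \<in> B \<Longrightarrow> adj a z \<Longrightarrow> a = l" "\<not> pinned (Suc n) B z"
    using ex_unpinned_at[OF B] by blast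
  have "side z = c" using p(2) adj_side[OF l(3)] adj_side[OF z(3)] by auto
  have nonadj: "\<not> adj a z" if "a \<in> A" for a using z(4)[of a] that l(2) A'(4) by (auto simp: B_def)
  have "\<not> adj z d" if C: "tight (insert z A) C" "card C \<le> n" and "d \<in> C" for C d
  proof
    assume "adj z d"
    define D where "D = C - insert z A'"
    have D: "tight (insert z A') D"
      unfolding D_def by (rule tight_extend[OF C(1)]) (use A' in auto)
    have fin: "finite C" "finite D" "D \<subseteq> V" "D \<inter> A' = {}" "z \<notin> D"
      using C D by (auto simp: tight_def)
    have "card D \<le> n" using card_mono[of C D] C fin by (auto simp: D_def)
    have "d \<noteq> p" using adj_sym[OF \<open>adj z d\<close>] z(4)[of p] A' l(2) by (auto simp: B_def)
    moreover have "d \<noteq> z" using \<open>adj z d\<close> adj_side by blast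
    moreover have "d \<notin> A" using C \<open>d \<in> C\<close> by (auto simp: tight_def)
    ultimately have "d \<in> D" using \<open>d \<in> C\<close> by (auto simp: D_def A'_def)
    show False
    \<comment> \<open>A neighbour of \<open>z\<close> in \<open>D\<close> other than
      \<open>l\<close> makes \<open>z\<close> pinned over \<open>B\<close>. Otherwise removing
      \<open>z\<close> costs only \<open>l\<close> a neighbour, so \<open>D\<close> pins
      \<open>l\<close> over \<open>A'\<close>.\<close>
    proof (cases "\<exists>d'\<in>D. adj z d' \<and> d' \<noteq> l")
      case True
      then obtain d' where d': "d' \<in> D" "adj z d'" "d' \<noteq> l" by blast
      have finT: "finite (B \<union> insert z (D - {l}))" using B fin by simp
      have "pins B (insert z (D - {l})) z"
        unfolding pins_def
      proof (intro conjI ballI)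
        have "card {l, d'} \<le> card (nbrs z (B \<union> insert z (D - {l})))"
          using finT d' B adj_sym[OF z(3)] by (intro card_mono) (auto simp: nbrs_def)
        then show "2 \<le> card (nbrs z (B \<union> insert z (D - {l})))" using d' by simp
        show "3 \<le> card (nbrs c (B \<union> insert z (D - {l})))" if "c \<in> insert z (D - {l}) - {z}" for c
          by (rule tight_nbrs[OF D _ finT]) (use that in \<open>auto simp: B_def\<close>)
      qed (use fin(2-5) z(1,2) in \<open>auto simp: B_def\<close>)
      moreover have "card (insert z (D - {l})) \<le> Suc n"
        using \<open>card D \<le> n\<close> fin card_mono[of D "D - {l}"] by (auto simp: card_insert_if)
      ultimately show False using z(5) by (auto simp: pinned_def)
    next
      case False
      then have "l \<in> D" and only: "\<And>c. c \<in> D \<Longrightarrow> adj c z \<Longrightarrow> c = l"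
        using \<open>adj z d\<close> \<open>d \<in> D\<close> adj_sym by blast+
      have finT: "finite (A' \<union> D)" using A' fin by simp
      have "pins A' D l"
        unfolding pins_def
      proof (intro conjI ballI)
        have "Suc 2 \<le> card (nbrs l (insert z A' \<union> D))" using D \<open>l \<in> D\<close> by (auto simp: tight_def)
        then show "2 \<le> card (nbrs l (A' \<union> D))"
          by (rule card_nbrs_remove[where w = z]) (use A' fin in auto)
        show "3 \<le> card (nbrs c (A' \<union> D))" if "c \<in> D - {l}" for c
          by (rule tight_nbrs[OF D _ finT]) (use that only in auto)
      qed (use fin \<open>l \<in> D\<close> in auto)
      then show False using l(5) \<open>card D \<le> n\<close> by (auto simp: pinned_def)
    qed
  qed
  moreover have "z \<notin> A" using z(2) A'(4) by (auto simp: B_def)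
  ultimately show ?thesis using z(1) \<open>side z = c\<close> nonadj True by blast
qed

end


section \<open>The back-and-forth system\<close>

locale open_plane_graph_pair =
  M: open_plane_graph V1 adj1 side1 + N: open_plane_graph V2 adj2 side2
  for V1 :: "'v set" and adj1 side1 and V2 :: "'w set" and adj2 side2
begin

section \<open>Isomorphisms of hulls and generic extensions\<close>

definition iso :: "('v \<Rightarrow> 'w) \<Rightarrow> 'v set \<Rightarrow> 'w set \<Rightarrow> bool" where
  "iso f S T \<longleftrightarrow> bij_betw f S T \<and> (\<forall>x\<in>S. side2 (f x) = side1 x) \<and>
     (\<forall>x\<in>S. \<forall>y\<in>S. adj2 (f x) (f y) \<longleftrightarrow> adj1 x y)"

lemma isoD:
  assumes "iso f S T"
  shows "inj_on f S" "f ` S = T" "x \<in> S \<Longrightarrow> side2 (f x) = side1 x"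
    "x \<in> S \<Longrightarrow> y \<in> S \<Longrightarrow> adj2 (f x) (f y) \<longleftrightarrow> adj1 x y"
  using assms by (auto simp: iso_def bij_betw_def)

lemma swap: "open_plane_graph_pair V2 adj2 side2 V1 adj1 side1"
  by unfold_locales

text \<open>Edges need only be preserved, since extra edges in the image can only add neighbours.
  This matters in \<open>generic_extension_hull\<close>, where tight sets are pulled back along a
  map that need not reflect edges.\<close>

lemma tight_image:
  assumes "inj_on f (A \<union> C)" "f ` C \<subseteq> V2" "finite A" "M.tight A C"
    "\<And>x y. x \<in> A \<union> C \<Longrightarrow> y \<in> A \<union> C \<Longrightarrow> adj1 x y \<Longrightarrow> adj2 (f x) (f y)"
  shows "N.tight (f ` A) (f ` C)" "card (f ` C) = card C"
proof -
  have fin: "finite C" "C \<inter> A = {}" using assms by (auto simp: M.tight_def)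
  show "card (f ` C) = card C" by (rule card_image, rule inj_on_subset[OF assms(1)]) auto
  show "N.tight (f ` A) (f ` C)"
    unfolding N.tight_def
  proof (intro conjI ballI)
    show "f ` C \<inter> f ` A = {}"
      using fin inj_on_image_Int[OF assms(1), of C A] by auto
    fix c' assume "c' \<in> f ` C"
    then obtain c where c: "c \<in> C" "c' = f c" by blast
    have "card (f ` M.nbrs c (A \<union> C)) = card (M.nbrs c (A \<union> C))"
      by (rule card_image, rule inj_on_subset[OF assms(1)]) (use c in \<open>auto simp: M.nbrs_def\<close>)
    moreover have "f ` M.nbrs c (A \<union> C) \<subseteq> N.nbrs c' (f ` A \<union> f ` C)"
      using assms(5)[of c] c by (auto simp: M.nbrs_def N.nbrs_def)
    then have "card (f ` M.nbrs c (A \<union> C)) \<le> card (N.nbrs c' (f ` A \<union> f ` C))"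
      using fin assms(3) by (intro card_mono N.finite_nbrs) auto
    moreover have "3 \<le> card (M.nbrs c (A \<union> C))" using assms(4) c by (auto simp: M.tight_def)
    ultimately show "3 \<le> card (N.nbrs c' (f ` A \<union> f ` C))" by linarith
  qed (use fin assms in auto)
qed

lemma iso_inverse:
  assumes "iso f S T" "S' \<subseteq> S"
  shows "open_plane_graph_pair.iso adj2 side2 adj1 side1 (inv_into S f) (f ` S') S'"
proof -
  interpret sw: open_plane_graph_pair V2 adj2 side2 V1 adj1 side1 by (rule swap)
  note f = isoD[OF assms(1)]
  have inv: "inv_into S f (f x) = x" if "x \<in> S'" for x
    using that assms(2) inv_into_f_f[OF f(1)] by blast
  show ?thesis
    unfolding sw.iso_def bij_betw_def
    using assms(2) inv f by (auto simp: inj_on_def image_image subset_iff)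
qed

lemma iso_hull_subset:
  assumes "iso f (M.hull n A) T" "T \<subseteq> V2" "m \<le> n" "finite A"
  shows "f ` M.hull m A \<subseteq> N.hull m (f ` A)"
proof
  note f = isoD[OF assms(1)]
  fix y assume "y \<in> f ` M.hull m A"
  then obtain x where x: "x \<in> M.hull m A" "y = f x" by blast
  show "y \<in> N.hull m (f ` A)"
  proof (cases "x \<in> A")
    case True
    then show ?thesis using x N.hull_subset by blast
  next
    case False
    then obtain C where C: "M.tight A C" "card C \<le> m" "x \<in> C" using x by (auto simp: M.hull_def)
    have "C \<subseteq> M.hull n A" by (rule M.tight_subset_hull[OF C(1)]) (use C(2) assms(3) in simp)
    then have sub: "A \<union> C \<subseteq> M.hull n A" using M.hull_subset by blast
    have "f ` C \<subseteq> V2" using sub f(2) assms(2) by blast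
    have edge: "adj2 (f x) (f y)" if "x \<in> A \<union> C" "y \<in> A \<union> C" "adj1 x y" for x y
      using that sub f(4)[of x y] by blast
    note ti = tight_image[OF inj_on_subset[OF f(1) sub] \<open>f ` C \<subseteq> V2\<close> assms(4) C(1) edge]
    have "f ` C \<subseteq> N.hull m (f ` A)"
      by (rule N.tight_subset_hull[OF ti(1)]) (use ti(2) C(2) in auto)
    then show ?thesis using C(3) x(2) by blast
  qed
qed

text \<open>The reverse inclusion is \<open>iso_hull_subset\<close> for the inverse map. One
  isomorphism at the largest depth thus controls all smaller hulls.\<close>

lemma iso_hull:
  assumes f: "iso f (M.hull n A) (N.hull n (f ` A))" and "f ` A \<subseteq> V2" "A \<subseteq> V1" "finite A" "m \<le> n"
  shows "f ` M.hull m A = N.hull m (f ` A)"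
proof
  show "f ` M.hull m A \<subseteq> N.hull m (f ` A)"
    by (rule iso_hull_subset[OF f]) (use assms N.hull_V in auto)
  interpret sw: open_plane_graph_pair V2 adj2 side2 V1 adj1 side1 by (rule swap)
  let ?g = "inv_into (M.hull n A) f"
  have inv: "?g (f x) = x" if "x \<in> M.hull n A" for x
    using that isoD(1)[OF f] by simp
  have gA: "?g ` f ` A = A" using inv M.hull_subset[of A n] by (force simp: image_image)
  have "sw.iso ?g (N.hull n (f ` A)) (M.hull n A)"
    using iso_inverse[OF f subset_refl] isoD(2)[OF f] by simp
  then have "?g ` N.hull m (f ` A) \<subseteq> M.hull m (?g ` f ` A)"
    by (rule sw.iso_hull_subset) (use assms M.hull_V in auto)
  then have g: "?g ` N.hull m (f ` A) \<subseteq> M.hull m A" by (simp only: gA)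
  show "N.hull m (f ` A) \<subseteq> f ` M.hull m A"
  proof
    fix y assume y: "y \<in> N.hull m (f ` A)"
    then have "y \<in> f ` M.hull n A" using N.hull_mono[OF assms(5)] isoD(2)[OF f] by blast
    then have "f (?g y) = y" by (rule f_inv_into_f)
    then show "y \<in> f ` M.hull m A" using g y by force
  qed
qed

text \<open>\<open>D\<close> and \<open>E\<close> are two hulls, one inside the other, and
  \<open>X\<close> is the new material. Edges between \<open>X\<close> and \<open>E - D\<close> are
  not copied; their images are kept nonadjacent. The last clause is genericity: no set of at most
  \<open>n\<close> elements that is tight over everything placed so far touches the image of
  \<open>X\<close>.\<close>

definition generic_extension ::
  "('v \<Rightarrow> 'w) \<Rightarrow> 'v set \<Rightarrow> 'v set \<Rightarrow> nat \<Rightarrow> 'v set \<Rightarrow> ('v \<Rightarrow> 'w) \<Rightarrow> bool" where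
  "generic_extension f D E n X g \<longleftrightarrow>
    iso g (D \<union> X) (g ` (D \<union> X)) \<and> (\<forall>x\<in>D. g x = f x) \<and> g ` X \<subseteq> V2 - f ` E \<and>
    (\<forall>x\<in>X. \<forall>y\<in>E - D. \<not> adj2 (g x) (f y)) \<and>
    (\<forall>C. N.tight (f ` E \<union> g ` X) C \<longrightarrow> card C \<le> n \<longrightarrow> (\<forall>c\<in>C. \<forall>x\<in>X. \<not> adj2 (g x) c))"

lemma generic_extensionD:
  assumes "generic_extension f D E n X g"
  shows "iso g (D \<union> X) (g ` (D \<union> X))" "\<And>x. x \<in> D \<Longrightarrow> g x = f x" "g ` X \<subseteq> V2 - f ` E"
    "\<And>x y. x \<in> X \<Longrightarrow> y \<in> E - D \<Longrightarrow> \<not> adj2 (g x) (f y)"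
    "\<And>C c x. N.tight (f ` E \<union> g ` X) C \<Longrightarrow> card C \<le> n \<Longrightarrow> c \<in> C \<Longrightarrow> x \<in> X \<Longrightarrow> \<not> adj2 (g x) c"
  using assms unfolding generic_extension_def by blast+

text \<open>No nonempty part of \<open>X\<close> is tight over \<open>D\<close>, so some
  \<open>b\<close> has at most two neighbours among the others and can be placed last. With at most
  one, \<open>ex_generic\<close> places it. With two, it must be the join of their images, and the
  work lies in showing that this join is new, has no third neighbour and is generic.\<close>

lemma generic_embedding:
  assumes f: "iso f E2 F2" and sub: "D \<subseteq> E" "E \<subseteq> E2" "E2 \<subseteq> V1" "F2 \<subseteq> V2" "finite E"
    and hull: "N.hull K (f ` E) \<subseteq> F2"
    and X: "finite X" "X \<subseteq> V1" "X \<inter> E2 = {}" "n + card X \<le> K"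
    and opn: "\<And>C. C \<subseteq> X \<Longrightarrow> M.tight D C \<Longrightarrow> C = {}"
  shows "\<exists>g. generic_extension f D E n X g"
  using X opn
proof (induction "card X" arbitrary: X n)
  case 0
  then have X: "X = {}" by simp
  have "D \<subseteq> E2" using sub by blast
  then have "iso f D (f ` D)"
    using f inj_on_subset unfolding iso_def bij_betw_def by blast
  then show ?case using X by (intro exI[of _ f]) (simp add: generic_extension_def)
next
  case (Suc k)
  note f = isoD[OF assms(1)]
  have "X \<noteq> {}" using Suc.hyps(2) by auto
  have DX: "X \<inter> D = {}" using Suc.prems sub by auto
  have "\<not> M.tight D X" using Suc.prems(5)[of X] \<open>X \<noteq> {}\<close> by blast
  then have "\<not> (\<forall>b\<in>X. 3 \<le> card (M.nbrs b (D \<union> X)))"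
    using Suc.prems(1,2) DX unfolding M.tight_def by blast
  then obtain b where b: "b \<in> X" "card (M.nbrs b (D \<union> X)) < 3"
    by (auto simp: not_le)
  define Y where "Y = X - {b}"
  have cX: "card X = Suc (card Y)" unfolding Y_def by (rule card.remove[OF Suc.prems(1) b(1)])
  then have "k = card Y" using Suc.hyps(2) by linarith
  have "X = insert b Y" "b \<notin> Y" "finite Y" "Y \<subseteq> V1" "Y \<inter> E2 = {}"
    using b(1) Suc.prems(1-3) unfolding Y_def by blast+
  note Y = this cX \<open>k = card Y\<close>
  have bD: "b \<notin> D" "b \<notin> E2" "b \<in> V1" using b(1) DX Suc.prems(2,3) by auto
  \<comment> \<open>The bound is \<open>Suc n\<close> for \<open>Y\<close> because a set of size
    \<open>n\<close> gains one element when the image of \<open>b\<close> is added to it. This is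
    why \<open>n + card X\<close> has to stay below \<open>K\<close>.\<close>
  have "\<exists>g. generic_extension f D E (Suc n) Y g"
  proof (rule Suc.hyps(1)[OF Y(7,3-5)])
    show "Suc n + card Y \<le> K" using Suc.prems Y by simp
    show "C = {}" if "C \<subseteq> Y" "M.tight D C" for C using Suc.prems(5)[of C] that Y(1) by blast
  qed
  then obtain g where "generic_extension f D E (Suc n) Y g" ..
  note g = generic_extensionD[OF this]
  note g' = isoD[OF g(1)]
  define A where "A = f ` E \<union> g ` Y"
  have A: "finite A" "A \<subseteq> V2" "f ` E \<subseteq> A" "g ` (D \<union> Y) \<subseteq> A"
  proof -
    show "finite A" using sub(5) Y(3) by (simp add: A_def)
    have "f ` E \<subseteq> V2" using sub(2,4) f(2) by blast
    then show "A \<subseteq> V2" using g(3) by (auto simp: A_def)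
    show "f ` E \<subseteq> A" by (simp add: A_def)
    have "g ` D \<subseteq> f ` E" using g(2) sub(1) by auto
    then show "g ` (D \<union> Y) \<subseteq> A" by (auto simp: A_def)
  qed
  have tightF: "N.tight (f ` E) C" if "N.tight A C" "card C \<le> Suc n" for C
  proof (rule N.tight_shrink[OF that(1) A(1)])
    show "a \<in> f ` E" if "c \<in> C" "a \<in> A" "adj2 c a" for c a
      using that g(5)[of C c] \<open>N.tight A C\<close> \<open>card C \<le> Suc n\<close> N.adj_sym[of c a] by (auto simp: A_def)
  qed (use A in auto)
  define P where "P = M.nbrs b (D \<union> Y)"
  have Psub: "P \<subseteq> D \<union> Y" by (auto simp: P_def M.nbrs_def)
  have "finite (D \<union> X)" using sub Suc.prems(1) finite_subset by blast
  then have "card P \<le> card (M.nbrs b (D \<union> X))"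
    by (intro card_mono M.finite_nbrs) (auto simp: P_def M.nbrs_def Y(1))
  then have cP: "card P \<le> 2" using b by linarith
  have "finite P" using Psub sub Y finite_subset by (metis finite_UnI)
  have gP: "g ` P \<subseteq> A" using Psub A by blast
  have sideP: "side2 p \<noteq> side1 b" if "p \<in> g ` P" for p
    using that g'(3) M.adj_side[of b] Psub by (auto simp: P_def M.nbrs_def)
  have "\<exists>b'\<in>V2. side2 b' = side1 b \<and> b' \<notin> A \<and> (\<forall>a\<in>A. adj2 a b' \<longleftrightarrow> a \<in> g ` P) \<and>
    (\<forall>C. N.tight (insert b' A) C \<longrightarrow> card C \<le> n \<longrightarrow> (\<forall>d\<in>C. \<not> adj2 b' d))"
  proof (cases "card P = 2")
    case False
    then have "card (g ` P) \<le> 1" using cP card_image_le[OF \<open>finite P\<close>, of g] by linarith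
    then show ?thesis using N.ex_generic[OF A(1,2) gP _ sideP] by blast
  next
    case True
    then obtain u v where uv: "P = {u, v}" "u \<noteq> v" by (auto simp: card_2_iff)
    have uv': "u \<in> D \<union> Y" "v \<in> D \<union> Y" "adj1 b u" "adj1 b v" "adj1 u b" "adj1 v b"
      using uv M.adj_sym by (auto simp: P_def M.nbrs_def)
    have guv: "g u \<noteq> g v" "g u \<in> A" "g v \<in> A" "side2 (g u) = side2 (g v)"
      using uv uv' g'(1) g'(3) A M.adj_side[of b u] M.adj_side[of b v] by (auto simp: inj_on_eq_iff)
    then obtain b' where b': "adj2 (g u) b'" "adj2 (g v) b'"
      using N.join_obtain[of "g u" "g v"] A by blast
    have b'V: "b' \<in> V2" using b' N.adj_V2 by blast
    have uniq: "w = b" if "adj1 u w" "adj1 v w" for w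
      using M.join_unique[OF uv(2) that uv'(5,6)] .
    have not_img: "b' \<notin> g ` (D \<union> Y)"
    proof
      assume "b' \<in> g ` (D \<union> Y)"
      then obtain w where w: "w \<in> D \<union> Y" "b' = g w" by blast
      then have "w = b" using b' g'(4) uv' by (intro uniq) auto
      then show False using w bD Y by blast
    qed
    \<comment> \<open>A preimage of \<open>b'\<close> in \<open>E2\<close> would be a common
      neighbour of \<open>u\<close> and \<open>v\<close>, hence \<open>b\<close> itself, which lies
      outside \<open>E2\<close>.\<close>
    have not_F2: "b' \<notin> F2" if "u \<in> D" "v \<in> D"
    proof
      assume "b' \<in> F2"
      then obtain w where w: "w \<in> E2" "b' = f w" using f(2) by blast
      then have "adj1 u w" "adj1 v w" using b' f(4) that sub g(2) by auto
      then show False using uniq w bD by blast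
    qed
    have not_F: "b' \<notin> f ` E"
    proof
      assume "b' \<in> f ` E"
      then obtain w where w: "w \<in> E" "b' = f w" by blast
      then have "w \<notin> D" using not_img g(2) by force
      then have "u \<in> D" "v \<in> D" using g(4)[of _ w] w b' uv' by auto
      then show False using not_F2 w f(2) sub by blast
    qed
    then have b'A: "b' \<notin> A" using not_img by (auto simp: A_def)
    \<comment> \<open>A small tight set through \<open>b'\<close> touches the images of
      \<open>u\<close> and \<open>v\<close>, so by genericity neither comes from \<open>Y\<close>
      and both lie in \<open>D\<close>. The set then falls into the hull of the image of
      \<open>E\<close>, thus into \<open>F2\<close>, where \<open>b'\<close> is not. A third
      neighbour in \<open>A\<close>, or a neighbour in a small tight set over
      \<open>insert b' A\<close>, would create exactly such a set.\<close>
    have key: False if C: "N.tight A C" "card C \<le> Suc n" "b' \<in> C" for C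
    proof -
      have "u \<in> D" "v \<in> D" using g(5)[OF C(1)[unfolded A_def] C(2,3)] b' uv' by auto
      moreover have "C \<subseteq> N.hull K (f ` E)"
        by (rule N.tight_subset_hull[OF tightF[OF C(1,2)]]) (use C Suc.prems Y in simp)
      ultimately show False using not_F2 hull C by blast
    qed
    have only: "a \<in> g ` P" if a: "a \<in> A" "adj2 a b'" for a
    proof (rule ccontr)
      assume "a \<notin> g ` P"
      then have "card {g u, g v, a} = 3" using uv guv by auto
      moreover have "{g u, g v, a} \<subseteq> N.nbrs b' (A \<union> {b'})"
        using b' a guv N.adj_sym[of _ b'] by (auto simp: N.nbrs_def)
      then have "card {g u, g v, a} \<le> card (N.nbrs b' (A \<union> {b'}))"
        using A(1) by (intro card_mono N.finite_nbrs) auto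
      ultimately have "N.tight A {b'}" using b'A b'V by (auto simp: N.tight_def)
      then show False using key[of "{b'}"] by simp
    qed
    have gen: "\<not> adj2 b' d" if C: "N.tight (insert b' A) C" "card C \<le> n" and "d \<in> C" for C d
    proof
      assume "adj2 b' d"
      have fin: "finite C" "C \<subseteq> V2" "C \<inter> A = {}" "b' \<notin> C" using C by (auto simp: N.tight_def)
      have finT: "finite (A \<union> insert b' C)" using fin A by simp
      have "N.tight A (insert b' C)"
        unfolding N.tight_def
      proof (intro conjI ballI)
        fix c assume c: "c \<in> insert b' C"
        show "3 \<le> card (N.nbrs c (A \<union> insert b' C))"
        proof (cases "c = b'")
          case True
          have "d \<noteq> g u" "d \<noteq> g v" using fin(3) \<open>d \<in> C\<close> guv(2,3) by blast+
          then have "card {g u, g v, d} = 3" using guv(1) by auto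
          moreover have "{g u, g v, d} \<subseteq> N.nbrs b' (A \<union> insert b' C)"
            using b' guv \<open>adj2 b' d\<close> \<open>d \<in> C\<close> N.adj_sym[of _ b'] by (auto simp: N.nbrs_def)
          then have "card {g u, g v, d} \<le> card (N.nbrs b' (A \<union> insert b' C))"
            using finT by (intro card_mono N.finite_nbrs) auto
          ultimately show ?thesis using True by simp
        next
          case False
          show ?thesis by (rule N.tight_nbrs[OF C(1) _ finT]) (use False c in auto)
        qed
      qed (use fin b'A b'V in auto)
      moreover have "card (insert b' C) \<le> Suc n" using C fin by simp
      ultimately show False using key by blast
    qed
    have "side2 b' = side1 b" using N.adj_side[OF b'(1)] sideP[of "g u"] uv by auto
    moreover have "adj2 a b'" if "a \<in> g ` P" for a using that uv b' by auto
    ultimately show ?thesis using b'V b'A only gen by blast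
  qed
  then obtain b' where b'V: "b' \<in> V2" and b'g: "side2 b' = side1 b \<and> b' \<notin> A \<and>
    (\<forall>a\<in>A. adj2 a b' \<longleftrightarrow> a \<in> g ` P) \<and>
    (\<forall>C. N.tight (insert b' A) C \<longrightarrow> card C \<le> n \<longrightarrow> (\<forall>d\<in>C. \<not> adj2 b' d))" ..
  note b' = b'V b'g[THEN conjunct1] b'g[THEN conjunct2, THEN conjunct1]
    b'g[THEN conjunct2, THEN conjunct2, THEN conjunct1, rule_format]
    b'g[THEN conjunct2, THEN conjunct2, THEN conjunct2, rule_format]
  define h where "h = g(b := b')"
  have h: "h b = b'" "\<And>x. x \<in> D \<union> Y \<Longrightarrow> h x = g x" using bD Y by (auto simp: h_def)
  have himg: "h ` (D \<union> Y) = g ` (D \<union> Y)" "h ` Y = g ` Y"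
    using h(2) by (auto intro!: image_cong)
  have adjb: "adj2 (g x) b' \<longleftrightarrow> adj1 x b" "adj2 b' (g x) \<longleftrightarrow> adj1 b x" if x: "x \<in> D \<union> Y" for x
  proof -
    have "g x \<in> A" using x A by blast
    then have "adj2 (g x) b' \<longleftrightarrow> g x \<in> g ` P" by (rule b'(4))
    also have "\<dots> \<longleftrightarrow> x \<in> P" using inj_on_image_mem_iff[OF g'(1) x Psub] .
    also have "\<dots> \<longleftrightarrow> adj1 b x" using x by (auto simp: P_def M.nbrs_def)
    finally have *: "adj2 (g x) b' \<longleftrightarrow> adj1 b x" .
    show "adj2 (g x) b' \<longleftrightarrow> adj1 x b" "adj2 b' (g x) \<longleftrightarrow> adj1 b x"
      using * M.adj_sym N.adj_sym by blast+
  qed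
  have "\<not> adj1 b b" "\<not> adj2 b' b'" using M.adj_side N.adj_side by blast+
  have Xeq: "D \<union> X = insert b (D \<union> Y)" using Y by auto
  have "iso h (D \<union> X) (h ` (D \<union> X))"
    unfolding iso_def
  proof (intro conjI ballI)
    have "inj_on h (D \<union> Y)" using inj_on_cong[of "D \<union> Y" h g, OF h(2)] g'(1) by (rule iffD2)
    moreover have "h b \<notin> h ` (D \<union> Y)" unfolding himg h(1) using b'(3) A(4) by blast
    moreover have "D \<union> Y - {b} = D \<union> Y" using bD(1) Y(2) by blast
    ultimately have "inj_on h (D \<union> X)" unfolding Xeq inj_on_insert by simp
    then show "bij_betw h (D \<union> X) (h ` (D \<union> X))" by (rule inj_on_imp_bij_betw)
    show "side2 (h x) = side1 x" if "x \<in> D \<union> X" for x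
    proof (cases "x = b")
      case True
      then show ?thesis using b'(2) h(1) by simp
    next
      case False
      then have "x \<in> D \<union> Y" using that unfolding Xeq by blast
      then show ?thesis using g'(3) h(2) by simp
    qed
    show "adj2 (h x) (h y) \<longleftrightarrow> adj1 x y" if xy: "x \<in> D \<union> X" "y \<in> D \<union> X" for x y
    proof -
      consider "x = b" "y = b" | "x = b" "y \<in> D \<union> Y" | "x \<in> D \<union> Y" "y = b"
        | "x \<in> D \<union> Y" "y \<in> D \<union> Y"
        using xy unfolding Xeq by blast
      then show ?thesis
      proof cases
        case 1
        then show ?thesis using h(1) \<open>\<not> adj1 b b\<close> \<open>\<not> adj2 b' b'\<close> by simp
      next
        case 2
        then show ?thesis using h(1) h(2)[of y] adjb(2)[of y] by simp
      next
        case 3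
        then show ?thesis using h(1) h(2)[of x] adjb(1)[of x] by simp
      next
        case 4
        then show ?thesis using h(2)[of x] h(2)[of y] g'(4)[of x y] by simp
      qed
    qed
  qed
  moreover have "\<forall>x\<in>D. h x = f x" using h(2) g(2) by simp
  moreover
  have hX: "h ` X = insert b' (g ` Y)" using Y(1) h(1) himg by simp
  have "h ` X \<subseteq> V2 - f ` E" unfolding hX using g(3) b'(1,3) A(3) by blast
  moreover have "\<forall>x\<in>X. \<forall>y\<in>E - D. \<not> adj2 (h x) (f y)"
  proof (intro ballI)
    fix x y assume x: "x \<in> X" and y: "y \<in> E - D"
    show "\<not> adj2 (h x) (f y)"
    proof (cases "x = b")
      case True
      have "f y \<notin> g ` P"
      proof
        assume "f y \<in> g ` P"
        then obtain u where u: "u \<in> D \<union> Y" "f y = g u" using Psub by blast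
        have "u \<in> D" using u y g(3) by blast
        then have "f y = f u" using u g(2) by simp
        moreover have "y \<in> E2" "u \<in> E2" using y \<open>u \<in> D\<close> sub by auto
        ultimately have "y = u" using f(1) by (simp add: inj_on_eq_iff)
        then show False using y \<open>u \<in> D\<close> by blast
      qed
      then have "\<not> adj2 (f y) b'" using b'(4)[of "f y"] y A(3) by blast
      then show ?thesis using True h(1) N.adj_sym by metis
    next
      case False
      then have "x \<in> Y" using x Y(1) by blast
      then show ?thesis using g(4)[of x y] h(2)[of x] y by simp
    qed
  qed
  moreover have "\<forall>C. N.tight (f ` E \<union> h ` X) C \<longrightarrow> card C \<le> n \<longrightarrow> (\<forall>c\<in>C. \<forall>x\<in>X. \<not> adj2 (h x) c)"
  proof (intro allI impI ballI)
    fix C c x assume C: "N.tight (f ` E \<union> h ` X) C" "card C \<le> n" and c: "c \<in> C" and x: "x \<in> X"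
    have "f ` E \<union> h ` X = insert b' A" using hX by (auto simp: A_def)
    then have tC: "N.tight (insert b' A) C" using C by simp
    have nb: "\<not> adj2 b' d" "\<not> adj2 d b'" if "d \<in> C" for d
      using b'(5)[OF tC C(2) that] N.adj_sym by blast+
    have "N.tight A C"
      by (rule N.tight_shrink[OF tC]) (use A(1) nb(2) in auto)
    then have "\<not> adj2 (g y) c" if "y \<in> Y" for y
      using g(5)[of C c y] C(2) c that by (simp add: A_def)
    then show "\<not> adj2 (h x) c" using x nb(1)[OF c] h(1) h(2)[of x] Y(1) by auto
  qed
  ultimately show ?case unfolding generic_extension_def by blast
qed

end

section \<open>Levels and gaps\<close>

lemma ex_gap:
  fixes S :: "nat \<Rightarrow> 'a set"
  assumes "finite B" "card B \<le> s" "\<And>t. S t \<subseteq> S (Suc t)"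
  shows "\<exists>t\<le>s. B \<inter> S (Suc t) \<subseteq> S t"
proof (rule ccontr)
  assume no: "\<not> ?thesis"
  \<comment> \<open>Without a gap, every step captures a new element of \<open>B\<close>, so
    \<open>Suc s\<close> steps capture more than \<open>B\<close> has.\<close>
  have "t \<le> card (B \<inter> S t)" if "t \<le> Suc s" for t
    using that
  proof (induction t)
    case (Suc t)
    then have "\<not> B \<inter> S (Suc t) \<subseteq> S t" using no by auto
    then have "B \<inter> S t \<subset> B \<inter> S (Suc t)" using assms(3)[of t] by blast
    then have "card (B \<inter> S t) < card (B \<inter> S (Suc t))"
      using assms(1) by (intro psubset_card_mono) auto
    then show ?case using Suc by simp
  qed simp
  from this[of "Suc s"] have "Suc s \<le> card (B \<inter> S (Suc s))" by simp
  also have "\<dots> \<le> card B" using assms(1) by (intro card_mono) auto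
  finally show False using assms(2) by simp
qed

text \<open>The increment is dictated by \<open>hull_hull\<close>: a hull of depth at most
  \<open>K\<close> over one level stays inside the next.\<close>

definition level :: "nat \<Rightarrow> nat \<Rightarrow> nat \<Rightarrow> nat" where
  "level k K i = ((\<lambda>m. m + K + hull_bound k m) ^^ i) 0"

lemma level_Suc: "level k K (Suc i) = level k K i + K + hull_bound k (level k K i)"
  by (simp add: level_def)

lemma level_mono: "i \<le> j \<Longrightarrow> level k K i \<le> level k K j"
  by (rule lift_Suc_mono_le) (simp_all add: level_Suc)

text \<open>
  The hull answering a move has at most \<open>s\<close> elements, so one of \<open>Suc s\<close> gaps contains none of
  them. A gap spans two levels: the hull in its middle absorbs the small sets that are tight over the
  lower hull, and the upper hull those that are tight over the middle one.
\<close>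

fun depth :: "nat \<Rightarrow> nat \<Rightarrow> nat" where
  "depth 0 k = 0"
| "depth (Suc r) k = (let n = depth r (Suc k); s = hull_bound (Suc k) n
     in level k (n + s) (2 * Suc s))"

section \<open>Answering a move\<close>

context open_plane_graph
begin

lemma hull_hull_level:
  assumes "finite A" "A \<subseteq> V" "card A \<le> k" "n \<le> K"
  shows "hull n (hull (level k K i) A) \<subseteq> hull (level k K (Suc i)) A"
proof -
  have "hull n (hull (level k K i) A) \<subseteq> hull (n + hull_bound k (level k K i)) A"
    by (rule hull_hull[OF assms(1-3)])
  also have "\<dots> \<subseteq> hull (level k K (Suc i)) A"
    by (rule hull_mono) (use assms(4) in \<open>simp add: level_Suc\<close>)
  finally show ?thesis .
qed

end

context open_plane_graph_pair
begin

text \<open>One inclusion transports tight sets along \<open>g\<close>. For the other, let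
  \<open>C\<close> be small and tight over the image of \<open>insert a A\<close>. Its part outside
  the images of \<open>D\<close> and \<open>X\<close> has no edge to the image of \<open>X\<close>,
  so it is tight over the image of \<open>D\<close> and falls into the image of \<open>E\<close>.
  Now \<open>C\<close> can be pulled back to a tight set over \<open>insert a A\<close>.\<close>

lemma generic_extension_hull:
  assumes f: "iso f E2 F2" "E2 \<subseteq> V1" "F2 \<subseteq> V2" and sub: "A \<subseteq> D" "D \<subseteq> E" "E \<subseteq> E2"
    and fin: "finite A" "finite E" "finite X" and XV: "X \<subseteq> V1" "X \<inter> E2 = {}"
    and g: "generic_extension f D E n X g"
    and hull: "N.hull n (f ` D) \<subseteq> f ` E"
    and a: "a \<in> D \<union> X" and B: "M.hull n (insert a A) \<subseteq> D \<union> X" "X \<subseteq> M.hull n (insert a A)"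
  shows "g ` M.hull n (insert a A) = N.hull n (g ` insert a A)"
proof
  interpret sw: open_plane_graph_pair V2 adj2 side2 V1 adj1 side1 by (rule swap)
  note f' = isoD[OF f(1)] and g' = generic_extensionD[OF g]
  note gi = isoD[OF g'(1)]
  let ?B = "M.hull n (insert a A)" and ?W = "f ` E \<union> g ` X"
  have gD: "g ` D = f ` D" using g'(2) by (rule image_cong[OF refl])
  have AE: "insert a A \<subseteq> D \<union> X" using sub a by auto
  have "f ` E \<subseteq> V2" using sub f(3) f'(2) by blast
  then have gV: "g ` (D \<union> X) \<subseteq> V2" using gD g'(3) sub(2) by blast
  have gedge: "adj2 (g x) (g y)" if "x \<in> D \<union> X" "y \<in> D \<union> X" "adj1 x y" for x y
    using gi(4)[OF that(1,2)] that(3) by blast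
  show "g ` ?B \<subseteq> N.hull n (g ` insert a A)"
  proof
    fix y assume "y \<in> g ` ?B"
    then obtain x where x: "x \<in> ?B" "y = g x" by blast
    show "y \<in> N.hull n (g ` insert a A)"
    proof (cases "x \<in> insert a A")
      case True
      then have "y \<in> g ` insert a A" using x(2) by (rule rev_image_eqI)
      then show ?thesis using N.hull_subset[of "g ` insert a A" n] by (rule rev_subsetD)
    next
      case False
      then obtain C where C: "M.tight (insert a A) C" "card C \<le> n" "x \<in> C"
        using x(1) unfolding M.hull_def by blast
      have CB: "insert a A \<union> C \<subseteq> D \<union> X"
        using M.tight_subset_hull[OF C(1,2)] B(1) AE by blast
      have "g ` C \<subseteq> V2" using CB gV by blast
      have edge: "adj2 (g x) (g y)" if "x \<in> insert a A \<union> C" "y \<in> insert a A \<union> C" "adj1 x y" for x y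
        using gedge[of x y] that CB by blast
      have "finite (insert a A)" using fin by simp
      note ti = tight_image[OF inj_on_subset[OF gi(1) CB] \<open>g ` C \<subseteq> V2\<close> this C(1) edge]
      have "g ` C \<subseteq> N.hull n (g ` insert a A)"
        by (rule N.tight_subset_hull[OF ti(1)]) (use ti(2) C(2) in auto)
      then show ?thesis using C(3) x(2) by blast
    qed
  qed
  \<comment> \<open>\<open>p\<close> inverts \<open>f\<close> on the image of \<open>E\<close> and
    \<open>g\<close> on the image of \<open>X\<close>. It may create edges, since \<open>X\<close>
    and \<open>E - D\<close> can be adjacent while their images are not.\<close>
  define p where "p w = (if w \<in> f ` E then inv_into E f w else inv_into X g w)" for w
  have injE: "inj_on f E" by (rule inj_on_subset[OF f'(1) sub(3)])
  have injX: "inj_on g X" by (rule inj_on_subset[OF gi(1)]) auto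
  have pf: "p (f x) = x" if "x \<in> E" for x using that injE by (simp add: p_def)
  have gX_notin: "g x \<notin> f ` E" if "x \<in> X" for x using that g'(3) by blast
  have pg: "p (g x) = x" if "x \<in> D \<union> X" for x
  proof (cases "x \<in> D")
    case True
    then show ?thesis using pf[of x] g'(2) sub by auto
  next
    case False
    then show ?thesis using that gX_notin[of x] injX by (simp add: p_def)
  qed
  have XE: "X \<inter> E = {}" using XV sub by blast
  have p_inj: "inj_on p ?W"
  proof (rule inj_on_inverseI[where g = "\<lambda>x. if x \<in> E then f x else g x"])
    fix w assume "w \<in> ?W"
    then consider e where "e \<in> E" "w = f e" | x where "x \<in> X" "w = g x" by blast
    then show "(if p w \<in> E then f (p w) else g (p w)) = w"
    proof cases
      case (1 e)
      then show ?thesis using pf by simp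
    next
      case (2 x)
      then have "p w = x" "x \<notin> E" using pg[of x] XE by auto
      then show ?thesis using 2 by simp
    qed
  qed
  have p_edge: "adj1 (p v) (p w)" if vw: "v \<in> ?W" "w \<in> ?W" and adj: "adj2 v w" for v w
  proof -
    have mixed: "adj1 e x" if "e \<in> E" "x \<in> X" "adj2 (g x) (f e)" for e x
    proof -
      have "e \<in> D" using g'(4)[OF that(2)] that by blast
      then have "adj2 (g x) (g e)" using that(3) g'(2) by simp
      then have "adj1 x e" using gi(4)[of x e] that(2) \<open>e \<in> D\<close> by blast
      then show ?thesis by (rule M.adj_sym)
    qed
    consider e e' where "e \<in> E" "e' \<in> E" "v = f e" "w = f e'"
      | e x where "e \<in> E" "x \<in> X" "v = f e" "w = g x"
      | e x where "e \<in> E" "x \<in> X" "v = g x" "w = f e"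
      | x x' where "x \<in> X" "x' \<in> X" "v = g x" "w = g x'"
      using vw by blast
    then show ?thesis
    proof cases
      case (1 e e')
      then show ?thesis using f'(4)[of e e'] sub(3) adj pf by auto
    next
      case (2 e x)
      then show ?thesis using mixed[of e x] N.adj_sym[OF adj] pf pg by auto
    next
      case (3 e x)
      then show ?thesis using M.adj_sym[OF mixed[of e x]] adj pf pg by auto
    next
      case (4 x x')
      then show ?thesis using gi(4)[of x x'] adj pg by auto
    qed
  qed
  show "N.hull n (g ` insert a A) \<subseteq> g ` ?B"
  proof
    fix y assume y: "y \<in> N.hull n (g ` insert a A)"
    show "y \<in> g ` ?B"
    proof (cases "y \<in> g ` insert a A")
      case True
      then show ?thesis using image_mono[OF M.hull_subset[of "insert a A" n], of g] by (rule rev_subsetD)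
    next
      case False
      then obtain C where C: "N.tight (g ` insert a A) C" "card C \<le> n" "y \<in> C"
        using y unfolding N.hull_def by blast
      have finC: "finite C" "C \<subseteq> V2" using C(1) by (auto simp: N.tight_def)
      have AW: "g ` insert a A \<subseteq> f ` D \<union> g ` X" using AE gD by blast
      have DW: "f ` D \<union> g ` X \<subseteq> ?W" using sub by blast
      have finW: "finite ?W" using fin by simp
      have no_edge: "\<not> adj2 (g x) c" if "c \<in> C - (f ` D \<union> g ` X)" "x \<in> X" for c x
      proof (cases "c \<in> f ` E")
        case True
        then obtain e where e: "c = f e" "e \<in> E" by (rule imageE)
        then have "e \<in> E - D" using that(1) by auto
        then show ?thesis unfolding e(1) by (rule g'(4)[OF that(2)])
      next
        case False
        have t: "N.tight ?W (C - ?W)"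
          by (rule N.tight_extend[OF C(1) finW order_trans[OF AW DW]])
        have "card (C - ?W) \<le> n" using card_mono[of C "C - ?W"] finC C(2) by auto
        moreover have "c \<in> C - ?W" using that(1) False by blast
        ultimately show ?thesis using g'(5)[OF t] that(2) by blast
      qed
      have t: "N.tight (f ` D) (C - (f ` D \<union> g ` X))"
      proof (rule N.tight_shrink)
        show "N.tight (f ` D \<union> g ` X) (C - (f ` D \<union> g ` X))"
          by (rule N.tight_extend[OF C(1) _ AW]) (rule finite_subset[OF DW finW])
        show "finite (f ` D \<union> g ` X)" by (rule finite_subset[OF DW finW])
        show "b \<in> f ` D" if "c \<in> C - (f ` D \<union> g ` X)" "b \<in> f ` D \<union> g ` X" "adj2 c b" for c b
          using that(2) no_edge[OF that(1)] N.adj_sym[OF that(3)] by blast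
      qed simp
      have "card (C - (f ` D \<union> g ` X)) \<le> n"
        using card_mono[of C "C - (f ` D \<union> g ` X)"] finC C(2) by auto
      from N.tight_subset_hull[OF t this] have "C \<subseteq> ?W" using hull DW by blast
      have W: "g ` insert a A \<union> C \<subseteq> ?W" using AW DW \<open>C \<subseteq> ?W\<close> by blast
      have "p ` f ` E = E" "p ` g ` X = X" using pf pg by (force simp: image_image)+
      then have "p ` ?W = E \<union> X" by (simp only: image_Un)
      then have "p ` C \<subseteq> E \<union> X" using image_mono[OF \<open>C \<subseteq> ?W\<close>, of p] by simp
      then have pV: "p ` C \<subseteq> V1" using sub(3) f(2) XV(1) by blast
      have pA: "p ` g ` insert a A = insert a A"
      proof -
        have "p ` g ` insert a A = (\<lambda>x. x) ` insert a A"
          unfolding image_image using pg AE by (intro image_cong) auto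
        then show ?thesis by simp
      qed
      have edge: "adj1 (p v) (p w)"
        if "v \<in> g ` insert a A \<union> C" "w \<in> g ` insert a A \<union> C" "adj2 v w" for v w
        using p_edge[of v w] that W by blast
      have "finite (g ` insert a A)" using fin by simp
      note ti = sw.tight_image[OF inj_on_subset[OF p_inj W] pV this C(1) edge]
      have "p ` C \<subseteq> ?B"
        by (rule M.tight_subset_hull[OF ti(1)[unfolded pA]]) (use ti(2) C(2) in auto)
      then have py: "p y \<in> ?B" using C(3) by blast
      have "y \<in> ?W" using C(3) \<open>C \<subseteq> ?W\<close> by blast
      then show ?thesis
      proof
        assume "y \<in> f ` E"
        then obtain e where e: "e \<in> E" "y = f e" by blast
        then have "e \<in> ?B" using py pf by simp
        then have "e \<in> D" using B(1) XE e(1) by blast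
        then have "y = g e" using e g'(2) by simp
        then show ?thesis using \<open>e \<in> ?B\<close> by blast
      next
        assume "y \<in> g ` X"
        then show ?thesis using B(2) by blast
      qed
    qed
  qed
qed

text \<open>The invariant of the game: \<open>r\<close> rounds remain, \<open>k\<close> bounds the
  number of chosen vertices, and only the values of \<open>f\<close> on the hull matter.\<close>

definition position :: "nat \<Rightarrow> nat \<Rightarrow> ('v \<Rightarrow> 'w) \<Rightarrow> 'v set \<Rightarrow> bool" where
  "position r k f A \<longleftrightarrow> finite A \<and> A \<subseteq> V1 \<and> card A \<le> k \<and> f ` A \<subseteq> V2 \<and>
     iso f (M.hull (depth r k) A) (N.hull (depth r k) (f ` A))"

lemma position_forth:
  assumes pos: "position (Suc r) k f A" and a: "a \<in> V1"
  shows "\<exists>g. position r (Suc k) g (insert a A) \<and> (\<forall>x\<in>A. g x = f x)"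
proof -
  define n where "n = depth r (Suc k)"
  define s where "s = hull_bound (Suc k) n"
  \<comment> \<open>\<open>n\<close> is the genericity wanted at the end, and \<open>s\<close> pays
    one unit for each vertex of \<open>X\<close>.\<close>
  define K where "K = n + s"
  let ?l = "level k K"
  have depth: "depth (Suc r) k = ?l (2 * Suc s)"
    by (simp add: n_def s_def K_def Let_def)
  have A: "finite A" "A \<subseteq> V1" "card A \<le> k" "f ` A \<subseteq> V2"
    and f: "iso f (M.hull (?l (2 * Suc s)) A) (N.hull (?l (2 * Suc s)) (f ` A))"
    using pos unfolding position_def depth by blast+
  define B where "B = M.hull n (insert a A)"
  have aA: "finite (insert a A)" "insert a A \<subseteq> V1" "card (insert a A) \<le> Suc k"
    using A a by (auto simp: card_insert_if)
  have B: "finite B" "B \<subseteq> V1" "card B \<le> s" "insert a A \<subseteq> B"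
    using M.finite_hull[OF aA(1,2)] M.hull_V[OF aA(2)] M.card_hull[OF aA(1,2), of n] M.hull_subset
      hull_bound_mono[OF aA(3), of n]
    by (auto simp: B_def s_def)
  have mono: "M.hull (?l i) A \<subseteq> M.hull (?l j) A" if "i \<le> j" for i j
    by (rule M.hull_mono[OF level_mono[OF that]])
  \<comment> \<open>Only even levels are compared, so that a whole intermediate level,
    \<open>E\<close>, lies inside the gap.\<close>
  obtain t where t: "t \<le> s" "B \<inter> M.hull (?l (2 * Suc t)) A \<subseteq> M.hull (?l (2 * t)) A"
    using ex_gap[OF B(1,3), of "\<lambda>t. M.hull (?l (2 * t)) A"] mono by auto
  define D E E2 where "D = M.hull (?l (2 * t)) A" and "E = M.hull (?l (Suc (2 * t))) A"
    and "E2 = M.hull (?l (Suc (Suc (2 * t)))) A"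
  have sub: "A \<subseteq> D" "D \<subseteq> E" "E \<subseteq> E2" "E2 \<subseteq> M.hull (?l (2 * Suc s)) A"
    using mono[of "2 * t" "Suc (2 * t)"] mono[of "Suc (2 * t)" "Suc (Suc (2 * t))"]
      mono[of "Suc (Suc (2 * t))" "2 * Suc s"] t(1) M.hull_subset
    by (auto simp: D_def E_def E2_def)
  have E2V: "E2 \<subseteq> V1" unfolding E2_def by (rule M.hull_V[OF A(2)])
  have finE: "finite E" unfolding E_def by (rule M.finite_hull[OF A(1,2)])
  have img: "f ` M.hull (?l i) A = N.hull (?l i) (f ` A)" if "i \<le> 2 * Suc s" for i
    by (rule iso_hull[OF f A(4,2,1) level_mono[OF that]])
  define F2 where "F2 = f ` E2"
  have fE2: "iso f E2 F2"
  proof -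
    have "inj_on f E2" by (rule inj_on_subset[OF isoD(1)[OF f] sub(4)])
    moreover have "x \<in> M.hull (?l (2 * Suc s)) A" if "x \<in> E2" for x using that sub(4) by blast
    ultimately show ?thesis
      using isoD(3,4)[OF f] by (auto simp: iso_def F2_def bij_betw_def)
  qed
  have imgs: "f ` D = N.hull (?l (2 * t)) (f ` A)" "f ` E = N.hull (?l (Suc (2 * t))) (f ` A)"
    "F2 = N.hull (?l (Suc (Suc (2 * t)))) (f ` A)"
    using img[of "2 * t"] img[of "Suc (2 * t)"] img[of "Suc (Suc (2 * t))"] t(1)
    by (auto simp: D_def E_def E2_def F2_def)
  have F2V: "F2 \<subseteq> V2" unfolding imgs(3) by (rule N.hull_V[OF A(4)])
  have fA: "finite (f ` A)" "card (f ` A) \<le> k"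
    using A card_image_le[of A f] by auto
  have hullE: "N.hull K (f ` E) \<subseteq> F2"
    unfolding imgs by (rule N.hull_hull_level[OF fA(1) A(4) fA(2)]) simp
  have hullD: "N.hull n (f ` D) \<subseteq> f ` E"
    unfolding imgs by (rule N.hull_hull_level[OF fA(1) A(4) fA(2)]) (simp add: K_def)
  define X where "X = B - D"
  have X: "finite X" "X \<subseteq> V1" "X \<inter> E2 = {}" "card X \<le> s"
  proof -
    show "finite X" "X \<subseteq> V1" using B by (auto simp: X_def)
    show "X \<inter> E2 = {}" using t(2) by (auto simp: X_def E2_def D_def)
    show "card X \<le> s" using card_mono[of B X] B by (simp add: X_def)
  qed
  \<comment> \<open>Such a \<open>C\<close> is small enough to be absorbed by \<open>E\<close>,
    while \<open>X\<close> lies beyond \<open>E2\<close>.\<close>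
  have opn: "C = {}" if C: "C \<subseteq> X" "M.tight D C" for C
  proof -
    have "card C \<le> s" using card_mono[OF X(1) C(1)] X(4) by simp
    then have "C \<subseteq> M.hull s D" by (rule M.tight_subset_hull[OF C(2)])
    also have "\<dots> \<subseteq> E"
      unfolding D_def E_def by (rule M.hull_hull_level[OF A(1-3)]) (simp add: K_def)
    finally show ?thesis using C(1) X(3) sub(3) by blast
  qed
  have "n + card X \<le> K" using X(4) by (simp add: K_def)
  from generic_embedding[OF fE2 sub(2,3) E2V F2V finE hullE X(1-3) this opn]
  obtain g where g: "generic_extension f D E n X g" by blast
  note g' = generic_extensionD[OF g] note gi = isoD[OF g'(1)]
  have BDX: "B \<subseteq> D \<union> X" by (auto simp: X_def)
  have "g ` B = N.hull n (g ` insert a A)"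
    unfolding B_def
    by (rule generic_extension_hull[OF fE2 E2V F2V sub(1-3) A(1) finE X(1-3) g hullD])
      (use BDX B in \<open>auto simp: B_def X_def\<close>)
  then have "bij_betw g B (N.hull n (g ` insert a A))"
    using inj_on_subset[OF gi(1) BDX] by (simp add: bij_betw_def)
  then have "iso g B (N.hull n (g ` insert a A))"
    unfolding iso_def using gi(3,4) BDX by blast
  moreover have "g ` insert a A \<subseteq> V2"
  proof -
    have "f ` D \<subseteq> V2" using F2V sub(2,3) unfolding F2_def by blast
    then have "g ` D \<subseteq> V2" using g'(2) by auto
    then show ?thesis using B(4) BDX g'(3) by blast
  qed
  ultimately have "position r (Suc k) g (insert a A)"
    using aA by (simp add: position_def B_def n_def)
  then show ?thesis using g'(2) sub(1) by blast
qed

lemma position_inverse: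
  assumes "position r k f A"
  shows "open_plane_graph_pair.position V2 adj2 side2 V1 adj1 side1 r k
    (inv_into (M.hull (depth r k) A) f) (f ` A)"
    "\<And>x. x \<in> A \<Longrightarrow> inv_into (M.hull (depth r k) A) f (f x) = x"
proof -
  interpret sw: open_plane_graph_pair V2 adj2 side2 V1 adj1 side1 by (rule swap)
  let ?H = "M.hull (depth r k) A"
  have A: "finite A" "A \<subseteq> V1" "card A \<le> k" "f ` A \<subseteq> V2" and f: "iso f ?H (N.hull (depth r k) (f ` A))"
    using assms unfolding position_def by blast+
  show inv: "inv_into ?H f (f x) = x" if "x \<in> A" for x
    using that M.hull_subset isoD(1)[OF f] by (intro inv_into_f_f) auto
  then have img: "inv_into ?H f ` f ` A = A" by (force simp: image_image)
  show "sw.position r k (inv_into ?H f) (f ` A)"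
    unfolding sw.position_def img
    using A card_image_le[OF A(1), of f] iso_inverse[OF f subset_refl] isoD(2)[OF f] by auto
qed

text \<open>The forth step in the other direction: invert the position, answer there, and invert the
  result.\<close>

lemma position_back:
  assumes pos: "position (Suc r) k f A" and b: "b \<in> V2"
  shows "\<exists>a g. a \<in> V1 \<and> g a = b \<and> position r (Suc k) g (insert a A) \<and> (\<forall>x\<in>A. g x = f x)"
proof -
  interpret sw: open_plane_graph_pair V2 adj2 side2 V1 adj1 side1 by (rule swap)
  note inv = position_inverse[OF pos]
  obtain h where h: "sw.position r (Suc k) h (insert b (f ` A))"
    "\<And>x. x \<in> A \<Longrightarrow> h (f x) = x"
    using sw.position_forth[OF inv(1) b] inv(2) by fastforce
  note inv' = sw.position_inverse[OF h(1)]
  let ?g = "inv_into (N.hull (depth r (Suc k)) (insert b (f ` A))) h"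
  have "h ` insert b (f ` A) = insert (h b) A" using h(2) by (force simp: image_image)
  then have "position r (Suc k) ?g (insert (h b) A)" using inv'(1) by simp
  moreover have "?g (h b) = b" using inv'(2) by simp
  moreover have "?g x = f x" if "x \<in> A" for x using inv'(2)[of "f x"] h(2) that by simp
  moreover have "h b \<in> V1" using h(1) by (auto simp: sw.position_def)
  ultimately show ?thesis by blast
qed

text \<open>By openness the hull of the empty set is empty in both planes, so any map starts the
  game, whatever the depth.\<close>

lemma position_empty: "position r k f {}"
proof -
  have "M.hull n {} = {}" "N.hull n {} = {}" for n
    by (simp_all add: M.hull_def N.hull_def M.tight_empty_iff N.tight_empty_iff)
  then show ?thesis by (simp add: position_def iso_def bij_betw_def)
qed

end


section \<open>Elementary equivalence\<close>

definition vertices :: "('p, 'l) incidence_structure \<Rightarrow> ('p + 'l) set" where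
  "vertices M = points M <+> lines M"

fun incident :: "('p, 'l) incidence_structure \<Rightarrow> 'p + 'l \<Rightarrow> 'p + 'l \<Rightarrow> bool" where
  "incident M (Inl p) (Inr l) \<longleftrightarrow> (p, l) \<in> incid M"
| "incident M (Inr l) (Inl p) \<longleftrightarrow> (p, l) \<in> incid M"
| "incident M _ _ \<longleftrightarrow> False"

lemma incident_iff:
  "incident M x y \<longleftrightarrow>
     (\<exists>p l. (p, l) \<in> incid M \<and> (x = Inl p \<and> y = Inr l \<or> x = Inr l \<and> y = Inl p))"
  by (cases x; cases y) auto

lemma vertices_simps [simp]:
  "Inl p \<in> vertices M \<longleftrightarrow> p \<in> points M" "Inr l \<in> vertices M \<longleftrightarrow> l \<in> lines M"
  by (auto simp: vertices_def)

lemma confined_empty: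
  assumes M: "open_plane M" and C: "finite C" "C \<subseteq> vertices M"
    "\<And>c. c \<in> C \<Longrightarrow> 3 \<le> card {y \<in> C. incident M c y}"
  shows "C = {}"
proof (rule ccontr)
  assume "C \<noteq> {}"
  define A where "A = \<lparr>points = Inl -` C, lines = Inr -` C,
    incid = incid M \<inter> ((Inl -` C) \<times> (Inr -` C))\<rparr>"
  have "subconfiguration A M"
    using C(2) by (auto simp: subconfiguration_def A_def subset_iff dest: vertices_simps[THEN iffD1])
  moreover have "confined A"
    unfolding confined_def
  proof (intro conjI ballI)
    show "finite (points A)" "finite (lines A)"
      using C(1) by (auto simp: A_def intro!: finite_vimageI)
    obtain c where c: "c \<in> C" using \<open>C \<noteq> {}\<close> by blast
    show "points A \<noteq> {} \<or> lines A \<noteq> {}" using c by (cases c) (auto simp: A_def)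
    fix p assume "p \<in> points A"
    then have p: "Inl p \<in> C" by (simp add: A_def)
    have "{y \<in> C. incident M (Inl p) y} = Inr ` {l \<in> lines A. (p, l) \<in> incid A}"
      using p by (auto simp: A_def incident_iff)
    then show "3 \<le> card {l \<in> lines A. (p, l) \<in> incid A}"
      using C(3)[OF p] by (simp add: card_image)
  next
    fix l assume "l \<in> lines A"
    then have l: "Inr l \<in> C" by (simp add: A_def)
    have "{y \<in> C. incident M (Inr l) y} = Inl ` {p \<in> points A. (p, l) \<in> incid A}"
      using l by (auto simp: A_def incident_iff)
    then show "3 \<le> card {p \<in> points A. (p, l) \<in> incid A}"
      using C(3)[OF l] by (simp add: card_image)
  qed
  ultimately show False using M by (auto simp: open_plane_def)
qed

lemma open_plane_graph_of_structure:
  assumes M: "projective_plane M" "nondegenerate M" "open_plane M"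
  shows "open_plane_graph (vertices M) (incident M) isl"
proof -
  have inc: "incid M \<subseteq> points M \<times> lines M"
    using M(1) by (simp add: projective_plane_def partial_plane_def incidence_system_def)
  have join: "\<exists>!l. l \<in> lines M \<and> (p, l) \<in> incid M \<and> (q, l) \<in> incid M"
    if "p \<in> points M" "q \<in> points M" "p \<noteq> q" for p q
    using M(1) that by (simp add: projective_plane_def)
  have meet: "\<exists>!p. p \<in> points M \<and> (p, l) \<in> incid M \<and> (p, k) \<in> incid M"
    if "l \<in> lines M" "k \<in> lines M" "l \<noteq> k" for l k
    using M(1) that by (simp add: projective_plane_def)
  interpret plane_graph "vertices M" "incident M" isl
  proof
    fix x y z w
    show "incident M x y \<Longrightarrow> incident M y x" by (auto simp: incident_iff)
    show "incident M x y \<Longrightarrow> x \<in> vertices M" using inc by (auto simp: incident_iff)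
    show "incident M x y \<Longrightarrow> isl x \<noteq> isl y" by (auto simp: incident_iff)
    show "z = w" if xyz: "x \<noteq> y" "incident M x z" "incident M y z" "incident M x w" "incident M y w"
    proof (cases z)
      case (Inl p)
      then obtain l k q where "x = Inr l" "y = Inr k" "w = Inl q"
        using xyz by (auto simp: incident_iff)
      then show ?thesis using Inl xyz meet[of l k] inc by auto
    next
      case (Inr l)
      then obtain p q k where "x = Inl p" "y = Inl q" "w = Inr k"
        using xyz by (auto simp: incident_iff)
      then show ?thesis using Inr xyz join[of p q] inc by auto
    qed
    show "\<exists>z. incident M x z \<and> incident M y z"
      if xy: "x \<in> vertices M" "y \<in> vertices M" "x \<noteq> y" "isl x = isl y"
    proof (cases x)
      case (Inl p)
      then obtain q where q: "y = Inl q" using xy by (cases y) auto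
      then obtain l where "(p, l) \<in> incid M" "(q, l) \<in> incid M" using join[of p q] xy Inl by auto
      then show ?thesis using Inl q by (intro exI[of _ "Inr l"]) simp
    next
      case (Inr l)
      then obtain k where k: "y = Inr k" using xy by (cases y) auto
      then obtain p where "(p, l) \<in> incid M" "(p, k) \<in> incid M" using meet[of l k] xy Inr by auto
      then show ?thesis using Inr k by (intro exI[of _ "Inl p"]) simp
    qed
  qed
  show ?thesis
  proof
    fix C assume "finite C" "C \<subseteq> vertices M" "\<And>c. c \<in> C \<Longrightarrow> 3 \<le> card {y \<in> C. incident M c y}"
    then show "C = {}" by (rule confined_empty[OF M(3)])
  next
    obtain p q r s where pq: "p \<in> points M" "q \<in> points M" "r \<in> points M" "s \<in> points M"
      "distinct [p, q, r, s]" "\<not> collinear3 M p q r" "\<not> collinear3 M p q s"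
      "\<not> collinear3 M p r s" "\<not> collinear3 M q r s"
      using M(2) unfolding nondegenerate_def by blast
    have "\<not> (incident M (Inl x) m \<and> incident M (Inl y) m \<and> incident M (Inl z) m)"
      if "\<not> collinear3 M x y z" for x y z m
      using that inc by (cases m) (auto simp: collinear3_def)
    then have "quad (Inl p) (Inl q) (Inl r) (Inl s)"
      unfolding quad_def using pq by simp
    then show "\<exists>a b c d. quad a b c d" by blast
  qed
qed

section \<open>Truth of formulas along positions\<close>

fun quantifier_rank :: "fm \<Rightarrow> nat" where
  "quantifier_rank (EqP i j) = 0"
| "quantifier_rank (EqL i j) = 0"
| "quantifier_rank (Inc i j) = 0"
| "quantifier_rank (Neg \<phi>) = quantifier_rank \<phi>"
| "quantifier_rank (Con \<phi> \<psi>) = max (quantifier_rank \<phi>) (quantifier_rank \<psi>)"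
| "quantifier_rank (ExP i \<phi>) = Suc (quantifier_rank \<phi>)"
| "quantifier_rank (ExL i \<phi>) = Suc (quantifier_rank \<phi>)"

context open_plane_graph_pair
begin

lemma positionD:
  assumes "position r k f A" "x \<in> A" "y \<in> A"
  shows "f x \<in> V2" "side2 (f x) = side1 x" "adj2 (f x) (f y) \<longleftrightarrow> adj1 x y" "f x = f y \<longleftrightarrow> x = y"
proof -
  have f: "iso f (M.hull (depth r k) A) (N.hull (depth r k) (f ` A))" "f ` A \<subseteq> V2"
    using assms(1) by (simp_all add: position_def)
  have xy: "x \<in> M.hull (depth r k) A" "y \<in> M.hull (depth r k) A"
    using assms M.hull_subset by blast+
  show "f x \<in> V2" using f(2) assms(2) by blast
  show "side2 (f x) = side1 x" "adj2 (f x) (f y) \<longleftrightarrow> adj1 x y" "f x = f y \<longleftrightarrow> x = y"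
    using isoD[OF f(1)] xy by (auto simp: inj_on_eq_iff)
qed

end

locale open_plane_pair =
  open_plane_graph_pair "vertices M" "incident M" isl "vertices N" "incident N" isl
  for M :: "('p, 'l) incidence_structure" and N :: "('q, 'k) incidence_structure"
begin

text \<open>Restricting the match to free variables lets a sentence start from the empty position,
  where no vertex has been chosen.\<close>

definition matching :: "('p + 'l) set \<Rightarrow> ('p + 'l \<Rightarrow> 'q + 'k) \<Rightarrow> fm \<Rightarrow>
    (nat \<Rightarrow> 'p) \<Rightarrow> (nat \<Rightarrow> 'l) \<Rightarrow> (nat \<Rightarrow> 'q) \<Rightarrow> (nat \<Rightarrow> 'k) \<Rightarrow> bool" where
  "matching A f \<phi> e h e' h' \<longleftrightarrow>
     (\<forall>i\<in>free_pvars \<phi>. Inl (e i) \<in> A \<and> f (Inl (e i)) = Inl (e' i)) \<and>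
     (\<forall>i\<in>free_lvars \<phi>. Inr (h i) \<in> A \<and> f (Inr (h i)) = Inr (h' i))"

text \<open>Each quantifier spends one round, answered by \<open>position_forth\<close> or
  \<open>position_back\<close>. Preservation of sides ensures that points are answered by points and
  lines by lines.\<close>

lemma sat_position:
  assumes "position r k f A" "quantifier_rank \<phi> \<le> r" "matching A f \<phi> e h e' h'"
  shows "sat M e h \<phi> \<longleftrightarrow> sat N e' h' \<phi>"
  using assms
proof (induction \<phi> arbitrary: r k f A e h e' h')
  case (EqP i j)
  then have "f (Inl (e i)) = f (Inl (e j)) \<longleftrightarrow> Inl (e i) = (Inl (e j) :: 'p + 'l)"
    by (intro positionD(4)[OF EqP(1)]) (auto simp: matching_def)
  then show ?case using EqP(3) by (simp add: matching_def)
next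
  case (EqL i j)
  then have "f (Inr (h i)) = f (Inr (h j)) \<longleftrightarrow> Inr (h i) = (Inr (h j) :: 'p + 'l)"
    by (intro positionD(4)[OF EqL(1)]) (auto simp: matching_def)
  then show ?case using EqL(3) by (simp add: matching_def)
next
  case (Inc i j)
  then have "incident N (f (Inl (e i))) (f (Inr (h j))) \<longleftrightarrow> incident M (Inl (e i)) (Inr (h j))"
    by (intro positionD(3)[OF Inc(1)]) (auto simp: matching_def)
  then show ?case using Inc(3) by (simp add: matching_def)
next
  case (Neg \<phi>)
  have "sat M e h \<phi> \<longleftrightarrow> sat N e' h' \<phi>"
    by (rule Neg.IH[OF Neg.prems(1)]) (use Neg.prems in \<open>simp_all add: matching_def\<close>)
  then show ?case by simp
next
  case (Con \<phi> \<psi>)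
  have "sat M e h \<phi> \<longleftrightarrow> sat N e' h' \<phi>"
    by (rule Con.IH(1)[OF Con.prems(1)]) (use Con.prems in \<open>simp_all add: matching_def\<close>)
  moreover have "sat M e h \<psi> \<longleftrightarrow> sat N e' h' \<psi>"
    by (rule Con.IH(2)[OF Con.prems(1)]) (use Con.prems in \<open>simp_all add: matching_def\<close>)
  ultimately show ?case by simp
next
  case (ExP i \<phi>)
  then obtain r' where r': "r = Suc r'" "quantifier_rank \<phi> \<le> r'" by (cases r) auto
  note pos = ExP.prems(1)[unfolded r'(1)]
  have step: "sat M (e(i := p)) h \<phi> \<longleftrightarrow> sat N (e'(i := q)) h' \<phi>"
    if "position r' (Suc k) g (insert (Inl p) A)" "g (Inl p) = Inl q" "\<forall>x\<in>A. g x = f x" for g p q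
    by (rule ExP.IH[OF that(1) r'(2)]) (use ExP.prems(3) that(2,3) in \<open>auto simp: matching_def\<close>)
  show ?case
  proof
    assume "sat M e h (ExP i \<phi>)"
    then obtain p where p: "p \<in> points M" "sat M (e(i := p)) h \<phi>" by auto
    then obtain g where g: "position r' (Suc k) g (insert (Inl p) A)" "\<forall>x\<in>A. g x = f x"
      using position_forth[OF pos, of "Inl p"] by auto
    have "g (Inl p) \<in> vertices N" "isl (g (Inl p))" using positionD(1,2)[OF g(1), of "Inl p" "Inl p"] by auto
    then obtain q where "g (Inl p) = Inl q" "q \<in> points N" by (cases "g (Inl p)") auto
    then show "sat N e' h' (ExP i \<phi>)" using step[OF g(1) _ g(2)] p(2) by auto
  next
    assume "sat N e' h' (ExP i \<phi>)"
    then obtain q where q: "q \<in> points N" "sat N (e'(i := q)) h' \<phi>" by auto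
    then obtain a g where g: "a \<in> vertices M" "g a = Inl q" "position r' (Suc k) g (insert a A)"
      "\<forall>x\<in>A. g x = f x"
      using position_back[OF pos, of "Inl q"] by auto
    have "isl a" using positionD(2)[OF g(3), of a a] g(2) by auto
    then obtain p where p: "a = Inl p" "p \<in> points M" using g(1) by (cases a) auto
    then show "sat M e h (ExP i \<phi>)" using step[of g p q] g q(2) by auto
  qed
next
  case (ExL i \<phi>)
  then obtain r' where r': "r = Suc r'" "quantifier_rank \<phi> \<le> r'" by (cases r) auto
  note pos = ExL.prems(1)[unfolded r'(1)]
  have step: "sat M e (h(i := p)) \<phi> \<longleftrightarrow> sat N e' (h'(i := q)) \<phi>"
    if "position r' (Suc k) g (insert (Inr p) A)" "g (Inr p) = Inr q" "\<forall>x\<in>A. g x = f x" for g p q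
    by (rule ExL.IH[OF that(1) r'(2)]) (use ExL.prems(3) that(2,3) in \<open>auto simp: matching_def\<close>)
  show ?case
  proof
    assume "sat M e h (ExL i \<phi>)"
    then obtain p where p: "p \<in> lines M" "sat M e (h(i := p)) \<phi>" by auto
    then obtain g where g: "position r' (Suc k) g (insert (Inr p) A)" "\<forall>x\<in>A. g x = f x"
      using position_forth[OF pos, of "Inr p"] by auto
    have "g (Inr p) \<in> vertices N" "\<not> isl (g (Inr p))" using positionD(1,2)[OF g(1), of "Inr p" "Inr p"] by auto
    then obtain q where "g (Inr p) = Inr q" "q \<in> lines N" by (cases "g (Inr p)") auto
    then show "sat N e' h' (ExL i \<phi>)" using step[OF g(1) _ g(2)] p(2) by auto
  next
    assume "sat N e' h' (ExL i \<phi>)"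
    then obtain q where q: "q \<in> lines N" "sat N e' (h'(i := q)) \<phi>" by auto
    then obtain a g where g: "a \<in> vertices M" "g a = Inr q" "position r' (Suc k) g (insert a A)"
      "\<forall>x\<in>A. g x = f x"
      using position_back[OF pos, of "Inr q"] by auto
    have "\<not> isl a" using positionD(2)[OF g(3), of a a] g(2) by auto
    then obtain p where p: "a = Inr p" "p \<in> lines M" using g(1) by (cases a) auto
    then show "sat M e h (ExL i \<phi>)" using step[of g p q] g q(2) by auto
  qed
qed

lemma elementarily_equivalent:
  assumes "L_structure M" "L_structure N" "sentence \<phi>"
  shows "holds M \<phi> \<longleftrightarrow> holds N \<phi>"
proof -
  obtain e :: "nat \<Rightarrow> 'p" and h :: "nat \<Rightarrow> 'l" where eh: "range e \<subseteq> points M" "range h \<subseteq> lines M"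
    using L_structure_assignment[OF assms(1)] by blast
  obtain e' :: "nat \<Rightarrow> 'q" and h' :: "nat \<Rightarrow> 'k" where eh': "range e' \<subseteq> points N" "range h' \<subseteq> lines N"
    using L_structure_assignment[OF assms(2)] by blast
  have "matching {} undefined \<phi> e h e' h'" using assms(3) by (simp add: matching_def sentence_def)
  from sat_position[OF position_empty order_refl this]
  have "sat M e h \<phi> \<longleftrightarrow> sat N e' h' \<phi>" .
  then show ?thesis using holds_sentence[OF assms(1,3) eh] holds_sentence[OF assms(2,3) eh'] by simp
qed

end


section \<open>A free plane on the natural numbers\<close>

text \<open>
  Vertex \<open>k\<close> of the free construction is new and isolated when it is added, unless \<open>k\<close> is the
  turn of a pair of earlier vertices on the same side without a common neighbour; then it joins
  that pair. Every pair has infinitely many turns.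
\<close>

definition turn :: "nat \<Rightarrow> nat \<times> nat" where
  "turn k = prod_decode (fst (prod_decode k))"

text \<open>The condition \<open>4 \<le> k\<close> makes the first four vertices isolated on arrival
  and puts them on one side; they become the quadrangle.\<close>

definition to_join :: "nat \<Rightarrow> (nat \<times> nat) set \<times> (nat \<Rightarrow> bool) \<Rightarrow> bool" where
  "to_join k S \<longleftrightarrow> (case (turn k, S) of ((i, j), E, s) \<Rightarrow>
     4 \<le> k \<and> i < k \<and> j < k \<and> i \<noteq> j \<and> s i = s j \<and> \<not> (\<exists>z. (i, z) \<in> E \<and> (j, z) \<in> E))"

definition add_vertex ::
  "nat \<Rightarrow> (nat \<times> nat) set \<times> (nat \<Rightarrow> bool) \<Rightarrow> (nat \<times> nat) set \<times> (nat \<Rightarrow> bool)" where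
  "add_vertex k S = (case (turn k, S) of ((i, j), E, s) \<Rightarrow>
     if to_join k S then (E \<union> {(k, i), (k, j), (i, k), (j, k)}, s(k := \<not> s i))
     else (E, s(k := True)))"

primrec stage :: "nat \<Rightarrow> (nat \<times> nat) set \<times> (nat \<Rightarrow> bool)" where
  "stage 0 = ({}, \<lambda>_. True)"
| "stage (Suc k) = add_vertex k (stage k)"

definition free_adj :: "nat \<Rightarrow> nat \<Rightarrow> bool" where
  "free_adj x y \<longleftrightarrow> (\<exists>k. (x, y) \<in> fst (stage k))"

definition free_side :: "nat \<Rightarrow> bool" where
  "free_side x = snd (stage (Suc x)) x"

lemma turn_surj: "\<exists>k\<ge>m. turn k = (i, j)"
proof -
  have "turn (prod_encode (prod_encode (i, j), m)) = (i, j)" by (simp add: turn_def)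
  moreover have "m \<le> prod_encode (prod_encode (i, j), m)" by (rule le_prod_encode_2)
  ultimately show ?thesis by blast
qed

lemma stage_Suc_cases:
  obtains (join) i j where "i < k" "j < k" "i \<noteq> j" "4 \<le> k" "snd (stage k) i = snd (stage k) j"
    "\<not> (\<exists>z. (i, z) \<in> fst (stage k) \<and> (j, z) \<in> fst (stage k))"
    "fst (stage (Suc k)) = fst (stage k) \<union> {(k, i), (k, j), (i, k), (j, k)}"
    "snd (stage (Suc k)) = (snd (stage k))(k := \<not> snd (stage k) i)" "turn k = (i, j)"
  | (isolated) "fst (stage (Suc k)) = fst (stage k)" "snd (stage (Suc k)) = (snd (stage k))(k := True)"
    "\<not> to_join k (stage k)"
proof (cases "to_join k (stage k)")
  case True
  then show ?thesis
    by (intro join[of "fst (turn k)" "snd (turn k)"])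
      (auto simp: to_join_def add_vertex_def split: prod.splits)
next
  case False
  then show ?thesis
    by (intro isolated) (auto simp: add_vertex_def split: prod.splits)
qed

lemma stage_bound: "(x, y) \<in> fst (stage k) \<Longrightarrow> x < k \<and> y < k"
proof (induction k)
  case (Suc k)
  then show ?case by (cases rule: stage_Suc_cases[of k]) (auto simp del: stage.simps)
qed simp

lemma stage_mono: "k \<le> m \<Longrightarrow> fst (stage k) \<subseteq> fst (stage m)"
proof (rule lift_Suc_mono_le)
  show "fst (stage n) \<subseteq> fst (stage (Suc n))" for n
    by (cases rule: stage_Suc_cases[of n]) (auto simp del: stage.simps)
qed

lemma stage_restrict: "(x, y) \<in> fst (stage m) \<Longrightarrow> x < k \<Longrightarrow> y < k \<Longrightarrow> (x, y) \<in> fst (stage k)"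
proof (induction m)
  case (Suc m)
  show ?case
  proof (cases "m < k")
    case True
    then show ?thesis using stage_mono[of "Suc m" k] Suc.prems(1) by auto
  next
    case False
    then have "(x, y) \<in> fst (stage m)"
      using Suc.prems by (cases rule: stage_Suc_cases[of m]) (auto simp del: stage.simps)
    then show ?thesis using Suc by blast
  qed
qed simp

lemma free_adj_iff: "x < k \<Longrightarrow> y < k \<Longrightarrow> free_adj x y \<longleftrightarrow> (x, y) \<in> fst (stage k)"
  using stage_restrict unfolding free_adj_def by blast

lemma free_adj_sym: "free_adj x y \<Longrightarrow> free_adj y x"
proof -
  have "(x, y) \<in> fst (stage k) \<Longrightarrow> (y, x) \<in> fst (stage k)" for k
  proof (induction k)
    case (Suc k)
    then show ?case by (cases rule: stage_Suc_cases[of k]) (auto simp del: stage.simps)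
  qed simp
  then show "free_adj x y \<Longrightarrow> free_adj y x" unfolding free_adj_def by blast
qed

lemma stage_side: "x < k \<Longrightarrow> snd (stage k) x = free_side x"
proof (induction k)
  case (Suc k)
  show ?case
  proof (cases "x = k")
    case False
    then have "snd (stage (Suc k)) x = snd (stage k) x"
      by (cases rule: stage_Suc_cases[of k]) (auto simp del: stage.simps)
    then show ?thesis using Suc False by simp
  qed (simp add: free_side_def)
qed simp

text \<open>This local description replaces the stages in the proofs of unique joins, of openness
  and of the quadrangle: each vertex has at most two earlier neighbours.\<close>

lemma free_vertex_cases:
  obtains (join) i j where "i < k" "j < k" "i \<noteq> j" "4 \<le> k" "free_side i = free_side j"
    "free_side k \<noteq> free_side i" "\<And>z. z < k \<Longrightarrow> \<not> (free_adj i z \<and> free_adj j z)"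
    "\<And>z. z \<le> k \<Longrightarrow> free_adj k z \<longleftrightarrow> z = i \<or> z = j"
  | (isolated) "free_side k" "\<And>z. z \<le> k \<Longrightarrow> \<not> free_adj k z"
proof (cases rule: stage_Suc_cases[of k])
  case (join i j)
  have adj: "free_adj x y \<longleftrightarrow> (x, y) \<in> fst (stage (Suc k))" if "x \<le> k" "y \<le> k" for x y
    using that by (intro free_adj_iff) auto
  have no: "(k, z) \<notin> fst (stage k)" for z using stage_bound by blast
  show ?thesis
  proof (rule that(1)[OF join(1-4)])
    show "free_side i = free_side j" "free_side k \<noteq> free_side i"
      using join stage_side[of i k] stage_side[of j k] stage_side[of k "Suc k"] by auto
    show "\<not> (free_adj i z \<and> free_adj j z)" if "z < k" for z
      using join(1,2,6) that free_adj_iff[of i k z] free_adj_iff[of j k z] by blast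
    show "free_adj k z \<longleftrightarrow> z = i \<or> z = j" if "z \<le> k" for z
      using adj[of k z] that no join(1-3) unfolding join(7) by auto
  qed
next
  case isolated
  show ?thesis
  proof (rule that(2))
    show "free_side k" using isolated stage_side[of k "Suc k"] by simp
    show "\<not> free_adj k z" if "z \<le> k" for z
      using free_adj_iff[of k "Suc k" z] that stage_bound[of k z k] isolated(1) by auto
  qed
qed

text \<open>Two common neighbours of a pair form a 4-cycle. Seen from its largest vertex
  \<open>k\<close>, the cycle neighbours \<open>x\<close>, \<open>y\<close> are the pair that
  \<open>k\<close> was added to join, and that pair had no common neighbour before.\<close>

lemma free_join_unique_max:
  assumes "x < k" "y < k" "x \<noteq> y" "free_adj k x" "free_adj k y" "w < k" "free_adj x w" "free_adj y w"
  shows False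
proof (cases rule: free_vertex_cases[of k])
  case (join i j)
  then have "{x, y} = {i, j}" using assms(1-5) join(8)[of x] join(8)[of y] by auto
  then show False using join(7)[OF assms(6)] assms(7,8) by (auto simp: doubleton_eq_iff)
next
  case isolated
  then show False using assms(1,4) by auto
qed

lemma free_adj_irrefl_side:
  assumes "free_adj x y"
  shows "free_side x \<noteq> free_side y"
proof -
  have less: "free_side k \<noteq> free_side z" if "free_adj k z" "z \<le> k" for k z
    using that by (cases rule: free_vertex_cases[of k]) auto
  show ?thesis using less[of x y] less[of y x] assms free_adj_sym by (metis nat_le_linear)
qed

interpretation free_plane: open_plane_graph UNIV free_adj free_side
proof -
  interpret plane_graph UNIV free_adj free_side
  proof
    fix x y z w
    show "free_adj x y \<Longrightarrow> free_adj y x" by (rule free_adj_sym)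
    show "free_adj x y \<Longrightarrow> x \<in> UNIV" by simp
    show "free_adj x y \<Longrightarrow> free_side x \<noteq> free_side y" by (rule free_adj_irrefl_side)
    show "z = w" if adj: "x \<noteq> y" "free_adj x z" "free_adj y z" "free_adj x w" "free_adj y w"
    proof (rule ccontr)
      assume "z \<noteq> w"
      have ne: "x \<noteq> z" "x \<noteq> w" "y \<noteq> z" "y \<noteq> w" using adj free_adj_irrefl_side by blast+
      note sym = adj(2-5)[THEN free_adj_sym]
      \<comment> \<open>The cases name the largest vertex of the 4-cycle: \<open>z\<close>,
        \<open>w\<close>, \<open>x\<close> or \<open>y\<close>.\<close>
      consider "x < z" "y < z" "w < z" | "x < w" "y < w" "z < w" | "z < x" "w < x" "y < x"
        | "z < y" "w < y" "x < y"
        using ne adj(1) \<open>z \<noteq> w\<close> by linarith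
      then show False
      proof cases
        case 1
        then show False using free_join_unique_max[of x z y w] adj sym by blast
      next
        case 2
        then show False using free_join_unique_max[of x w y z] adj sym by blast
      next
        case 3
        then show False using free_join_unique_max[of z x w y] adj sym \<open>z \<noteq> w\<close> by blast
      next
        case 4
        then show False using free_join_unique_max[of z y w x] adj sym \<open>z \<noteq> w\<close> by blast
      qed
    qed
    show "\<exists>z. free_adj x z \<and> free_adj y z"
      if xy: "x \<in> UNIV" "y \<in> UNIV" "x \<noteq> y" "free_side x = free_side y"
    proof -
      obtain k where k: "4 + x + y + 1 \<le> k" "turn k = (x, y)" using turn_surj by blast
      then have lt: "4 \<le> k" "x < k" "y < k" by auto
      show ?thesis
      proof (cases rule: stage_Suc_cases[of k])
        case (join i j)
        then have "(x, k) \<in> fst (stage (Suc k))" "(y, k) \<in> fst (stage (Suc k))" using k(2) by auto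
        then show ?thesis unfolding free_adj_def by blast
      next
        \<comment> \<open>At its own turn a pair is passed over only because it already has a common
          neighbour.\<close>
        case isolated
        then have "\<exists>z. (x, z) \<in> fst (stage k) \<and> (y, z) \<in> fst (stage k)"
          using lt k(2) xy(3,4) stage_side[of x k] stage_side[of y k]
          by (auto simp: to_join_def split: prod.splits)
        then show ?thesis unfolding free_adj_def by blast
      qed
    qed
  qed
  show "open_plane_graph UNIV free_adj free_side"
  proof
    fix C :: "nat set"
    assume C: "finite C" "\<And>c. c \<in> C \<Longrightarrow> 3 \<le> card {y \<in> C. free_adj c y}"
    show "C = {}"
    proof (rule ccontr)
      assume "C \<noteq> {}"
      \<comment> \<open>All neighbours of the youngest vertex in \<open>C\<close> are older, so
        there are at most two.\<close>
      define k where "k = Max C"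
      have k: "k \<in> C" "\<And>c. c \<in> C \<Longrightarrow> c \<le> k" using C(1) \<open>C \<noteq> {}\<close> by (auto simp: k_def)
      have "card {y \<in> C. free_adj k y} \<le> 2"
      proof (cases rule: free_vertex_cases[of k])
        case (join i j)
        then have "{y \<in> C. free_adj k y} \<subseteq> {i, j}" using k(2) by auto
        then have "card {y \<in> C. free_adj k y} \<le> card {i, j}" by (intro card_mono) auto
        also have "\<dots> \<le> 2" by (simp add: card_insert_if)
        finally show ?thesis .
      next
        case isolated
        then have "{y \<in> C. free_adj k y} = {}" using k(2) by auto
        then show ?thesis by (simp only: card.empty)
      qed
      then show False using C(2)[OF k(1)] by simp
    qed
  next
    have small: "free_side k" "\<And>z. z \<le> k \<Longrightarrow> \<not> free_adj k z" if "k < 4" for k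
      using that by (cases rule: free_vertex_cases[of k]; simp)+
    have nc: "\<not> (free_adj x m \<and> free_adj y m \<and> free_adj z m)"
      if "x < 4" "y < 4" "z < 4" "x \<noteq> y" "x \<noteq> z" "y \<noteq> z" for x y z m
    proof
      assume "free_adj x m \<and> free_adj y m \<and> free_adj z m"
      then have adj: "free_adj m x" "free_adj m y" "free_adj m z" "free_adj x m" by (auto dest: free_adj_sym)
      show False
      proof (cases rule: free_vertex_cases[of m])
        case (join i j)
        then have "x \<le> m" "y \<le> m" "z \<le> m" using that by auto
        then show False using join(8) adj that by metis
      next
        case isolated
        then have "free_side x = False" using free_adj_irrefl_side[OF adj(1)] by simp
        then show False using small that by simp
      qed
    qed
    have "quad 0 1 2 3"
      unfolding quad_def
    proof (intro conjI allI)
      fix m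
      show "\<not> (free_adj 0 m \<and> free_adj 1 m \<and> free_adj 2 m)" "\<not> (free_adj 0 m \<and> free_adj 1 m \<and> free_adj 3 m)"
        "\<not> (free_adj 0 m \<and> free_adj 2 m \<and> free_adj 3 m)" "\<not> (free_adj 1 m \<and> free_adj 2 m \<and> free_adj 3 m)"
        by (rule nc; simp)+
    qed (use small(1) in simp_all)
    then show "\<exists>a b c d. quad a b c d" by blast
  qed
qed

section \<open>Consistency and completeness\<close>

definition free_structure :: "(nat, nat) incidence_structure" where
  "free_structure = \<lparr>points = {x. free_side x}, lines = {x. \<not> free_side x},
     incid = {(p, l). free_side p \<and> \<not> free_side l \<and> free_adj p l}\<rparr>"

lemma free_structure_model: "model_of free_structure open_projective_planes_theory"
proof -
  let ?M = free_structure
  have join: "\<exists>!l. l \<in> lines ?M \<and> (p, l) \<in> incid ?M \<and> (q, l) \<in> incid ?M"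
    if pq: "p \<in> points ?M" "q \<in> points ?M" "p \<noteq> q" for p q
  proof -
    obtain l where l: "free_adj p l" "free_adj q l"
      using free_plane.join_obtain[of p q] pq by (auto simp: free_structure_def)
    show ?thesis
    proof (rule ex1I[of _ l])
      show "l \<in> lines ?M \<and> (p, l) \<in> incid ?M \<and> (q, l) \<in> incid ?M"
        using l pq free_plane.adj_side[OF l(1)] by (simp add: free_structure_def)
      show "k = l" if "k \<in> lines ?M \<and> (p, k) \<in> incid ?M \<and> (q, k) \<in> incid ?M" for k
        using that free_plane.join_unique[OF pq(3) _ _ l] by (simp add: free_structure_def)
    qed
  qed
  have meet: "\<exists>!p. p \<in> points ?M \<and> (p, l) \<in> incid ?M \<and> (p, k) \<in> incid ?M"
    if lk: "l \<in> lines ?M" "k \<in> lines ?M" "l \<noteq> k" for l k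
  proof -
    obtain p where p: "free_adj l p" "free_adj k p"
      using free_plane.join_obtain[of l k] lk by (auto simp: free_structure_def)
    show ?thesis
    proof (rule ex1I[of _ p])
      show "p \<in> points ?M \<and> (p, l) \<in> incid ?M \<and> (p, k) \<in> incid ?M"
        using p lk free_plane.adj_side[OF p(1)] by (simp add: free_structure_def free_adj_sym)
      show "q = p" if "q \<in> points ?M \<and> (q, l) \<in> incid ?M \<and> (q, k) \<in> incid ?M" for q
        using that free_plane.join_unique[OF lk(3) _ _ p] free_adj_sym by (simp add: free_structure_def)
    qed
  qed
  have sys: "incidence_system ?M" by (auto simp: incidence_system_def free_structure_def)
  then have partial: "partial_plane ?M"
    unfolding partial_plane_def using join meet by blast
  then have "projective_plane ?M" unfolding projective_plane_def using join meet by blast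
  moreover have "open_plane ?M"
    unfolding open_plane_def
  proof (intro conjI notI partial, elim exE conjE)
    fix A assume A: "subconfiguration A ?M" "confined A"
    then have side: "\<And>p. p \<in> points A \<Longrightarrow> free_side p" "\<And>l. l \<in> lines A \<Longrightarrow> \<not> free_side l"
      and incA: "\<And>p l. (p, l) \<in> incid A \<longleftrightarrow> p \<in> points A \<and> l \<in> lines A \<and> free_adj p l"
      by (auto simp: subconfiguration_def free_structure_def)
    have "points A \<union> lines A = {}"
    proof (rule free_plane.no_confined)
      show "finite (points A \<union> lines A)" using A(2) by (simp add: confined_def)
      fix c assume "c \<in> points A \<union> lines A"
      then show "3 \<le> card {y \<in> points A \<union> lines A. free_adj c y}"
      proof
        assume c: "c \<in> points A"
        then have "y \<notin> points A" if "free_adj c y" for y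
          using side(1) free_plane.adj_side[OF that] by auto
        then have "{l \<in> lines A. (c, l) \<in> incid A} = {y \<in> points A \<union> lines A. free_adj c y}"
          using c by (auto simp: incA)
        then show ?thesis using A(2) c by (auto simp: confined_def)
      next
        assume c: "c \<in> lines A"
        then have "y \<notin> lines A" if "free_adj c y" for y
          using side(2) free_plane.adj_side[OF that] by auto
        moreover have "(p, c) \<in> incid A \<longleftrightarrow> p \<in> points A \<and> free_adj c p" for p
          using c incA free_adj_sym by blast
        ultimately have "{p \<in> points A. (p, c) \<in> incid A} = {y \<in> points A \<union> lines A. free_adj c y}"
          by auto
        then show ?thesis using A(2) c by (auto simp: confined_def)
      qed
    qed simp
    then show False using A(2) by (simp add: confined_def)
  qed
  moreover have "nondegenerate ?M"
  proof -
    obtain a b c d where "free_plane.quad a b c d" using free_plane.ex_quad by blast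
    \<comment> \<open>The abstract quadrangle might consist of lines; its dual then consists of
      points.\<close>
    then obtain a b c d where q: "free_plane.quad a b c d" "free_side a"
      using free_plane.quad_dual by metis
    note q' = free_plane.quadD[OF q(1)]
    show ?thesis
      unfolding nondegenerate_def
    proof (rule bexI[of _ a], rule bexI[of _ b], rule bexI[of _ c], rule bexI[of _ d])
      show "distinct [a, b, c, d] \<and> \<not> collinear3 ?M a b c \<and> \<not> collinear3 ?M a b d \<and>
        \<not> collinear3 ?M a c d \<and> \<not> collinear3 ?M b c d"
        using q'(5-10,14-17) by (auto simp: collinear3_def free_structure_def)
    qed (use q(2) q'(11-13) in \<open>auto simp: free_structure_def\<close>)
  qed
  ultimately show ?thesis unfolding model_of_open_projective_planes_theory by blast
qed

text \<open>Infinite carrier types contain injective copies of the natural numbers, along which the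
  free plane is transported.\<close>

lemma consistent_open_projective_planes_theory:
  assumes "infinite (UNIV :: 'p set)" and "infinite (UNIV :: 'l set)"
  shows "consistent TYPE('p \<times> 'l) open_projective_planes_theory"
proof -
  obtain f :: "nat \<Rightarrow> 'p" and g :: "nat \<Rightarrow> 'l" where "inj f" "inj g"
    using infinite_countable_subset[OF assms(1)] infinite_countable_subset[OF assms(2)] by blast
  then have "model_of (map_structure f g free_structure) open_projective_planes_theory"
    using free_structure_model
    by (auto simp: model_of_def L_structure_map_structure holds_map_structure
        sentence_open_projective_planes_theory)
  then show ?thesis unfolding consistent_def by blast
qed

text \<open>Any two models agree on every sentence, so a sentence that holds in one model holds in
  all, and otherwise its negation does.\<close>

theorem theorem1p1:
  assumes "infinite (UNIV :: 'p set)" and "infinite (UNIV :: 'l set)"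
  shows "complete_theory TYPE('p \<times> 'l) open_projective_planes_theory"
  unfolding complete_theory_def entails_def
proof (intro conjI allI impI)
  show "consistent TYPE('p \<times> 'l) open_projective_planes_theory"
    using assms by (rule consistent_open_projective_planes_theory)
  fix \<phi> assume \<phi>: "sentence \<phi>"
  have equiv: "holds M \<phi> \<longleftrightarrow> holds N \<phi>"
    if M: "model_of M open_projective_planes_theory" and N: "model_of N open_projective_planes_theory"
    for M N :: "('p, 'l) incidence_structure"
  proof -
    have "open_plane_graph (vertices M) (incident M) isl" "open_plane_graph (vertices N) (incident N) isl"
      using M N open_plane_graph_of_structure unfolding model_of_open_projective_planes_theory by blast+
    then interpret open_plane_pair M N
      by (simp add: open_plane_pair_def open_plane_graph_pair_def)
    show ?thesis using elementarily_equivalent M N \<phi> by (simp add: model_of_def)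
  qed
  show "(\<forall>M :: ('p, 'l) incidence_structure. model_of M open_projective_planes_theory \<longrightarrow> holds M \<phi>) \<or>
    (\<forall>M :: ('p, 'l) incidence_structure. model_of M open_projective_planes_theory \<longrightarrow> holds M (Neg \<phi>))"
    using equiv holds_Neg[OF _ \<phi>] unfolding model_of_def by metis
qed

end
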